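(* Assume the Riemann Hypothesis. For each integer $n\ge 0$, let $C_n$ be the coefficient defined by the Laurent expansion about $s=1$ of the secondary zeta function $Z(s)$, $$Z(s)=\frac{1}{2\pi(s-1)^2}-\frac{\log(2\pi)}{2\pi(s-1)}+\sum_{n=0}^{\infty}C_n\frac{(s-1)^n}{n!}.$$ Then for every integer $n\ge 0$, $$C_n=\lim_{T\to\infty}(-1)^n\left\{\sum_{0<\gamma<T}\frac{\log^n(\gamma)}{\gamma}-\frac{1}{2\pi(n+1)(n+2)}\log^{n+1}(T)\log\left(\frac{T^{n+1}}{(2\pi)^{n+2}}\right)\right\},$$ where the sum runs over the imaginary parts $\gamma$ of the non-trivial zeros of the Riemann zeta function with $0<\gamma<T$, counted with multiplicity.
   Context: The Riemann Hypothesis (RH) is a standing assumption: every non-trivial zero of the Riemann zeta function $\zeta$ has the form $\rho=\tfrac12+i\gamma$ with $\gamma$ real. Sums over $\gamma>0$ or $0<\gamma<T$ run over the positive imaginary parts of the non-trivial zeros of $\zeta$, counted with multiplicity. The notation $\log^k(x)$ means $(\log x)^k$. The secondary zeta function is defined by $$Z(s)=\sum_{\gamma>0}\frac{1}{\gamma^s},$$ which converges absolutely for $\Re(s)>1$. It is known that $Z$ extends analytically to $\mathbb{C}\setminus\{1,-1,-3,-5,\ldots\}$, with a double pole at $s=1$ and simple poles at the negative odd integers, and that its principal part at $s=1$ is $\frac{1}{2\pi(s-1)^2}-\frac{\log(2\pi)}{2\pi(s-1)}$. The power series $\sum_{n\ge0} C_n (s-1)^n/n!$ is the regular part of $Z$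 at $s=1$. *)

theory Defs
  imports "HOL-Complex_Analysis.Complex_Analysis"
begin

text \<open>
  The Riemann zeta function is the (unique) analytic continuation of its Dirichlet series to the
  plane without the point 1. The value at 1 is left unspecified, which is why 1 is excluded
  explicitly from the set of zeros below.
\<close>

definition is_zeta :: "(complex \<Rightarrow> complex) \<Rightarrow> bool" where
  "is_zeta f \<longleftrightarrow> f holomorphic_on - {1} \<and>
     (\<forall>s. Re s > 1 \<longrightarrow> (\<lambda>n. 1 / of_nat (Suc n) powr s) sums f s)"

definition zeta :: "complex \<Rightarrow> complex" where
  "zeta = (SOME f. is_zeta f)"

definition nontrivial_zeros :: "complex set" where
  "nontrivial_zeros =
     {\<rho>. \<rho> \<noteq> 1 \<and> zeta \<rho> = 0 \<and> (\<nexists>k::nat. k \<ge> 1 \<and> \<rho> = - of_nat (2 * k))}"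

definition riemann_hypothesis :: bool where
  "riemann_hypothesis \<longleftrightarrow> (\<forall>\<rho>\<in>nontrivial_zeros. Re \<rho> = 1 / 2)"

text \<open>
  Sums over positive imaginary parts, counted with multiplicity, are sums over the distinct
  non-trivial zeros in the upper half plane, each weighted by its order.
\<close>

definition upper_zeros :: "complex set" where
  "upper_zeros = {\<rho> \<in> nontrivial_zeros. Im \<rho> > 0}"

definition zero_sum :: "(real \<Rightarrow> real) \<Rightarrow> real \<Rightarrow> real" where
  "zero_sum f T =
     (\<Sum>\<rho> | \<rho> \<in> upper_zeros \<and> Im \<rho> < T. of_int (zorder zeta \<rho>) * f (Im \<rho>))"

text \<open>
  The conditions determine \<open>Z\<close> on the whole of the connected domain, so that a function
  satisfying them is \<^emph>\<open>the\<close> secondary zeta function.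
\<close>

definition is_secondary_zeta :: "(complex \<Rightarrow> complex) \<Rightarrow> bool" where
  "is_secondary_zeta Z \<longleftrightarrow>
     Z holomorphic_on - insert 1 (range (\<lambda>k::nat. - of_nat (2 * k + 1))) \<and>
     (\<forall>s. Re s > 1 \<longrightarrow>
        ((\<lambda>\<rho>. of_int (zorder zeta \<rho>) * (1 / of_real (Im \<rho>) powr s)) has_sum Z s) upper_zeros)"

end

(*
Under the Riemann Hypothesis the theorem follows from any counting estimate
N(T) = (T log(T / 2 pi) - T) / (2 pi) + O(T^(3/4)) for the positive ordinates: Abel summation then
shows that the truncated sums  SUM_{g < T} g^(-s)  minus their main term converge locally uniformly
for Re s > 9/10; by the identity theorem the limit is the regular part of Z, and Cauchy's
inequality transfers the convergence to the n-th derivatives at s = 1.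

For the estimate, the zeta function is continued to Re s > -1 by the trapezoidal rule, and the
functional equation is proved for real s in (-1,0), where all integrands are nonnegative, by
evaluating the Mellin transform of 1/(e^x - 1) - 1/x + 1/2 in two ways. The completed function
G(z) = xi(1/2 + z) is even of order less than 2, so G'/G is the limit of its symmetric partial
fractions. Integrating the real part along Re s = 2, where Stirling's formula gives the argument of
xi, yields  SUM_g (arctan((T-g)/(3/2)) + arctan((T+g)/(3/2))) = (T log(T / 2 pi) - T) / 2 + O(1),
and comparing T with T +- sqrt T turns these smoothed counts into N(T).
*)
theory Submission
  imports Defs
begin

section \<open>The Mellin transform of the Bernoulli kernel\<close>

text \<open>The strip -1 < s < 0 is where the Mellin integral converges: the kernel vanishes
  linearly at 0 and tends to 1/2 at infinity. Both of its expansions, into trapezoidal errors of exp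
  (- t x) and into partial fractions, have nonnegative terms, so Tonelli's theorem replaces
  convergence arguments. Evenness of G removes the linear exponential factor of a Hadamard product:
  the logarithmic derivative of the zero-free part vanishes at 0, so it is controlled by a second
  derivative of size R^(3/2 - 2), which tends to 0. The obstacle in counting is that a smoothed
  count sees zeros far from T. The a priori bound N(T) = O(T^(5/4)) is read off from the convergence
  of the series of Z at s = 5/4; a window of length sqrt T then costs T^(5/4 - 1/2). As 3/4 < 9/10,
  the error integral converges for Re s > 9/10, which leaves a disc around s = 1 for Cauchy's
  inequality. Integrating log (t / 2 pi) t^(-s) / (2 pi) from t = 1 gives exactly the prescribed
  principal part of Z, so no constant is left over to correct C_0.\<close>

text \<open>Two integrations by parts against the parabola \<open>p\<close>, which vanishes at both
  ends and has second derivative -1, leave the error of the one-step trapezoidal rule. The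
  antiderivative \<open>U\<close> stands in for the integral of \<open>u\<close>.\<close>

lemma trapezoid_has_integral:
  fixes u U u1 u2 :: "real \<Rightarrow> 'a::banach"
  assumes U: "\<And>t. t \<in> {a..a+1} \<Longrightarrow> (U has_vector_derivative u t) (at t within {a..a+1})"
    and u: "\<And>t. t \<in> {a..a+1} \<Longrightarrow> (u has_vector_derivative u1 t) (at t within {a..a+1})"
    and u1: "\<And>t. t \<in> {a..a+1} \<Longrightarrow> (u1 has_vector_derivative u2 t) (at t within {a..a+1})"
  shows "((\<lambda>t. ((t - a) * (a + 1 - t) / 2) *\<^sub>R u2 t) has_integral
           ((1/2) *\<^sub>R (u a + u (a+1)) - (U (a+1) - U a))) {a..a+1}"
proof -
  define p where "p = (\<lambda>t. (t - a) * (a + 1 - t) / 2)"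
  define q where "q = (\<lambda>t. (1 + 2 * a - 2 * t) / 2)"
  define F where "F = (\<lambda>t. p t *\<^sub>R u1 t - q t *\<^sub>R u t - U t)"
  have p: "(p has_vector_derivative q t) (at t within {a..a+1})" for t
    unfolding p_def q_def has_real_derivative_iff_has_vector_derivative[symmetric]
    by (auto intro!: derivative_eq_intros simp: field_simps)
  have q: "(q has_vector_derivative - 1) (at t within {a..a+1})" for t
    unfolding q_def has_real_derivative_iff_has_vector_derivative[symmetric]
    by (auto intro!: derivative_eq_intros simp: field_simps)
  have "(F has_vector_derivative p t *\<^sub>R u2 t) (at t within {a..a+1})" if "t \<in> {a..a+1}" for t
    unfolding F_def
    by (rule has_vector_derivative_eq_rhs,
        (rule has_vector_derivative_diff has_vector_derivative_scaleR
           U u u1 p[unfolded has_real_derivative_iff_has_vector_derivative[symmetric]]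
           q[unfolded has_real_derivative_iff_has_vector_derivative[symmetric]] that)+)
       (simp add: algebra_simps)
  then have "((\<lambda>t. p t *\<^sub>R u2 t) has_integral (F (a+1) - F a)) {a..a+1}"
    by (intro fundamental_theorem_of_calculus) auto
  moreover have "F (a+1) - F a = (1/2) *\<^sub>R (u a + u (a+1)) - (U (a+1) - U a)"
    by (simp add: F_def p_def q_def algebra_simps flip: scaleR_add_left)
  ultimately show ?thesis by (simp add: p_def)
qed

text \<open>The Peano kernel of the trapezoidal rule on [n, n + 1]. Its nonnegativity there is what
  makes Tonelli's theorem applicable below.\<close>

definition trapezoid_weight :: "nat \<Rightarrow> real \<Rightarrow> real" where
  "trapezoid_weight n t = (t - real n) * (real n + 1 - t) / 2"

lemma trapezoid_weight_nonneg: "t \<in> {real n..real n + 1} \<Longrightarrow> trapezoid_weight n t \<ge> 0"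
  by (auto simp: trapezoid_weight_def)

lemma trapezoid_weight_le: "trapezoid_weight n t \<le> 1 / 8"
proof -
  have "0 \<le> (t - real n - 1/2)\<^sup>2" by simp
  then show ?thesis by (simp add: trapezoid_weight_def power2_eq_square field_simps)
qed

lemma trapezoid_weight_measurable [measurable]: "trapezoid_weight n \<in> borel_measurable borel"
  unfolding trapezoid_weight_def by measurable

text \<open>The trapezoidal error of t^(-s) / (s (s + 1)) on [n, n + 1], in closed form. The
  interval [0, 1] is kept apart because the derivatives of t^(-s) are singular at 0.\<close>

definition trapezoid_moment :: "real \<Rightarrow> nat \<Rightarrow> real" where
  "trapezoid_moment s n = (if n = 0 then 1 / (2 * s * (s - 1)) else
     ((s - 1) * (real n powr - s + (real n + 1) powr - s) / 2
        - (real n powr (1 - s) - (real n + 1) powr (1 - s))) / (s * (s + 1) * (s - 1)))"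

text \<open>For \<open>n > 0\<close> this is the trapezoidal identity. For \<open>n = 0\<close> one
  factor t of the weight tames the singularity, and t^(-s-1) is integrable at 0 because s <
  0.\<close>

lemma nn_integral_trapezoid_moment:
  assumes s: "-1 < s" "s < 0"
  shows "(\<integral>\<^sup>+t. ennreal (trapezoid_weight n t * t powr (- s - 2)) * indicator {real n..real n + 1} t \<partial>lborel)
           = ennreal (trapezoid_moment s n)"
    and "trapezoid_moment s n \<ge> 0"
proof -
  have *: "((\<lambda>t. trapezoid_weight n t * t powr (- s - 2)) has_integral trapezoid_moment s n)
          {real n..real n + 1}"
  proof (cases "n = 0")
    case True
    have "((\<lambda>t. (t powr (- s - 1) - t powr (- s)) * (1/2)) has_integral
        (1 powr (- s - 1 + 1) / (- s - 1 + 1) - 1 powr (- s + 1) / (- s + 1)) * (1/2)) {0..1::real}"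
      using s by (intro has_integral_diff has_integral_powr_from_0 has_integral_mult_left) auto
    also have "(1 powr (- s - 1 + 1) / (- s - 1 + 1) - 1 powr (- s + 1) / (- s + 1)) * (1/2) = trapezoid_moment s n"
    proof -
      have nz: "s \<noteq> 0" "1 - s \<noteq> 0" "s - 1 \<noteq> 0" using s by auto
      have "1 / (- s) - 1 / (1 - s) = 1 / (s * (s - 1))"
        using nz by (simp add: divide_simps)
      then show ?thesis using True by (simp add: trapezoid_moment_def)
    qed
    also have "((\<lambda>t. (t powr (- s - 1) - t powr (- s)) * (1/2)) has_integral trapezoid_moment s n) {0..1::real}
       \<longleftrightarrow> ((\<lambda>t. trapezoid_weight n t * t powr (- s - 2)) has_integral trapezoid_moment s n) {0..1::real}"
    proof (rule has_integral_cong)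
      fix t :: real assume t: "t \<in> {0..1}"
      have 1: "t powr (- s - 1) = t * t powr (- s - 2)"

      proof (cases "t = 0")
        case False
        have "t powr (- s - 1) = t powr (1 + (- s - 2))"
          by (rule arg_cong[where f = "(powr) t"]) simp
        also have "\<dots> = t powr 1 * t powr (- s - 2)" by (rule powr_add)
        finally show ?thesis using t by simp
      qed simp
      have 2: "t powr (- s) = t * t powr (- s - 1)"

      proof (cases "t = 0")
        case False
        have "t powr (- s) = t powr (1 + (- s - 1))"
          by (rule arg_cong[where f = "(powr) t"]) simp
        also have "\<dots> = t powr 1 * t powr (- s - 1)" by (rule powr_add)
        finally show ?thesis using t by simp
      qed simp
      from 1 2 have "t powr (- s - 1) = t * t powr (- s - 2)" "t powr (-s) = t * (t * t powr (- s - 2))"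
        by simp_all
      then show "(t powr (- s - 1) - t powr - s) * (1/2) = trapezoid_weight n t * t powr (- s - 2)"
        using True by (simp add: trapezoid_weight_def algebra_simps)
    qed
    finally show ?thesis using True by simp
  next
    case False
    then have pos: "t > 0" if "t \<in> {real n..real n + 1}" for t using that by auto
    define U where "U = (\<lambda>t. (1 / ((1 - s) * s * (s + 1))) * t powr (1 - s))"
    define u where "u = (\<lambda>t. (1 / (s * (s + 1))) * t powr (- s))"
    define u1 where "u1 = (\<lambda>t. (- 1 / (s + 1)) * t powr (- s - 1))"
    have "(U has_vector_derivative u t) (at t within {real n..real n + 1})"
      "(u has_vector_derivative u1 t) (at t within {real n..real n + 1})"
      "(u1 has_vector_derivative t powr (- s - 2)) (at t within {real n..real n + 1})"
      if "t \<in> {real n..real n + 1}" for t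
    proof -
      have t: "t > 0" using pos[OF that] .
      have D: "((\<lambda>t. c * t powr w) has_vector_derivative (c * (w * t powr (w - 1)))) (at t within A)" for c w A
        unfolding has_real_derivative_iff_has_vector_derivative[symmetric]
        by (intro DERIV_cmult has_field_derivative_at_within[OF has_real_derivative_powr[OF t]])
      have e: "1 - s - 1 = - s" "- s - 1 - 1 = - s - 2" by simp_all
      have nz: "s \<noteq> 0" "1 - s \<noteq> 0" "s + 1 \<noteq> 0" using s by auto
      have "u t = (1 / ((1 - s) * s * (s + 1))) * ((1 - s) * t powr (- s))"
        "u1 t = (1 / (s * (s + 1))) * (- s * t powr (- s - 1))"
        using nz by (simp_all add: u_def u1_def)
      moreover have "(- 1 / (s + 1)) * ((- s - 1) * t powr (- s - 2)) = t powr (- s - 2)"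
      proof -
        have "(- 1 / (s + 1)) * ((- s - 1) * X) = X" for X :: real using nz(3) by (simp add: divide_simps) (simp add: algebra_simps)
        then show ?thesis .
      qed
      ultimately show "(U has_vector_derivative u t) (at t within {real n..real n + 1})"
        "(u has_vector_derivative u1 t) (at t within {real n..real n + 1})"
        "(u1 has_vector_derivative t powr (- s - 2)) (at t within {real n..real n + 1})"
        using D[of "1 / ((1 - s) * s * (s + 1))" "1 - s"] D[of "1 / (s * (s + 1))" "- s"] D[of "- 1 / (s + 1)" "- s - 1"]
        unfolding e U_def [symmetric] u_def [symmetric] u1_def [symmetric] by (simp_all only:)
    qed
    from trapezoid_has_integral[OF this]
    have "((\<lambda>t. ((t - real n) * (real n + 1 - t) / 2) *\<^sub>R t powr (- s - 2)) has_integral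
           ((1/2) *\<^sub>R (u (real n) + u (real n +1)) - (U (real n +1) - U (real n)))) {real n..real n +1}" .
    moreover have "(1/2) *\<^sub>R (u (real n) + u (real n +1)) - (U (real n +1) - U (real n)) = trapezoid_moment s n"
    proof -
      have nz: "s \<noteq> 0" "1 - s \<noteq> 0" "s - 1 \<noteq> 0" "s + 1 \<noteq> 0" using s by auto
      have "(1/2) * (1 / (s * (s + 1)) * A + 1 / (s * (s + 1)) * B) - (1 / ((1 - s) * s * (s + 1)) * D - 1 / ((1 - s) * s * (s + 1)) * C)
         = ((s - 1) * (A + B) / 2 - (C - D)) / (s * (s + 1) * (s - 1))" for A B C D :: real
        using nz by (simp add: divide_simps) (simp add: algebra_simps)
      then show ?thesis using False
        unfolding U_def u_def trapezoid_moment_def real_scaleR_def by (simp only: if_False)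
    qed
    ultimately show ?thesis by (simp add: trapezoid_weight_def)
  qed
  then show "(\<integral>\<^sup>+t. ennreal (trapezoid_weight n t * t powr (- s - 2)) * indicator {real n..real n + 1} t \<partial>lborel)
           = ennreal (trapezoid_moment s n)"
    by (rule nn_integral_has_integral_lebesgue'[rotated]) (simp add: trapezoid_weight_nonneg)
  show "trapezoid_moment s n \<ge> 0"
    using * by (rule has_integral_nonneg) (simp add: trapezoid_weight_nonneg)
qed

text \<open>The trapezoidal error of t -> exp (- t x) on [n, n + 1].\<close>

definition trapezoid_exp :: "real \<Rightarrow> nat \<Rightarrow> real" where
  "trapezoid_exp x n = (exp (- real n * x) + exp (- (real n + 1) * x)) / 2
      - (exp (- real n * x) - exp (- (real n + 1) * x)) / x"

lemma trapezoid_exp_measurable [measurable]: "(\<lambda>x. trapezoid_exp x n) \<in> borel_measurable borel"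
  unfolding trapezoid_exp_def by measurable

lemma nn_integral_trapezoid_exp:
  assumes x: "x > 0"
  shows "(\<integral>\<^sup>+t. ennreal (trapezoid_weight n t * (x\<^sup>2 * exp (- t * x))) * indicator {real n..real n + 1} t \<partial>lborel)
           = ennreal (trapezoid_exp x n)"
    and "trapezoid_exp x n \<ge> 0"
proof -
  have *: "((\<lambda>t. trapezoid_weight n t * (x\<^sup>2 * exp (- t * x))) has_integral trapezoid_exp x n)
          {real n..real n + 1}"
  proof -
    define U where "U = (\<lambda>t. - exp (- t * x) / x)"
    define u where "u = (\<lambda>t. exp (- t * x))"
    define u1 where "u1 = (\<lambda>t. - x * exp (- t * x))"
    have "(U has_vector_derivative u t) (at t within {real n..real n + 1})"
      "(u has_vector_derivative u1 t) (at t within {real n..real n + 1})"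
      "(u1 has_vector_derivative x\<^sup>2 * exp (- t * x)) (at t within {real n..real n + 1})" for t
      using x unfolding U_def u_def u1_def has_real_derivative_iff_has_vector_derivative[symmetric]
      by (auto intro!: derivative_eq_intros simp: power2_eq_square)
    from trapezoid_has_integral[OF this]
    have "((\<lambda>t. ((t - real n) * (real n + 1 - t) / 2) *\<^sub>R (x\<^sup>2 * exp (- t * x))) has_integral
           ((1/2) *\<^sub>R (u (real n) + u (real n +1)) - (U (real n +1) - U (real n)))) {real n..real n +1}" .
    moreover have "(1/2) *\<^sub>R (u (real n) + u (real n +1)) - (U (real n +1) - U (real n)) = trapezoid_exp x n"
    proof -
      have "- (real n + 1) * x = - ((real n + 1) * x)" by (simp add: algebra_simps)
      then show ?thesis using x
        by (simp only: U_def u_def trapezoid_exp_def) (simp add: field_simps)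
    qed
    ultimately show ?thesis by (simp add: trapezoid_weight_def)
  qed
  then show "(\<integral>\<^sup>+t. ennreal (trapezoid_weight n t * (x\<^sup>2 * exp (- t * x))) * indicator {real n..real n + 1} t \<partial>lborel)
           = ennreal (trapezoid_exp x n)"
    using x by (intro nn_integral_has_integral_lebesgue') (simp_all add: trapezoid_weight_nonneg)
  show "trapezoid_exp x n \<ge> 0"
    using * by (rule has_integral_nonneg) (simp add: trapezoid_weight_nonneg)
qed

text \<open>Euler's integral after the scaling x -> t x, kept as a nonnegative Lebesgue integral so
  that it can serve as the inner integral in Tonelli's theorem.\<close>

lemma nn_integral_powr_exp:
  assumes a: "a > 0" and t: "t > (0::real)"
  shows "(\<integral>\<^sup>+x. ennreal (x powr (a - 1) * exp (- t * x)) * indicator {0<..} x \<partial>lborel)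
           = ennreal (Gamma a * t powr - a)"
proof -
  let ?f = "\<lambda>x. ennreal (x powr (a - 1) * exp (- t * x)) * indicator {0<..} x"
  let ?q = "\<lambda>x. indicator {0..} (0 + t * x) * (0 + t * x) powr (a - 1) / exp (0 + t * x)"
  have "(\<integral>\<^sup>+x. ennreal (indicator {0..} x * x powr (a - 1) / exp x) \<partial>lborel) = ennreal (Gamma a)"
    by (simp add: Gamma_conv_nn_integral_real a)
  also have "(\<integral>\<^sup>+x. ennreal (indicator {0..} x * x powr (a - 1) / exp x) \<partial>lborel)
     = ennreal t * (\<integral>\<^sup>+x. ennreal (?q x) \<partial>lborel)"
    using t by (subst nn_integral_real_affine[where c = t and t = 0]) (auto)
  also have "\<dots> = (\<integral>\<^sup>+x. ennreal t * ennreal (?q x) \<partial>lborel)"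
    by (rule nn_integral_cmult[symmetric]) simp
  also have "\<dots> = (\<integral>\<^sup>+x. ennreal (t powr a) * ?f x \<partial>lborel)"
  proof (rule nn_integral_cong)
    fix x :: real
    consider "x < 0" | "x = 0" | "x > 0" by linarith
    then show "ennreal t * ennreal (?q x)
      = ennreal (t powr a) * ?f x"
    proof cases
      case 1
      then have "t * x < 0" using t by (simp add: mult_pos_neg)
      then show ?thesis using 1 by simp
    next
      case 3
      have e: "(t * x) powr (a - 1) = t powr (a - 1) * x powr (a - 1)" using 3 t by (simp add: powr_mult)
      have "t * t powr (a - 1) = t powr a" using t powr_add[of t 1 "a - 1"] by simp
      then have "t * ((t * x) powr (a - 1) / exp (t * x)) = t powr a * (x powr (a - 1) * exp (- t * x))"
        unfolding e by (simp add: exp_minus divide_inverse mult.assoc[symmetric])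
      moreover have "t * x \<ge> 0" using 3 t by simp
      ultimately show ?thesis using 3 t by (simp flip: ennreal_mult)
    qed simp
  qed
  also have "\<dots> = ennreal (t powr a) * (\<integral>\<^sup>+x. ?f x \<partial>lborel)"
    by (rule nn_integral_cmult) auto
  finally have eq: "ennreal (Gamma a) = ennreal (t powr a) *
      (\<integral>\<^sup>+x. ?f x \<partial>lborel)"
    by (rule sym)
  have "ennreal (Gamma a * t powr - a) = ennreal (t powr - a) * ennreal (Gamma a)"
    using a by (simp add: mult.commute flip: ennreal_mult)
  also have "\<dots> = ennreal (t powr - a * t powr a) *
      (\<integral>\<^sup>+x. ?f x \<partial>lborel)"
    unfolding eq by (simp add: ennreal_mult mult.assoc)
  also have "t powr - a * t powr a = 1" using t by (simp add: powr_minus)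
  finally show ?thesis by simp
qed

text \<open>Writing \<open>trapezoid_exp\<close> as an integral over t and exchanging the order
  makes the x-integral a Gamma integral. The second derivative x^2 exp (- t x) raises the exponent,
  hence Gamma (s + 2).\<close>

lemma nn_integral_Mellin_trapezoid_exp:
  assumes s: "-1 < s" "s < 0"
  shows "(\<integral>\<^sup>+x. ennreal (trapezoid_exp x n * x powr (s - 1)) * indicator {0<..} x \<partial>lborel)
           = ennreal (Gamma (s + 2) * trapezoid_moment s n)"
proof -
  define J where "J = {real n..real n + 1}"
  have [measurable]: "J \<in> sets borel" by (simp add: J_def)
  let ?h = "\<lambda>x t. ennreal (trapezoid_weight n t * (x powr (s + 1) * exp (- t * x))) * indicator J t * indicator {0<..} x"
  have "(\<integral>\<^sup>+x. ennreal (trapezoid_exp x n * x powr (s - 1)) * indicator {0<..} x \<partial>lborel)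
     = (\<integral>\<^sup>+x. (\<integral>\<^sup>+t. ?h x t \<partial>lborel) \<partial>lborel)"
  proof (rule nn_integral_cong)
    fix x :: real
    show "ennreal (trapezoid_exp x n * x powr (s - 1)) * indicator {0<..} x =
      (\<integral>\<^sup>+t. ?h x t \<partial>lborel)"
    proof (cases "x > 0")
      case True
      have "ennreal (trapezoid_exp x n * x powr (s - 1)) * indicator {0<..} x =
         (\<integral>\<^sup>+t. ennreal (trapezoid_weight n t * (x\<^sup>2 * exp (- t * x))) * indicator J t \<partial>lborel) * ennreal (x powr (s - 1))"
        using nn_integral_trapezoid_exp[OF True, of n] True by (simp add: J_def ennreal_mult)
      also have "\<dots> = (\<integral>\<^sup>+t. ennreal (trapezoid_weight n t * (x\<^sup>2 * exp (- t * x))) * indicator J t * ennreal (x powr (s - 1)) \<partial>lborel)"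
        by (rule nn_integral_multc[symmetric]) auto
      also have "\<dots> = (\<integral>\<^sup>+t. ?h x t \<partial>lborel)"
      proof (rule nn_integral_cong)
        fix t
        have "x powr (s + 1) = x\<^sup>2 * x powr (s - 1)"
          using True powr_add[of x 2 "s - 1"] by (simp add: powr_numeral add.commute)
        then show "ennreal (trapezoid_weight n t * (x\<^sup>2 * exp (- t * x))) * indicator J t * ennreal (x powr (s - 1))
          = ?h x t"
          using True by (auto split: split_indicator simp: J_def trapezoid_weight_nonneg mult_ac simp flip: ennreal_mult)
      qed
      finally show ?thesis .
    qed auto
  qed
  also have "\<dots> = (\<integral>\<^sup>+t. (\<integral>\<^sup>+x. ?h x t \<partial>lborel) \<partial>lborel)"
    by (rule lborel_pair.Fubini') measurable
  also have "\<dots> = (\<integral>\<^sup>+t. ennreal (Gamma (s + 2)) * (ennreal (trapezoid_weight n t * t powr (- s - 2)) * indicator J t) \<partial>lborel)"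
  proof (rule nn_integral_cong_AE)
    \<comment> \<open>Euler's integral needs t > 0; the endpoint t = 0, which occurs for n = 0, is
      discarded as a null set.\<close>
    have "AE t in lborel. t \<noteq> (0::real)" by (rule AE_lborel_singleton)
    then show "AE t in lborel. (\<integral>\<^sup>+x. ?h x t \<partial>lborel)
      = ennreal (Gamma (s + 2)) * (ennreal (trapezoid_weight n t * t powr (- s - 2)) * indicator J t)"
    proof eventually_elim
      case (elim t)
      show ?case
      proof (cases "t \<in> J")
        case True
        with elim have t: "t > 0" and w: "trapezoid_weight n t \<ge> 0"
          by (auto simp: J_def trapezoid_weight_nonneg)
        have "(\<integral>\<^sup>+x. ?h x t \<partial>lborel)
          = (\<integral>\<^sup>+x. ennreal (trapezoid_weight n t) * (ennreal (x powr (s + 2 - 1) * exp (- t * x)) * indicator {0<..} x) \<partial>lborel)"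
          using True w by (intro nn_integral_cong) (auto split: split_indicator simp: add_ac simp flip: ennreal_mult)
        also have "\<dots> = ennreal (trapezoid_weight n t) * ennreal (Gamma (s + 2) * t powr - (s + 2))"
          using s t by (subst nn_integral_cmult) (simp_all only: nn_integral_powr_exp, auto)
        also have "\<dots> = ennreal (Gamma (s + 2)) * (ennreal (trapezoid_weight n t * t powr (- s - 2)) * indicator J t)"
          using True w s by (simp add: mult_ac flip: ennreal_mult)
        finally show ?thesis .
      qed auto
    qed
  qed
  also have "\<dots> = ennreal (Gamma (s + 2)) * ennreal (trapezoid_moment s n)"
    using nn_integral_trapezoid_moment[OF s, of n]
    by (subst nn_integral_cmult) (simp_all add: J_def)
  also have "\<dots> = ennreal (Gamma (s + 2) * trapezoid_moment s n)"
    using s nn_integral_trapezoid_moment[OF s, of n] by (simp flip: ennreal_mult)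
  finally show ?thesis .
qed

text \<open>A geometric series: interior endpoints are counted twice with weight 1/2, the endpoint 0
  only once, and the integrals add up to 1/x.\<close>

lemma trapezoid_exp_sums:
  assumes x: "x > 0"
  shows "trapezoid_exp x sums (1 / (exp x - 1) - 1 / x + 1 / 2)"
proof -
  define q where "q = exp (- x)"
  have q: "0 < q" "q < 1" using x by (auto simp: q_def)
  have *: "trapezoid_exp x n = q ^ n * ((1 + q) / 2 - (1 - q) / x)" for n
  proof -
    have "exp (- real n * x) = q ^ n" by (simp add: q_def exp_of_nat_mult[symmetric])
    moreover have "exp (- (real n + 1) * x) = q ^ n * q"
      by (simp add: q_def exp_of_nat_mult[symmetric] exp_add[symmetric] algebra_simps)
    ultimately show ?thesis by (simp only: trapezoid_exp_def) (simp add: algebra_simps diff_divide_distrib)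
  qed
  have "(\<lambda>n. q ^ n * ((1 + q) / 2 - (1 - q) / x)) sums (1 / (1 - q) * ((1 + q) / 2 - (1 - q) / x))"
    using q by (intro sums_mult2 geometric_sums) auto
  moreover have "1 / (1 - q) * ((1 + q) / 2 - (1 - q) / x) = 1 / (exp x - 1) - 1 / x + 1 / 2"
    using x q by (simp add: q_def exp_minus field_simps)
  ultimately show ?thesis by (simp add: * [abs_def])
qed

lemma nn_integral_Mellin_bernoulli:
  assumes s: "-1 < s" "s < 0"
  shows "(\<integral>\<^sup>+x. ennreal ((1 / (exp x - 1) - 1 / x + 1 / 2) * x powr (s - 1)) * indicator {0<..} x \<partial>lborel)
           = (\<Sum>n. ennreal (Gamma (s + 2) * trapezoid_moment s n))"
proof -
  have "(\<integral>\<^sup>+x. ennreal ((1 / (exp x - 1) - 1 / x + 1 / 2) * x powr (s - 1)) * indicator {0<..} x \<partial>lborel)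
    = (\<integral>\<^sup>+x. (\<Sum>n. ennreal (trapezoid_exp x n * x powr (s - 1)) * indicator {0<..} x) \<partial>lborel)"
  proof (rule nn_integral_cong)
    fix x :: real
    show "ennreal ((1 / (exp x - 1) - 1 / x + 1 / 2) * x powr (s - 1)) * indicator {0<..} x
      = (\<Sum>n. ennreal (trapezoid_exp x n * x powr (s - 1)) * indicator {0<..} x)"
    proof (cases "x > 0")
      case True
      have "(\<lambda>n. trapezoid_exp x n * x powr (s - 1)) sums ((1 / (exp x - 1) - 1 / x + 1 / 2) * x powr (s - 1))"
        by (intro sums_mult2 trapezoid_exp_sums True)
      then have "(\<Sum>n. ennreal (trapezoid_exp x n * x powr (s - 1)))
          = ennreal ((1 / (exp x - 1) - 1 / x + 1 / 2) * x powr (s - 1))"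
        using nn_integral_trapezoid_exp(2)[OF True] by (intro suminf_ennreal_eq) auto
      then show ?thesis using True by simp
    qed auto
  qed
  also have "\<dots> = (\<Sum>n. (\<integral>\<^sup>+x. ennreal (trapezoid_exp x n * x powr (s - 1)) * indicator {0<..} x \<partial>lborel))"
    by (rule nn_integral_suminf) auto
  finally show ?thesis by (simp add: nn_integral_Mellin_trapezoid_exp[OF s])
qed

section \<open>Partial fractions of the kernel and the second evaluation of its Mellin
  transform\<close>

text \<open>The logarithmic derivative of the reflection formula, which says that Gamma z * Gamma (1
  - z) * sin (pi z) is constant near z.\<close>

lemma Digamma_reflection_complex:
  fixes z :: complex
  assumes z: "z \<notin> \<int>"
  shows "(Digamma (1 - z) - Digamma z) * sin (of_real pi * z) = of_real pi * cos (of_real pi * z)"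
proof -
  have z1: "z \<notin> \<int>\<^sub>\<le>\<^sub>0" "1 - z \<notin> \<int>\<^sub>\<le>\<^sub>0"
    using z Ints_diff[of 1 "1 - z"] by (auto dest!: nonpos_Ints_Int)
  have "((\<lambda>w. Gamma w * Gamma (1 - w) * sin (of_real pi * w)) has_field_derivative
      (Gamma z * Gamma (1 - z)) * ((Digamma z - Digamma (1 - z)) * sin (of_real pi * z) + of_real pi * cos (of_real pi * z))) (at z)"
    using z1 by (auto intro!: derivative_eq_intros simp: algebra_simps)
  moreover have "eventually (\<lambda>w. Gamma w * Gamma (1 - w) * sin (of_real pi * w) = of_real pi) (nhds z)"
  proof -
    have "eventually (\<lambda>w. w \<in> - \<int>) (nhds z)"
      using z by (intro eventually_nhds_in_open) (auto simp: closed_Ints)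
    then show ?thesis
    proof eventually_elim
      case (elim w)
      have "sin (of_real pi * w) \<noteq> 0"
      proof
        assume "sin (of_real pi * w) = 0"
        then obtain n :: int where "of_real pi * w = of_real (real_of_int n * pi)"
          by (auto simp: sin_eq_0)
        then have "w = of_int n" by simp
        then show False using elim by auto
      qed
      then show ?case by (subst Gamma_reflection_complex) simp
    qed
  qed
  ultimately have "((\<lambda>w. of_real pi) has_field_derivative
      (Gamma z * Gamma (1 - z)) * ((Digamma z - Digamma (1 - z)) * sin (of_real pi * z) + of_real pi * cos (of_real pi * z))) (at z)"
    by (subst (asm) DERIV_cong_ev[OF refl _ refl])
  then have "(Gamma z * Gamma (1 - z)) * ((Digamma z - Digamma (1 - z)) * sin (of_real pi * z) + of_real pi * cos (of_real pi * z)) = 0"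
    by (rule DERIV_unique) simp
  then have "(Digamma z - Digamma (1 - z)) * sin (of_real pi * z) + of_real pi * cos (of_real pi * z) = 0"
    using z1 by (simp add: Gamma_eq_zero_iff)
  then show ?thesis by (simp add: algebra_simps)
qed

text \<open>The kernel is coth (x / 2) / 2 - 1 / x. At z = i x / (2 pi) the digamma reflection
  formula becomes the cotangent expansion on the imaginary axis; the term 1 / z moves Digamma z to
  Digamma (1 + z), whose series is paired with that of Digamma (1 - z).\<close>

lemma bernoulli_kernel_sums:
  fixes x :: real
  assumes x: "x > 0"
  shows "(\<lambda>n. 2 * x / (x\<^sup>2 + (2 * pi * (real n + 1))\<^sup>2)) sums (1 / (exp x - 1) - 1 / x + 1 / 2)"
proof -
  define y where "y = x / (2 * pi)"
  define z where "z = \<i> * of_real y"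
  have y: "y > 0" using x by (simp add: y_def)
  have xy: "x = 2 * pi * y" by (simp add: y_def)
  have zI: "z \<notin> \<int>"
  proof
    assume "z \<in> \<int>"
    then obtain m where "z = of_int m" by (auto elim: Ints_cases)
    then have "Im z = 0" by simp
    then show False using y by (simp add: z_def)
  qed
  have z0: "z \<noteq> 0" "1 + z \<noteq> 0" "1 - z \<noteq> 0" using zI y by (auto simp: z_def complex_eq_iff)
  have "(\<lambda>n. (inverse (of_nat (Suc n)) - inverse (1 - z + of_nat n)) -
             (inverse (of_nat (Suc n)) - inverse (1 + z + of_nat n))) sums
        ((Digamma (1 - z) + euler_mascheroni) - (Digamma (1 + z) + euler_mascheroni))"
    using z0 summable_sums[OF summable_Digamma[of "1 - z"]] summable_sums[OF summable_Digamma[of "1 + z"]]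
    unfolding Digamma_def by (intro sums_diff) simp_all
  then have S: "(\<lambda>n. inverse (1 + z + of_nat n) - inverse (1 - z + of_nat n)) sums
        (Digamma (1 - z) - Digamma z - 1 / z)"
    using Digamma_plus1[OF z0(1)] by (simp add: add_ac diff_diff_eq)
  \<comment> \<open>\<open>E\<close> is exp (x / 2), so (E + 1/E) / (E - 1/E) is coth (x /
    2).\<close>
  define E where "E = exp (pi * y)"
  let ?c = "pi * (E + inverse E) / (E - inverse E) - 1 / y"
  let ?q = "\<lambda>n. 2 * y / ((real n + 1)\<^sup>2 + y\<^sup>2)"
  have E: "E > 1" using y by (simp add: E_def)
  have e1: "exp (\<i> * (of_real pi * z)) = of_real (inverse E)" "exp (- (\<i> * (of_real pi * z))) = of_real E"
  proof -
    have "\<i> * (of_real pi * z) = of_real (- (pi * y))"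
      by (simp add: z_def complex_eq_iff)
    then show "exp (\<i> * (of_real pi * z)) = of_real (inverse E)" "exp (- (\<i> * (of_real pi * z))) = of_real E"
      unfolding E_def by (simp_all only: exp_of_real exp_minus of_real_minus minus_minus of_real_inverse)
  qed
  have sn: "sin (of_real pi * z) = \<i> * of_real ((E - inverse E) / 2)"
    unfolding sin_exp_eq e1 by (simp add: field_simps)
  have cs: "cos (of_real pi * z) = of_real ((E + inverse E) / 2)"
    unfolding cos_exp_eq e1 by (simp add: field_simps)
  have "E - inverse E \<noteq> 0" using E by (simp add: field_simps)
     (metis less_irrefl mult_strict_mono mult_1 zero_less_one order_less_trans less_imp_le)
  then have ne: "of_real (E - inverse E) \<noteq> (0::complex)" by (metis of_real_eq_0_iff)
  have "(Digamma (1 - z) - Digamma z) * (\<i> * of_real ((E - inverse E) / 2)) = of_real pi * of_real ((E + inverse E) / 2)"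
    using Digamma_reflection_complex[OF zI] unfolding sn cs .
  then have "Digamma (1 - z) - Digamma z = - \<i> * of_real (pi * (E + inverse E) / (E - inverse E))"
  proof -
    have a: "E - inverse E \<noteq> 0" by (metis ne of_real_0)
    have inv: "(\<i> * of_real ((E - inverse E) / 2)) * (- \<i> * of_real (2 / (E - inverse E))) = 1"
    proof -
      have "(\<i> * of_real u) * (- \<i> * of_real v) = of_real (u * v)" for u v by (simp add: complex_eq_iff)
      then have "(\<i> * of_real ((E - inverse E) / 2)) * (- \<i> * of_real (2 / (E - inverse E)))
         = of_real ((E - inverse E) / 2 * (2 / (E - inverse E)))" .
      also have "(E - inverse E) / 2 * (2 / (E - inverse E)) = 1" using a by simp
      finally show ?thesis by simp
    qed
    have "Digamma (1 - z) - Digamma z = (Digamma (1 - z) - Digamma z) * ((\<i> * of_real ((E - inverse E) / 2)) * (- \<i> * of_real (2 / (E - inverse E))))"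
      unfolding inv by simp
    also have "\<dots> = of_real pi * of_real ((E + inverse E) / 2) * (- \<i> * of_real (2 / (E - inverse E)))"
      unfolding mult.assoc[symmetric] \<open>(Digamma (1 - z) - Digamma z) * (\<i> * of_real ((E - inverse E) / 2)) = of_real pi * of_real ((E + inverse E) / 2)\<close>[unfolded mult.assoc[symmetric]] ..
    also have "\<dots> = - \<i> * of_real (pi * ((E + inverse E) / 2) * (2 / (E - inverse E)))"
      by (simp only: of_real_mult mult_ac)
    also have "pi * ((E + inverse E) / 2) * (2 / (E - inverse E)) = pi * (E + inverse E) / (E - inverse E)"
      by simp
    finally show ?thesis .
  qed
  moreover have "1 / z = - \<i> * of_real (1 / y)"
    by (simp add: z_def divide_inverse)
  ultimately have D: "Digamma (1 - z) - Digamma z - 1 / z = - \<i> * of_real (?c)"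
    by (simp add: algebra_simps)
  have t: "inverse (1 + z + of_nat n) - inverse (1 - z + of_nat n) = - \<i> * of_real (?q n)" for n
  proof -
    have ne: "1 + z + of_nat n \<noteq> 0" "1 - z + of_nat n \<noteq> 0" using y by (auto simp: z_def complex_eq_iff)
    have "(1 + z + of_nat n) * (1 - z + of_nat n) = of_real ((real n + 1)\<^sup>2 + y\<^sup>2)"
      by (simp add: z_def power2_eq_square algebra_simps)
    moreover have "inverse (1 + z + of_nat n) - inverse (1 - z + of_nat n) = (-2 * z) / ((1 + z + of_nat n) * (1 - z + of_nat n))"
      using ne by (simp add: field_simps)
    ultimately show ?thesis by (simp add: z_def)
  qed
  have "(\<lambda>n. \<i> * (- \<i> * of_real (?q n))) sums
      (\<i> * (- \<i> * of_real (?c)))"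
    using S unfolding t D by (rule sums_mult)
  then have "(\<lambda>n. complex_of_real (?q n)) sums
      of_real (?c)"
    by (simp only: mult.assoc[symmetric] mult_minus_right i_squared minus_minus mult_1)
  then have "(\<lambda>n. ?q n) sums (?c)"
    unfolding sums_of_real_iff .
  then have "(\<lambda>n. 1 / (2 * pi) * (?q n)) sums (1 / (2 * pi) * (?c))"
    by (rule sums_mult)
  moreover have "1 / (2 * pi) * (?q n) = 2 * x / (x\<^sup>2 + (2 * pi * (real n + 1))\<^sup>2)" for n
  proof -
    have "x\<^sup>2 + (2 * pi * (real n + 1))\<^sup>2 = 4 * pi\<^sup>2 * ((real n + 1)\<^sup>2 + y\<^sup>2)"
    proof -
      have "(2 * pi * y)\<^sup>2 + (2 * pi * N)\<^sup>2 = 4 * pi\<^sup>2 * (N\<^sup>2 + y\<^sup>2)" for N :: real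
        by (simp add: power2_eq_square algebra_simps)
      then show ?thesis unfolding xy .
    qed
    then show ?thesis by (simp add: xy power2_eq_square)
  qed
  moreover have "1 / (2 * pi) * (?c) = 1 / (exp x - 1) - 1 / x + 1 / 2"
  proof -
    have ex: "exp x = E * E" by (simp add: E_def xy flip: exp_add)
    have EE: "E * E \<noteq> 1" using E by (metis less_irrefl mult_strict_mono mult_1 zero_less_one order_less_trans less_imp_le)
    have "(E + inverse E) / (E - inverse E) = (E * E + 1) / (E * E - 1)"
      using E EE by (simp add: field_simps)
    moreover have "1 / (2 * pi) * (pi * A / B - 1 / y) = (A / B) / 2 - 1 / x" for A B :: real
      by (simp add: xy right_diff_distrib)
    ultimately have "1 / (2 * pi) * (?c) = (E * E + 1) / (E * E - 1) / 2 - 1 / x"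
      by (simp only:)
    also have "(E * E + 1) / (E * E - 1) / 2 = 1 / (exp x - 1) + 1 / 2"
      unfolding ex using EE by (simp add: field_simps)
    finally show ?thesis by simp
  qed
  ultimately show ?thesis by (simp only:)
qed

text \<open>The substitution u = x^2 / (x^2 + c^2) turns the integral into a Beta integral with
  parameters a + b = 1, so its denominator Gamma (a + b) is 1.\<close>

lemma nn_integral_powr_quadratic:
  fixes s c :: real
  assumes s: "-1 < s" "s < 1" and c: "c > 0"
  shows "(\<integral>\<^sup>+x. ennreal (2 * x powr s / (x\<^sup>2 + c\<^sup>2)) * indicator {0<..} x \<partial>lborel)
           = ennreal (c powr (s - 1) * (Gamma ((1 + s) / 2) * Gamma ((1 - s) / 2)))"
proof -
  define a b where "a = (1 + s) / 2" and "b = (1 - s) / 2"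
  have ab: "a > 0" "b > 0" "a + b = 1" using s by (auto simp: a_def b_def field_simps)
  define f where "f = (\<lambda>u::real. u powr (a - 1) * (1 - u) powr (b - 1))"
  define g where "g = (\<lambda>x::real. x\<^sup>2 / (x\<^sup>2 + c\<^sup>2))"
  define g' where "g' = (\<lambda>x::real. 2 * x * c\<^sup>2 / (x\<^sup>2 + c\<^sup>2)\<^sup>2)"
  have pos: "x\<^sup>2 + c\<^sup>2 > 0" for x using c by (simp add: add_nonneg_pos)
  have f0: "f u \<ge> 0" for u by (simp add: f_def)
  have "(f has_integral Beta a b) {0<..<1}"
    using has_integral_Beta_real[OF ab(1,2)] unfolding f_def by (simp add: has_integral_Icc_iff_Ioo)
  moreover have img: "g ` {0<..} = {0<..<1}"
  proof (intro equalityI subsetI)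
    fix u assume "u \<in> {0<..<1::real}"
    then have u: "0 < u" "u < 1" by auto
    define x where "x = c * sqrt (u / (1 - u))"
    have "x > 0" using u c by (simp add: x_def)
    moreover have "x\<^sup>2 = c\<^sup>2 * (u / (1 - u))" using u by (simp add: x_def power_mult_distrib)
    then have "g x = u" using u c by (simp add: g_def field_simps)
    ultimately show "u \<in> g ` {0<..}" by auto
  qed (use c pos in \<open>auto simp: g_def\<close>)
  ultimately have "f absolutely_integrable_on (g ` {0<..}) \<and> integral (g ` {0<..}) f = Beta a b"
    using f0 by (auto intro!: nonnegative_absolutely_integrable_1 simp: has_integral_iff)
  moreover have "inj_on g {0<..}"
  proof (rule inj_onI)
    fix x y assume xy: "x \<in> {0<..}" "y \<in> {0<..}" "g x = g y"
    then have "x\<^sup>2 * (y\<^sup>2 + c\<^sup>2) = y\<^sup>2 * (x\<^sup>2 + c\<^sup>2)"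
      using pos[of x] pos[of y] by (simp add: g_def frac_eq_eq)
    then have "x\<^sup>2 = y\<^sup>2" using c by (simp add: algebra_simps)
    then show "x = y" using xy by (simp add: power2_eq_iff_nonneg)
  qed
  moreover have "(g has_field_derivative g' x) (at x within {0<..})" for x
  proof -
    have "x\<^sup>2 + c\<^sup>2 \<noteq> 0" using pos[of x] by (metis less_irrefl)
    then have "((\<lambda>x. x\<^sup>2 / (x\<^sup>2 + c\<^sup>2)) has_field_derivative
        (2 * x * (x\<^sup>2 + c\<^sup>2) - x\<^sup>2 * (2 * x)) / ((x\<^sup>2 + c\<^sup>2) * (x\<^sup>2 + c\<^sup>2))) (at x within {0<..})"
      by (intro DERIV_divide) (auto intro!: derivative_eq_intros)
    then show ?thesis unfolding g_def g'_def
      by (simp add: power2_eq_square algebra_simps)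
  qed
  ultimately have "(\<lambda>x. \<bar>g' x\<bar> * f (g x)) absolutely_integrable_on {0<..} \<and>
      integral {0<..} (\<lambda>x. \<bar>g' x\<bar> * f (g x)) = Beta a b"
    by (subst has_absolute_integral_change_of_variables_1') auto
  then have "((\<lambda>x. \<bar>g' x\<bar> * f (g x)) has_integral Beta a b) {0<..}"
    by (auto simp: has_integral_iff absolutely_integrable_on_def)
  then have I: "((\<lambda>x. c powr (s - 1) * (\<bar>g' x\<bar> * f (g x))) has_integral c powr (s - 1) * Beta a b) {0<..}"
    by (rule has_integral_mult_right)
  have "c powr (s - 1) * (\<bar>g' x\<bar> * f (g x)) = 2 * x powr s / (x\<^sup>2 + c\<^sup>2)" if "x \<in> {0<..}" for x
  proof -
    have x: "x > 0" using that by auto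
    define Q where "Q = x\<^sup>2 + c\<^sup>2"
    have Q: "Q > 0" using pos by (simp add: Q_def)
    have g1: "g x = x powr 2 * Q powr (-1)" using x Q by (simp add: g_def Q_def powr_minus divide_inverse)
    have "1 - g x = c\<^sup>2 / Q"
    proof -
      have "c\<^sup>2 = Q - x\<^sup>2" by (simp add: Q_def)
      then show ?thesis using Q unfolding g_def Q_def[symmetric] by (simp add: diff_divide_distrib)
    qed
    then have g2: "1 - g x = c powr 2 * Q powr (-1)" using c Q by (simp add: powr_minus divide_inverse)
    have "f (g x) = x powr (2 * (a - 1)) * c powr (2 * (b - 1)) * (Q powr (- (a - 1)) * Q powr (- (b - 1)))"
      unfolding f_def g2 unfolding g1 powr_mult powr_powr by (simp only: mult_minus1 mult_ac)
    also have "Q powr (- (a - 1)) * Q powr (- (b - 1)) = Q powr (2 - (a + b))"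
      by (simp add: algebra_simps flip: powr_add)
    also have "\<dots> = Q" using ab Q by simp
    also have "2 * (a - 1) = s - 1" by (simp add: a_def field_simps)
    also have "2 * (b - 1) = - 1 - s" by (simp add: b_def field_simps)
    finally have f1: "f (g x) = x powr (s - 1) * c powr (-1 - s) * Q" .
    have gp: "\<bar>g' x\<bar> = 2 * x * c powr 2 / Q\<^sup>2" using x c Q by (simp add: g'_def Q_def)
    have "c powr (s - 1) * (\<bar>g' x\<bar> * f (g x)) = 2 * (x powr 1 * x powr (s - 1)) * (c powr (s - 1) * c powr 2 * c powr (- 1 - s)) / Q"
      unfolding f1 gp using x Q by (simp add: power2_eq_square field_simps)
    also have "\<dots> = 2 * x powr s / Q"
    proof -
      have "x powr 1 * x powr (s - 1) = x powr s" unfolding powr_add[symmetric] by simp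
      moreover have "c powr (s - 1) * c powr 2 * c powr (- 1 - s) = 1"
        unfolding powr_add[symmetric] using c by simp
      ultimately show ?thesis by (simp only: mult_1_right)
    qed
    finally show ?thesis by (simp add: Q_def)
  qed
  then have "((\<lambda>x. 2 * x powr s / (x\<^sup>2 + c\<^sup>2)) has_integral c powr (s - 1) * Beta a b) {0<..}"
    by (intro has_integral_eq[OF _ I]) simp
  moreover have "Beta a b = Gamma a * Gamma b"
    using ab by (simp add: Beta_def)
  ultimately show ?thesis
    by (intro nn_integral_has_integral_lebesgue') (auto simp: a_def b_def)
qed

text \<open>Both expansions of the kernel are integrated term by term. The right-hand series is that
  of zeta at 1 - s > 1, while the left-hand one will be recognised as the continuation at s.\<close>

lemma Mellin_bernoulli_eq:
  fixes s :: real
  assumes s: "-1 < s" "s < 0"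
  shows "summable (trapezoid_moment s)"
    and "Gamma (s + 2) * (\<Sum>n. trapezoid_moment s n) =
      (2 * pi) powr (s - 1) * (Gamma ((1 + s) / 2) * Gamma ((1 - s) / 2)) * (\<Sum>n. (real n + 1) powr (s - 1))"
proof -
  define K where "K = (2 * pi) powr (s - 1) * (Gamma ((1 + s) / 2) * Gamma ((1 - s) / 2))"
  have K: "K \<ge> 0" using s by (simp add: K_def)
  define c where "c = (\<lambda>n. 2 * pi * (real n + 1))"
  have c: "c n > 0" for n by (simp add: c_def)
  have sm: "summable (\<lambda>n. K * (real n + 1) powr (s - 1))"
    using s summable_Suc_iff[of "\<lambda>n. real n powr (s - 1)"]
    by (intro summable_mult) (simp add: summable_real_powr_iff add.commute)
  have "(\<Sum>n. ennreal (Gamma (s + 2) * trapezoid_moment s n)) =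
    (\<integral>\<^sup>+x. ennreal ((1 / (exp x - 1) - 1 / x + 1 / 2) * x powr (s - 1)) * indicator {0<..} x \<partial>lborel)"
    by (rule nn_integral_Mellin_bernoulli[OF s, symmetric])
  also have "\<dots> = (\<integral>\<^sup>+x. (\<Sum>n. ennreal (2 * x powr s / (x\<^sup>2 + (c n)\<^sup>2)) * indicator {0<..} x) \<partial>lborel)"
  proof (rule nn_integral_cong)
    fix x :: real
    show "ennreal ((1 / (exp x - 1) - 1 / x + 1 / 2) * x powr (s - 1)) * indicator {0<..} x
      = (\<Sum>n. ennreal (2 * x powr s / (x\<^sup>2 + (c n)\<^sup>2)) * indicator {0<..} x)"
    proof (cases "x > 0")
      case True
      have "(\<lambda>n. 2 * x / (x\<^sup>2 + (c n)\<^sup>2) * x powr (s - 1)) sums ((1 / (exp x - 1) - 1 / x + 1 / 2) * x powr (s - 1))"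
        unfolding c_def by (intro sums_mult2 bernoulli_kernel_sums True)
      moreover have "2 * x / (x\<^sup>2 + (c n)\<^sup>2) * x powr (s - 1) = 2 * x powr s / (x\<^sup>2 + (c n)\<^sup>2)" for n
        using True powr_add[of x 1 "s - 1"] by (simp add: mult.assoc)
      ultimately have "(\<lambda>n. 2 * x powr s / (x\<^sup>2 + (c n)\<^sup>2)) sums ((1 / (exp x - 1) - 1 / x + 1 / 2) * x powr (s - 1))"
        by (simp only:)
      then have "(\<Sum>n. ennreal (2 * x powr s / (x\<^sup>2 + (c n)\<^sup>2)))
          = ennreal ((1 / (exp x - 1) - 1 / x + 1 / 2) * x powr (s - 1))"
        by (intro suminf_ennreal_eq) auto
      then show ?thesis using True by simp
    qed auto
  qed
  also have "\<dots> = (\<Sum>n. (\<integral>\<^sup>+x. ennreal (2 * x powr s / (x\<^sup>2 + (c n)\<^sup>2)) * indicator {0<..} x \<partial>lborel))"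
    by (rule nn_integral_suminf) auto
  also have "\<dots> = (\<Sum>n. ennreal (c n powr (s - 1) * (Gamma ((1 + s) / 2) * Gamma ((1 - s) / 2))))"
    using s c by (intro suminf_cong nn_integral_powr_quadratic) auto
  also have "\<dots> = (\<Sum>n. ennreal (K * (real n + 1) powr (s - 1)))"
  proof -
    have "c n powr (s - 1) = (2 * pi) powr (s - 1) * (real n + 1) powr (s - 1)" for n
      unfolding c_def by (rule powr_mult)
    then show ?thesis by (simp only: K_def mult_ac)
  qed
  also have "\<dots> = ennreal (\<Sum>n. K * (real n + 1) powr (s - 1))"
    using sm K by (intro suminf_ennreal2) auto
  finally have eq: "(\<Sum>n. ennreal (Gamma (s + 2) * trapezoid_moment s n)) = ennreal (\<Sum>n. K * (real n + 1) powr (s - 1))" .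
  have nn: "Gamma (s + 2) * trapezoid_moment s n \<ge> 0" for n
    using s nn_integral_trapezoid_moment(2)[OF s, of n] by simp
  \<comment> \<open>Summability comes for free: the nonnegative series equals a finite extended
    real.\<close>
  have "summable (\<lambda>n. Gamma (s + 2) * trapezoid_moment s n)"
    by (rule summable_suminf_not_top[OF nn]) (simp add: eq)
  moreover have G: "Gamma (s + 2) \<noteq> 0" using Gamma_real_pos[of "s + 2"] s by linarith
  ultimately show sT: "summable (trapezoid_moment s)"
    by (simp add: summable_cmult_iff)
  have "ennreal (\<Sum>n. Gamma (s + 2) * trapezoid_moment s n) = ennreal (\<Sum>n. K * (real n + 1) powr (s - 1))"
    using eq nn sT by (subst (asm) suminf_ennreal2) (auto intro: summable_mult)
  then have "(\<Sum>n. Gamma (s + 2) * trapezoid_moment s n) = (\<Sum>n. K * (real n + 1) powr (s - 1))"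
  proof (subst (asm) ennreal_inj)
    show "0 \<le> (\<Sum>n. Gamma (s + 2) * trapezoid_moment s n)"
      by (intro suminf_nonneg nn summable_mult sT)
    show "0 \<le> (\<Sum>n. K * (real n + 1) powr (s - 1))"
      by (intro suminf_nonneg sm mult_nonneg_nonneg K) simp
  qed
  also have "(\<Sum>n. K * (real n + 1) powr (s - 1)) = K * (\<Sum>n. (real n + 1) powr (s - 1))"
    using s summable_Suc_iff[of "\<lambda>n. real n powr (s - 1)"]
    by (intro suminf_mult) (simp add: summable_real_powr_iff add.commute)
  also have "(\<Sum>n. Gamma (s + 2) * trapezoid_moment s n) = Gamma (s + 2) * (\<Sum>n. trapezoid_moment s n)"
    by (intro suminf_mult sT)
  finally show "Gamma (s + 2) * (\<Sum>n. trapezoid_moment s n) =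
      (2 * pi) powr (s - 1) * (Gamma ((1 + s) / 2) * Gamma ((1 - s) / 2)) * (\<Sum>n. (real n + 1) powr (s - 1))"
    by (simp add: K_def)
qed

section \<open>Continuation of the zeta function by the trapezoidal rule\<close>

text \<open>The trapezoidal error of (s - 1) t^(-s) on [n + 1, n + 2]; the factor s - 1 cancels the
  pole of zeta and keeps the antiderivative - t^(1-s) free of a denominator.\<close>

definition zeta_trapezoid :: "nat \<Rightarrow> complex \<Rightarrow> complex" where
  "zeta_trapezoid n s =
     (s - 1) / 2 * (of_real (real n + 1) powr - s + of_real (real n + 1 + 1) powr - s)
       - (of_real (real n + 1) powr (1 - s) - of_real (real n + 1 + 1) powr (1 - s))"

lemma has_vector_derivative_of_real_powr:
  assumes "t > 0"
  shows "((\<lambda>t. of_real t powr w) has_vector_derivative (w * of_real t powr (w - 1) :: complex)) (at t within A)"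
  using assms by (auto intro!: has_vector_derivative_real_field derivative_eq_intros)

text \<open>The second derivative is (s - 1) s (s + 1) t^(-s-2) and the Peano kernel is at most 1/8.
  The two gained powers of t make the series converge for Re s > -1; Re s > -2 makes the power
  decrease on the interval.\<close>

lemma norm_zeta_trapezoid_le:
  assumes s: "Re s > -2"
  shows "norm (zeta_trapezoid n s) \<le> norm ((s - 1) * s * (s + 1)) / 8 * (real n + 1) powr (- Re s - 2)"
proof -
  define a where "a = real (Suc n)"
  have a: "a = real n + 1" "a > 0" by (simp_all add: a_def)
  define U where "U = (\<lambda>t::real. - (of_real t powr (1 - s)))"
  define u where "u = (\<lambda>t::real. (s - 1) * of_real t powr (- s))"
  define u1 where "u1 = (\<lambda>t::real. (s - 1) * (- s * of_real t powr (- s - 1)))"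
  define u2 where "u2 = (\<lambda>t::real. (s - 1) * (- s * ((- s - 1) * of_real t powr (- s - 1 - 1))))"
  have pos: "t > 0" if "t \<in> {a..a+1}" for t using that a by auto
  have d: "((\<lambda>t. of_real t powr w) has_vector_derivative (w * of_real t powr (w - 1) :: complex)) (at t within {a..a+1})"
    if "t \<in> {a..a+1}" for t w using pos[OF that] by (rule has_vector_derivative_of_real_powr)
  have "((\<lambda>t. ((t - a) * (a + 1 - t) / 2) *\<^sub>R u2 t) has_integral
           ((1/2) *\<^sub>R (u a + u (a+1)) - (U (a+1) - U a))) {a..a+1}"
  proof (rule trapezoid_has_integral)
    fix t assume t: "t \<in> {a..a+1}"
    show "(U has_vector_derivative u t) (at t within {a..a+1})"
      unfolding U_def u_def
      using has_vector_derivative_minus[OF d[OF t, of "1 - s"]] by (simp add: algebra_simps)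
    show "(u has_vector_derivative u1 t) (at t within {a..a+1})"
      unfolding u_def u1_def by (rule has_vector_derivative_mult_right d t)+
    show "(u1 has_vector_derivative u2 t) (at t within {a..a+1})"
      unfolding u2_def u1_def by (rule has_vector_derivative_mult_right d t)+
  qed
  also have "(1/2) *\<^sub>R (u a + u (a+1)) - (U (a+1) - U a) = zeta_trapezoid n s"
    unfolding u_def U_def zeta_trapezoid_def a(1) scaleR_conv_of_real by (simp add: field_simps)
  finally have I: "((\<lambda>t. ((t - a) * (a + 1 - t) / 2) *\<^sub>R u2 t) has_integral zeta_trapezoid n s) (cbox a (a+1))"
    by simp
  have "norm (zeta_trapezoid n s) \<le> norm ((s - 1) * s * (s + 1)) / 8 * a powr (- Re s - 2) * measure lborel (cbox a (a+1))"
  proof (rule has_integral_bound[OF _ I])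
    fix t assume "t \<in> cbox a (a+1)"
    then have t: "t \<in> {a..a+1}" by simp
    have w: "(t - a) * (a + 1 - t) / 2 \<ge> 0" using t by simp
    have "(t - a) * (a + 1 - t) / 2 \<le> 1 / 8"
      using trapezoid_weight_le[of "Suc n" t] unfolding trapezoid_weight_def a_def .
    moreover have "norm (u2 t) = norm ((s - 1) * s * (s + 1)) * t powr (- Re s - 2)"
    proof -
      have "u2 t = ((s - 1) * s * (s + 1)) * of_real t powr (- s - 2)"
        by (simp add: u2_def algebra_simps)
      then show ?thesis using pos[OF t] by (simp add: norm_mult norm_powr_real_powr)
    qed
    moreover have "t powr (- Re s - 2) \<le> a powr (- Re s - 2)"
      using s t a by (intro powr_mono2') auto
    ultimately have "norm (((t - a) * (a + 1 - t) / 2) *\<^sub>R u2 t) \<le> 1/8 * (norm ((s - 1) * s * (s + 1)) * a powr (- Re s - 2))"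
      using w unfolding norm_scaleR by (intro mult_mono) (auto intro: mult_left_mono)
    then show "norm (((t - a) * (a + 1 - t) / 2) *\<^sub>R u2 t) \<le> norm ((s - 1) * s * (s + 1)) / 8 * a powr (- Re s - 2)"
      by simp
  qed simp
  then show ?thesis by (simp add: a(1))
qed

text \<open>The continuation of \<open>(s - 1) * \<zeta>(s)\<close> to the half plane \<open>Re s > -1\<close> by the trapezoidal rule.\<close>

definition zeta_aux :: "complex \<Rightarrow> complex" where
  "zeta_aux s = (s + 1) / 2 + (\<Sum>n. zeta_trapezoid n s)"

lemma summable_shifted_powr: "e < -1 \<Longrightarrow> summable (\<lambda>n. (real n + 1) powr e)"
  using summable_Suc_iff[of "\<lambda>n. real n powr e"] by (simp add: summable_real_powr_iff add.commute)

lemma summable_zeta_trapezoid: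
  assumes "Re s > -1"
  shows "summable (\<lambda>n. norm (zeta_trapezoid n s))"
proof (rule summable_comparison_test')
  show "summable (\<lambda>n. norm ((s - 1) * s * (s + 1)) / 8 * (real n + 1) powr (- Re s - 2))"
    using assms by (intro summable_mult summable_shifted_powr) auto
  show "norm (norm (zeta_trapezoid n s)) \<le> norm ((s - 1) * s * (s + 1)) / 8 * (real n + 1) powr (- Re s - 2)" for n
    using norm_zeta_trapezoid_le[of s n] assms by simp
qed

lemma holomorphic_zeta_trapezoid: "zeta_trapezoid n holomorphic_on A"
proof -
  have "of_real (real n + 1) \<noteq> (0::complex)" "of_real (real n + 1 + 1) \<noteq> (0::complex)"
    by (metis of_nat_Suc of_nat_0_less_iff of_real_eq_0_iff less_irrefl zero_less_Suc add.commute)+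
  then show ?thesis
    unfolding zeta_trapezoid_def [abs_def] by (auto intro!: holomorphic_intros)
qed

lemma holomorphic_zeta_aux: "zeta_aux holomorphic_on {s. Re s > -1}"
proof -
  have op: "open {s. Re s > -1}" by (rule open_halfspace_Re_gt)
  have "\<exists>d h. 0 < d \<and> summable h \<and>
      (\<forall>\<^sub>F n in sequentially. \<forall>y\<in>ball x d \<inter> {s. Re s > -1}. norm (zeta_trapezoid n y) \<le> h n)"
    if "x \<in> {s. Re s > -1}" for x
  proof -
    \<comment> \<open>Half the distance of \<open>x\<close> from the line Re = -1; on the ball the
      terms are dominated by a multiple of (n + 1)^(-1-d).\<close>
    define d where "d = (Re x + 1) / 2"
    have d: "d > 0" using that by (simp add: d_def)
    define B where "B = (norm x + d + 1) * (norm x + d) * (norm x + d + 1)"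
    have "norm (zeta_trapezoid n y) \<le> B / 8 * (real n + 1) powr (- (d - 1) - 2)" if "y \<in> ball x d" for n y
    proof -
      have xy: "norm (x - y) < d" using that by (simp add: dist_norm)
      have ny: "norm y \<le> norm x + d" using norm_triangle_ineq4[of x "x - y"] xy by simp
      have "\<bar>Re (x - y)\<bar> \<le> norm (x - y)" by (rule abs_Re_le_cmod)
      then have Re: "Re y > d - 1" using xy by (simp add: d_def abs_le_iff field_simps)
      have "norm (zeta_trapezoid n y) \<le> norm ((y - 1) * y * (y + 1)) / 8 * (real n + 1) powr (- Re y - 2)"
        using Re d by (intro norm_zeta_trapezoid_le) simp
      also have "\<dots> \<le> B / 8 * (real n + 1) powr (- (d - 1) - 2)"
      proof (intro mult_mono divide_right_mono powr_mono)
        show "norm ((y - 1) * y * (y + 1)) \<le> B"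
          unfolding norm_mult B_def
          using ny norm_triangle_ineq4[of y 1] norm_triangle_ineq[of y 1] d
          by (intro mult_mono) auto
      qed (use Re d in \<open>auto simp: B_def\<close>)
      finally show ?thesis .
    qed
    moreover have "summable (\<lambda>n. B / 8 * (real n + 1) powr (- (d - 1) - 2))"
      using d by (intro summable_mult summable_shifted_powr) simp
    ultimately show ?thesis using d
      by (intro exI[of _ d] exI[of _ "\<lambda>n. B / 8 * (real n + 1) powr (- (d - 1) - 2)"]) auto
  qed
  moreover have "(zeta_trapezoid n has_field_derivative deriv (zeta_trapezoid n) x) (at x)"
    for n x by (rule holomorphic_derivI[OF holomorphic_zeta_trapezoid[of n UNIV]]) auto
  ultimately have "\<exists>g g'. \<forall>x\<in>{s. Re s > -1}. (\<lambda>n. zeta_trapezoid n x) sums g x \<and>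
      (\<lambda>n. deriv (zeta_trapezoid n) x) sums g' x \<and> (g has_field_derivative g' x) (at x)"
    by (intro series_and_derivative_comparison_local[OF op])
  then obtain g g' where g: "\<And>x. x \<in> {s. Re s > -1} \<Longrightarrow> (\<lambda>n. zeta_trapezoid n x) sums g x \<and>
      (\<lambda>n. deriv (zeta_trapezoid n) x) sums g' x \<and> (g has_field_derivative g' x) (at x)"
    by metis
  have "(\<lambda>s. (s + 1) / 2 + g s) holomorphic_on {s. Re s > -1}"
  proof (intro holomorphic_intros)
    show "g holomorphic_on {s. Re s > -1}" using g op by (auto simp: holomorphic_on_open)
  qed auto
  then show ?thesis
  proof (rule holomorphic_transform)
    show "(s + 1) / 2 + g s = zeta_aux s" if "s \<in> {s. Re s > -1}" for s
      using g[OF that] by (simp add: zeta_aux_def sums_iff)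
  qed
qed

lemma norm_of_real_powr: "x > 0 \<Longrightarrow> norm (of_real x powr w) = x powr Re w"
  by (simp add: norm_powr_real_powr)

text \<open>The trapezoidal terms differ from those of (s - 1) zeta(s) by telescoping differences,
  whose total - (s + 1) / 2 is cancelled by the explicit summand of \<open>zeta_aux\<close>.\<close>

lemma zeta_aux_eq_series:
  assumes s: "Re s > 1"
  shows "(\<lambda>n. (s - 1) * (of_real (real n + 1) powr - s)) sums zeta_aux s"
proof -
  define p where "p = (\<lambda>w n. of_real (real n + 1) powr w :: complex)"
  have sm: "summable (p (-s))"
  proof (rule summable_comparison_test')
    show "norm (p (-s) n) \<le> (real n + 1) powr (- Re s)" for n
      unfolding p_def by (subst norm_of_real_powr) auto
    show "summable (\<lambda>n. (real n + 1) powr (- Re s))" using s by (intro summable_shifted_powr) simp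
  qed
  then have z: "p (-s) \<longlonglongrightarrow> 0" by (rule summable_LIMSEQ_zero)
  have z1: "p (1 - s) \<longlonglongrightarrow> 0"
  proof (rule Lim_null_comparison)
    show "\<forall>\<^sub>F n in sequentially. norm (p (1 - s) n) \<le> (real n + 1) powr (1 - Re s)"
      unfolding p_def by (subst norm_of_real_powr) auto
    show "(\<lambda>n. (real n + 1) powr (1 - Re s)) \<longlonglongrightarrow> 0"
      using s by real_asymp
  qed
  have sh: "p w (Suc n) = of_real (real n + 1 + 1) powr w" for w n by (simp add: p_def add_ac)
  have t: "zeta_trapezoid n s = (s - 1) * p (-s) n + ((s - 1) / 2 * (p (-s) (Suc n) - p (-s) n) + (p (1-s) (Suc n) - p (1-s) n))" for n
    unfolding sh unfolding p_def zeta_trapezoid_def by (simp add: field_simps)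
  have S: "(\<lambda>n. (s - 1) / 2 * (p (-s) (Suc n) - p (-s) n) + (p (1-s) (Suc n) - p (1-s) n)) sums
      ((s - 1) / 2 * (0 - p (-s) 0) + (0 - p (1-s) 0))"
    by (intro sums_add sums_mult telescope_sums z z1)
  have P: "(\<lambda>n. (s - 1) * p (-s) n) sums ((s - 1) * suminf (p (-s)))"
    by (intro sums_mult summable_sums sm)
  have "(\<lambda>n. zeta_trapezoid n s) sums ((s - 1) * suminf (p (-s)) + ((s - 1) / 2 * (0 - p (-s) 0) + (0 - p (1-s) 0)))"
    unfolding t by (intro sums_add S P)
  then have "zeta_aux s = (s - 1) * suminf (p (-s))"
    by (simp add: zeta_aux_def sums_iff p_def field_simps)
  then show ?thesis using P by (simp add: p_def)
qed

lemma zeta_trapezoid_of_real: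
  "zeta_trapezoid n (of_real s) = of_real
     ((s - 1) * ((real n + 1) powr - s + (real n + 1 + 1) powr - s) / 2
        - ((real n + 1) powr (1 - s) - (real n + 1 + 1) powr (1 - s)))"
proof -
  have e: "of_real x powr - of_real s = (of_real (x powr - s) :: complex)"
    "of_real x powr (1 - of_real s) = (of_real (x powr (1 - s)) :: complex)" if "x \<ge> 0" for x
    using powr_of_real[OF that, of "-s"] powr_of_real[OF that, of "1-s"] by simp_all
  have n: "0 \<le> real n + 1" "0 \<le> real n + 1 + 1" by simp_all
  show ?thesis unfolding zeta_trapezoid_def e[OF n(1)] e[OF n(2)]
    by (simp only: of_real_mult of_real_diff of_real_divide of_real_add of_real_1 of_real_numeral times_divide_eq_left)
qed

text \<open>The summand (s + 1) / 2 is precisely the contribution of the missing interval [0, 1],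
  that is, of \<open>trapezoid_moment s 0\<close>.\<close>

lemma zeta_aux_of_real:
  assumes s: "-1 < s" "s < 0"
  shows "zeta_aux (of_real s) = of_real (s * (s + 1) * (s - 1) * (\<Sum>n. trapezoid_moment s n))"
proof -
  have sm: "summable (trapezoid_moment s)" by (rule Mellin_bernoulli_eq[OF s])
  have e: "zeta_trapezoid n (of_real s) = of_real (s * (s + 1) * (s - 1) * trapezoid_moment s (Suc n))" for n
    using s unfolding zeta_trapezoid_of_real trapezoid_moment_def by (simp add: add_ac)
  have "zeta_aux (of_real s) = (of_real s + 1) / 2 + of_real (\<Sum>n. s * (s + 1) * (s - 1) * trapezoid_moment s (Suc n))"
    unfolding zeta_aux_def e using sm
    by (subst suminf_of_real [symmetric]) (auto intro!: summable_mult simp: summable_Suc_iff)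
  also have "\<dots> = of_real ((s + 1) / 2 + s * (s + 1) * (s - 1) * (\<Sum>n. trapezoid_moment s (Suc n)))"
    using sm by (subst suminf_mult) (auto simp: summable_Suc_iff)
  also have "(s + 1) / 2 = s * (s + 1) * (s - 1) * trapezoid_moment s 0"
    using s by (simp add: trapezoid_moment_def)
  also have "s * (s + 1) * (s - 1) * trapezoid_moment s 0 + s * (s + 1) * (s - 1) * (\<Sum>n. trapezoid_moment s (Suc n))
     = s * (s + 1) * (s - 1) * (\<Sum>n. trapezoid_moment s n)"
  proof -
    have "(\<Sum>n. trapezoid_moment s n) = trapezoid_moment s 0 + (\<Sum>n. trapezoid_moment s (Suc n))"
      using suminf_split_head[OF sm] by simp
    then show ?thesis by (simp only: distrib_left)
  qed
  finally show ?thesis .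
qed

section \<open>The functional equation\<close>

text \<open>Riemann's xi: the usual factors s / 2 and Gamma (s / 2) are merged into Gamma (1 + s /
  2), which has no pole for Re s > -1.\<close>

definition xi_half :: "complex \<Rightarrow> complex" where
  "xi_half s = zeta_aux s * of_real pi powr (- s / 2) * Gamma (1 + s / 2)"

lemma not_nonpos_Ints_if_Re_pos: "Re z > 0 \<Longrightarrow> z \<notin> \<int>\<^sub>\<le>\<^sub>0"
  by (auto elim!: nonpos_Ints_cases)

lemma holomorphic_xi_half: "xi_half holomorphic_on {s. Re s > -1}"
proof -
  have "1 + s / 2 \<notin> \<int>\<^sub>\<le>\<^sub>0" if "Re s > -1" for s
    using that by (intro not_nonpos_Ints_if_Re_pos) simp
  then show ?thesis unfolding xi_half_def [abs_def]
    by (intro holomorphic_intros holomorphic_zeta_aux holomorphic_Gamma') auto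
qed

lemma Gamma_duplication_real:
  fixes z :: real assumes "z > 0"
  shows "Gamma z * Gamma (z + 1/2) = 2 powr (1 - 2 * z) * sqrt pi * Gamma (2 * z)"
proof -
  have "Gamma (complex_of_real z) * Gamma (complex_of_real z + 1/2) =
    exp ((1 - 2 * of_real z) * of_real (ln 2)) * of_real (sqrt pi) * Gamma (2 * of_real z)"
    using assms by (intro Gamma_legendre_duplication not_nonpos_Ints_if_Re_pos) auto
  also have "complex_of_real z + 1/2 = of_real (z + 1/2)" by simp
  also have "2 * complex_of_real z = of_real (2 * z)" by simp
  also have "(1 - complex_of_real (2 * z)) * of_real (ln 2) = of_real ((1 - 2 * z) * ln 2)" by simp
  finally have "complex_of_real (Gamma z * Gamma (z + 1/2)) = of_real (exp ((1 - 2 * z) * ln 2) * sqrt pi * Gamma (2 * z))"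
    unfolding Gamma_complex_of_real exp_of_real of_real_mult[symmetric] .
  then show ?thesis unfolding of_real_eq_iff by (simp add: powr_def)
qed

text \<open>The equality of the two Mellin evaluations in symmetric form. Here \<open>S\<close>
  encodes zeta(s) and \<open>W\<close> is zeta(1 - s). The duplication formula splits Gamma (s + 2)
  and produces the factor Gamma ((1 + s) / 2), which cancels on both sides.\<close>

lemma xi_half_reflect_real:
  fixes s :: real
  assumes s: "-1 < s" "s < 0"
  shows "xi_half (of_real s) = xi_half (1 - of_real s)"
proof -
  define S where "S = (\<Sum>n. trapezoid_moment s n)"
  define W where "W = (\<Sum>n. (real n + 1) powr (s - 1))"
  define A where "A = Gamma (1 + s / 2)"
  define B where "B = Gamma ((1 + s) / 2)"
  define D where "D = Gamma ((1 - s) / 2)"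
  define G where "G = Gamma (s + 2)"
  have GS: "G * S = (2 * pi) powr (s - 1) * (B * D) * W"
    using Mellin_bernoulli_eq(2)[OF s] by (simp add: G_def S_def B_def D_def W_def)
  have B: "B > 0" using s by (simp add: B_def)
  have "Gamma (1 + s / 2) * Gamma (1 + s / 2 + 1/2) = 2 powr (1 - 2 * (1 + s / 2)) * sqrt pi * Gamma (2 * (1 + s / 2))"
    using s by (intro Gamma_duplication_real) simp
  moreover have "Gamma (1 + s / 2 + 1/2) = (1 + s) / 2 * B"
  proof -
    have "(1 + s) / 2 \<notin> \<int>\<^sub>\<le>\<^sub>0" using s by (auto elim!: nonpos_Ints_cases)
    from Gamma_plus1[OF this] show ?thesis by (simp add: B_def add_divide_distrib add_ac)
  qed
  moreover have "1 - 2 * (1 + s / 2) = - 1 - s" "2 * (1 + s / 2) = s + 2" by simp_all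
  ultimately have dup: "A * ((1 + s) / 2 * B) = 2 powr (- 1 - s) * sqrt pi * G"
    unfolding A_def G_def by (simp only:)
  have D1: "Gamma (1 + (1 - s) / 2) = (1 - s) / 2 * D"
  proof -
    have "(1 - s) / 2 \<notin> \<int>\<^sub>\<le>\<^sub>0" using s by (auto elim!: nonpos_Ints_cases)
    from Gamma_plus1[OF this] show ?thesis by (simp add: D_def add_ac)
  qed
  have p: "2 powr (- 1 - s) * sqrt pi * (2 * pi) powr (s - 1) = (1/4) * pi powr (s - 1/2)"
  proof -
    have "2 powr (- 1 - s) * sqrt pi * (2 * pi) powr (s - 1) = (2 powr (- 1 - s) * 2 powr (s - 1)) * (pi powr (1/2) * pi powr (s - 1))"
      by (simp only: powr_mult powr_half_sqrt pi_ge_zero mult_ac)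
    also have "pi powr (1/2) * pi powr (s - 1) = pi powr (s - 1/2)"
      unfolding powr_add[symmetric] by simp
    also have "2 powr (- 1 - s) * 2 powr (s - 1) = (2::real) powr (-2)"
      unfolding powr_add[symmetric] by simp
    also have "\<dots> = 1/4" by (simp add: powr_minus powr_numeral)
    finally show ?thesis .
  qed
  have "(A * ((1 + s) / 2 * B)) * S = 2 powr (- 1 - s) * sqrt pi * ((2 * pi) powr (s - 1) * (B * D) * W)"
    unfolding dup GS[symmetric] by (simp only: mult_ac)
  also have "\<dots> = B * ((1/4) * pi powr (s - 1/2) * D * W)"
    unfolding p[symmetric] by (simp only: mult_ac)
  finally have "B * (A * (1 + s) / 2 * S) = B * ((1/4) * pi powr (s - 1/2) * D * W)"
    by (simp only: mult_ac times_divide_eq_left times_divide_eq_right)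
  then have "A * (1 + s) / 2 * S = (1/4) * pi powr (s - 1/2) * D * W"
    using B by (simp only: mult_cancel_left) auto
  then have key: "A * (1 + s) * S = (1/2) * pi powr (s - 1/2) * D * W"
    by (simp add: field_simps)
  have p2: "pi powr (- s / 2) * pi powr (s - 1/2) = pi powr (- (1 - s) / 2)"
    unfolding powr_add[symmetric] by (rule arg_cong[where f = "(powr) pi"]) (simp add: field_simps)
  have pw: "of_real pi powr (- of_real x / 2) = complex_of_real (pi powr (- x / 2))" for x
    using powr_of_real[of pi "- x / 2"] by simp
  have Gm: "Gamma (1 + of_real x / 2) = complex_of_real (Gamma (1 + x / 2))" for x
    using Gamma_complex_of_real[of "1 + x / 2"] by simp
  have "xi_half (of_real s) = of_real (s * (s + 1) * (s - 1) * S * pi powr (- s / 2) * A)"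
    unfolding xi_half_def zeta_aux_of_real[OF s] pw Gm A_def S_def by simp
  also have "s * (s + 1) * (s - 1) * S * pi powr (- s / 2) * A = s * (s - 1) * pi powr (- s / 2) * (A * (1 + s) * S)"
    by (simp add: algebra_simps)
  also have "\<dots> = (- s * W) * (pi powr (- s / 2) * pi powr (s - 1/2)) * ((1 - s) / 2 * D)"
    unfolding key by (simp add: field_simps)
  also have "\<dots> = (- s * W) * pi powr (- (1 - s) / 2) * Gamma (1 + (1 - s) / 2)"
    unfolding p2 D1 ..
  also have "of_real \<dots> = xi_half (of_real (1 - s))"
  proof -
    have "(\<lambda>n. (of_real (1 - s) - 1) * (of_real (real n + 1) powr - of_real (1 - s))) sums zeta_aux (of_real (1 - s))"
      using s by (intro zeta_aux_eq_series) simp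
    moreover have "(of_real (1 - s) - 1) * (of_real (real n + 1) powr - of_real (1 - s)) = complex_of_real (- s * (real n + 1) powr (s - 1))" for n
      using powr_of_real[of "real n + 1" "s - 1"] by simp
    ultimately have "(\<lambda>n. complex_of_real (- s * (real n + 1) powr (s - 1))) sums zeta_aux (of_real (1 - s))"
      by (simp only:)
    moreover have "(\<lambda>n. - s * (real n + 1) powr (s - 1)) sums (- s * W)"
      unfolding W_def using s by (intro sums_mult summable_sums summable_shifted_powr) simp
    then have "(\<lambda>n. complex_of_real (- s * (real n + 1) powr (s - 1))) sums of_real (- s * W)"
      by (rule sums_of_real)
    ultimately have "zeta_aux (of_real (1 - s)) = of_real (- s * W)" by (rule sums_unique2)
    then show ?thesis unfolding xi_half_def pw Gm by simp
  qed
  finally show ?thesis by simp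
qed

text \<open>In this strip both sides are holomorphic, and the real segment (-1, 0), where they
  agree, accumulates at -1/2.\<close>

lemma xi_half_reflect:
  assumes "-1 < Re s" "Re s < 2"
  shows "xi_half s = xi_half (1 - s)"
proof -
  define V where "V = {s. Re s > -1} \<inter> {s. Re s < 2}"
  have V: "open V" "convex V"
    unfolding V_def by (auto intro!: open_halfspace_Re_gt open_halfspace_Re_lt convex_Int convex_halfspace_Re_gt convex_halfspace_Re_lt)
  have h1: "(\<lambda>s. xi_half s) holomorphic_on V"
    by (rule holomorphic_on_subset[OF holomorphic_xi_half]) (auto simp: V_def)
  have h2: "(\<lambda>s. xi_half (1 - s)) holomorphic_on V"
  proof -
    have "(xi_half \<circ> (\<lambda>s. 1 - s)) holomorphic_on V"
      by (rule holomorphic_on_compose_gen[OF _ holomorphic_xi_half]) (auto simp: V_def intro!: holomorphic_intros)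
    then show ?thesis by (simp add: o_def)
  qed
  define U where "U = complex_of_real ` {-1<..<0}"
  have "xi_half s - xi_half (1 - s) = 0"
  proof (rule analytic_continuation[where f = "\<lambda>s. xi_half s - xi_half (1 - s)" and S = V and U = U and \<xi> = "-1/2"])
    show "(\<lambda>s. xi_half s - xi_half (1 - s)) holomorphic_on V" by (intro holomorphic_intros h1 h2)
    show "open V" "connected V" using V by (auto intro: convex_connected)
    show "U \<subseteq> V" "-1/2 \<in> V" "s \<in> V" using assms by (auto simp: U_def V_def)
    show "-1/2 islimpt U"
    proof (rule islimptI)
      fix T :: "complex set" assume T: "-1/2 \<in> T" "open T"
      then obtain e where e: "e > 0" "ball (-1/2) e \<subseteq> T" by (auto simp: open_contains_ball)
      define d where "d = min (e / 2) (1/4)"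
      have d: "d > 0" "d < e" "d \<le> 1/4" using e by (auto simp: d_def)
      have "dist (-1/2) (complex_of_real (-1/2 + d)) = d"
        using d by (simp add: dist_norm)
      then have "complex_of_real (-1/2 + d) \<in> T" using e d by auto
      moreover have "complex_of_real (-1/2 + d) \<in> U" unfolding U_def using d by (intro imageI) auto
      moreover have "complex_of_real (-1/2 + d) \<noteq> -1/2" using d by (simp add: complex_eq_iff)
      ultimately show "\<exists>y\<in>U. y \<in> T \<and> y \<noteq> -1/2" by blast
    qed
    show "xi_half z - xi_half (1 - z) = 0" if "z \<in> U" for z
      using that xi_half_reflect_real by (auto simp: U_def)
  qed
  then show ?thesis by simp
qed

text \<open>The two half planes cover the plane, and the reflection formula makes the pieces agree
  on the overlap -1 < Re s < 2.\<close>

definition xi :: "complex \<Rightarrow> complex" where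
  "xi s = (if Re s > -1 then xi_half s else xi_half (1 - s))"

lemma xi_reflect: "xi (1 - s) = xi s"
  using xi_half_reflect[of s] by (auto simp: xi_def)

lemma holomorphic_xi: "xi holomorphic_on A"
proof -
  have "xi holomorphic_on {s. Re s > -1} \<union> {s. Re s < 2}"
  proof (rule holomorphic_on_Un)
    show "xi holomorphic_on {s. Re s > -1}"
      using holomorphic_xi_half by (rule holomorphic_transform) (simp add: xi_def)
    have "(\<lambda>s. xi_half (1 - s)) holomorphic_on {s. Re s < 2}"
    proof -
      have "(xi_half \<circ> (\<lambda>s. 1 - s)) holomorphic_on {s. Re s < 2}"
        by (rule holomorphic_on_compose_gen[OF _ holomorphic_xi_half]) (auto intro!: holomorphic_intros)
      then show ?thesis by (simp add: o_def)
    qed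
    then show "xi holomorphic_on {s. Re s < 2}"
    proof (rule holomorphic_transform)
      show "xi_half (1 - s) = xi s" if "s \<in> {s. Re s < 2}" for s
        using that xi_half_reflect[of s] by (auto simp: xi_def)
    qed
  qed (auto simp: open_halfspace_Re_gt open_halfspace_Re_lt)
  moreover have "{s. Re s > -1} \<union> {s. Re s < 2} = UNIV" by auto
  ultimately show ?thesis using holomorphic_on_subset by auto
qed

section \<open>Identification of \<open>zeta\<close> with the continuation\<close>

text \<open>\<open>rGamma\<close> is entire, so removing the Gamma factor from \<open>xi\<close>
  creates no singularity; its zeros become the trivial zeros.\<close>

definition zeta_ext :: "complex \<Rightarrow> complex" where
  "zeta_ext s = xi s * of_real pi powr (s / 2) * rGamma (1 + s / 2) / (s - 1)"

lemma zeta_ext_eq: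
  assumes "Re s > -1"
  shows "zeta_ext s = zeta_aux s / (s - 1)"
proof -
  have "1 + s / 2 \<notin> \<int>\<^sub>\<le>\<^sub>0" using assms by (intro not_nonpos_Ints_if_Re_pos) simp
  then have "Gamma (1 + s / 2) * rGamma (1 + s / 2) = 1"
    by (simp add: rGamma_inverse_Gamma Gamma_eq_zero_iff)
  moreover have "of_real pi powr (- s / 2) * of_real pi powr (s / 2) = (1 :: complex)"
    unfolding powr_add[symmetric] by simp
  moreover have "zeta_ext s = zeta_aux s * (of_real pi powr (- s / 2) * of_real pi powr (s / 2)) * (Gamma (1 + s / 2) * rGamma (1 + s / 2)) / (s - 1)"
    using assms by (simp add: zeta_ext_def xi_def xi_half_def)
  ultimately show ?thesis by simp
qed

text \<open>The witness that makes the choice operator in the definition of \<open>zeta\<close>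
  meaningful.\<close>

lemma is_zeta_zeta_ext: "is_zeta zeta_ext"
  unfolding is_zeta_def
proof (intro conjI allI impI)
  show "zeta_ext holomorphic_on - {1}"
    unfolding zeta_ext_def [abs_def] by (intro holomorphic_intros holomorphic_xi) auto
  fix s :: complex assume s: "Re s > 1"
  then have s1: "s \<noteq> 1" by auto
  have "(\<lambda>n. (s - 1) * (of_real (real n + 1) powr - s) / (s - 1)) sums (zeta_aux s / (s - 1))"
    by (intro sums_divide zeta_aux_eq_series s)
  moreover have "(s - 1) * (of_real (real n + 1) powr - s) / (s - 1) = 1 / of_nat (Suc n) powr s" for n
    using s1 by (simp add: powr_minus divide_inverse add_ac)
  ultimately show "(\<lambda>n. 1 / of_nat (Suc n) powr s) sums zeta_ext s"
    using s by (simp add: zeta_ext_eq)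
qed

text \<open>The identity theorem on the connected punctured plane; the chosen function may have any
  value at 1.\<close>

lemma zeta_eq_zeta_ext:
  assumes "s \<noteq> 1"
  shows "zeta s = zeta_ext s"
proof -
  have z: "is_zeta zeta" unfolding zeta_def by (rule someI[of is_zeta, OF is_zeta_zeta_ext])
  show ?thesis
  proof (rule analytic_continuation_open[where s = "{s. Re s > 1}" and s' = "- {1}" and f = zeta and g = zeta_ext])
    show "open {s. Re s > 1}" by (rule open_halfspace_Re_gt)
    have "2 \<in> {s. Re s > 1}" by simp
    then show "{s. Re s > 1} \<noteq> {}" by blast
    show "connected (- {1::complex})" by (rule connected_punctured_universe) simp
    show "zeta holomorphic_on - {1}" "zeta_ext holomorphic_on - {1}"
      using z is_zeta_zeta_ext by (auto simp: is_zeta_def)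
    fix w assume "w \<in> {s. Re s > 1}"
    then show "zeta w = zeta_ext w"
      using z is_zeta_zeta_ext unfolding is_zeta_def by (metis mem_Collect_eq sums_unique2)
  qed (use assms in auto)
qed

section \<open>Zeros and growth of the completed zeta function\<close>

lemma zeta_series: "Re s > 1 \<Longrightarrow> (\<lambda>n. 1 / of_nat (Suc n) powr s) sums zeta s"
  using is_zeta_zeta_ext zeta_eq_zeta_ext[of s] by (cases "s = 1") (auto simp: is_zeta_def)

text \<open>Comparison with zeta(2) - 1 < 1. It keeps zeta(s) in the right half plane for Re s >= 2,
  where the principal logarithm is holomorphic.\<close>

lemma norm_zeta_minus_1_less:
  assumes s: "Re s \<ge> 2"
  shows "norm (zeta s - 1) < 1"
proof -
  have "(\<lambda>n. 1 / of_nat (Suc (Suc n)) powr s) sums (zeta s - 1)"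
    using zeta_series[of s] s by (subst sums_Suc_iff) simp
  then have eq: "zeta s - 1 = (\<Sum>n. 1 / of_nat (Suc (Suc n)) powr s)" by (simp add: sums_iff)
  have I: "(\<lambda>n. 1 / (real (Suc n) + 1)\<^sup>2) sums (pi\<^sup>2 / 6 - 1)"
    using inverse_squares_sums by (subst sums_Suc_iff) (simp add: add.commute)
  have "norm (\<Sum>n. 1 / of_nat (Suc (Suc n)) powr s) \<le> (\<Sum>n. 1 / (real (Suc n) + 1)\<^sup>2)"
  proof (rule norm_suminf_le)
    show "summable (\<lambda>n. 1 / (real (Suc n) + 1)\<^sup>2)" using I by (rule sums_summable)
    show "norm (1 / of_nat (Suc (Suc n)) powr s) \<le> 1 / (real (Suc n) + 1)\<^sup>2" for n
    proof -
      have "norm (complex_of_nat (Suc (Suc n)) powr s) = real (Suc (Suc n)) powr Re s"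
        using norm_of_real_powr[of "real (Suc (Suc n))" s] by simp
      moreover have "real (Suc (Suc n)) powr 2 \<le> real (Suc (Suc n)) powr Re s"
        using s by (intro powr_mono) auto
      ultimately show ?thesis
        by (simp add: norm_divide frac_le powr_numeral add_ac del: of_nat_Suc) (simp add: frac_le add_ac)
    qed
  qed
  also have "\<dots> = pi\<^sup>2 / 6 - 1" using I by (simp add: sums_iff)
  also have "\<dots> < 1"
  proof -
    have "pi\<^sup>2 \<le> (3.15)\<^sup>2" using pi_approx by (intro power_mono) auto
    then show ?thesis by (simp add: power2_eq_square)
  qed
  finally show ?thesis using eq by simp
qed

lemma Re_zeta_pos: "Re s \<ge> 2 \<Longrightarrow> Re (zeta s) > 0"
  using norm_zeta_minus_1_less[of s] abs_Re_le_cmod[of "zeta s - 1"] by simp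

lemma xi_eq:
  assumes "Re s > -1" "s \<noteq> 1"
  shows "xi s = (s - 1) * zeta s * of_real pi powr (- s / 2) * Gamma (1 + s / 2)"
  using assms zeta_eq_zeta_ext[of s] zeta_ext_eq[of s] by (simp add: xi_def xi_half_def)

lemma Gamma_nonzero_if_Re_pos: "Re z > 0 \<Longrightarrow> Gamma z \<noteq> 0"
  by (simp add: Gamma_eq_zero_iff not_nonpos_Ints_if_Re_pos)

lemma xi_nonzero: "Re s \<ge> 2 \<Longrightarrow> xi s \<noteq> 0"
  using xi_eq[of s] Re_zeta_pos[of s] Gamma_nonzero_if_Re_pos[of "1 + s / 2"] by (cases "s = 1") auto

text \<open>At s = 1 all trapezoidal terms vanish, so \<open>zeta_aux 1 = 1\<close>. This reconciles
  the exclusion of 1 from \<open>nontrivial_zeros\<close> with the zeros of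
  \<open>xi\<close>.\<close>

lemma xi_1_nonzero: "xi 1 \<noteq> 0"
proof -
  have "zeta_trapezoid n 1 = 0" for n
  proof -
    have "complex_of_real (real n + 1) \<noteq> 0" "complex_of_real (real n + 1 + 1) \<noteq> 0"
      by (metis of_nat_Suc of_nat_0_less_iff of_real_eq_0_iff less_irrefl zero_less_Suc add.commute)+
    then show ?thesis by (simp add: zeta_trapezoid_def del: of_real_add)
  qed
  then show ?thesis using Gamma_nonzero_if_Re_pos[of "3/2"]
    by (simp add: xi_def xi_half_def zeta_aux_def)
qed

text \<open>At s = 1/2 the explicit summand of \<open>zeta_aux\<close> is 3/4, and the trapezoidal
  series is smaller: |(s - 1) s (s + 1)| = 3/8 there. The partial fraction theorem needs its even
  function to be nonzero at its centre.\<close>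

lemma xi_one_half_nonzero: "xi (1/2) \<noteq> 0"
proof -
  have S: "summable (\<lambda>n. norm (zeta_trapezoid n (1/2)))"
    by (rule summable_zeta_trapezoid) simp
  have I: "(\<lambda>n. 3/64 * (1 / (real n + 1)\<^sup>2)) sums (3/64 * (pi\<^sup>2 / 6))"
    using inverse_squares_sums by (intro sums_mult) (simp add: add.commute)
  have "norm (\<Sum>n. zeta_trapezoid n (1/2)) \<le> (\<Sum>n. 3/64 * (1 / (real n + 1)\<^sup>2))"
  proof (rule norm_suminf_le)
    show "summable (\<lambda>n. 3/64 * (1 / (real n + 1)\<^sup>2))" using I by (rule sums_summable)
    show "norm (zeta_trapezoid n (1/2)) \<le> 3/64 * (1 / (real n + 1)\<^sup>2)" for n
    proof -
      have "norm (zeta_trapezoid n (1/2)) \<le> norm (((1/2) - 1) * (1/2) * ((1/2) + 1) :: complex) / 8 * (real n + 1) powr (- Re (1/2) - 2)"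
        by (rule norm_zeta_trapezoid_le) simp
      also have "norm (((1/2) - 1) * (1/2) * ((1/2) + 1) :: complex) = 3/8"
        by (simp add: norm_mult norm_divide)
      also have "3/8 / 8 * (real n + 1) powr (- Re (1/2) - 2) \<le> 3/64 * (real n + 1) powr (-2)"
        by (intro mult_mono powr_mono) auto
      also have "\<dots> = 3/64 * (1 / (real n + 1)\<^sup>2)"
        by (subst powr_neg_numeral) auto
      finally show ?thesis .
    qed
  qed
  also have "\<dots> = 3/64 * (pi\<^sup>2 / 6)" using I by (simp add: sums_iff)
  also have "\<dots> < 3/4"
  proof -
    have "pi\<^sup>2 \<le> (3.15)\<^sup>2" using pi_approx by (intro power_mono) auto
    then show ?thesis by (simp add: power2_eq_square)
  qed
  finally have lt: "norm (\<Sum>n. zeta_trapezoid n (1/2)) < 3/4" .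
  have "zeta_aux (1/2) \<noteq> 0"
  proof
    assume "zeta_aux (1/2) = 0"
    then have "(\<Sum>n. zeta_trapezoid n (1/2)) = - (3/4)" by (simp add: zeta_aux_def eq_neg_iff_add_eq_0 add.commute)
    then show False using lt by simp
  qed
  then show ?thesis using Gamma_nonzero_if_Re_pos[of "1 + 1/4"]
    by (simp add: xi_def xi_half_def)
qed

lemma rGamma_half_eq_0D:
  assumes "rGamma (1 + s / 2 :: complex) = 0"
  shows "\<exists>k::nat. k \<ge> 1 \<and> s = - of_nat (2 * k)"
proof -
  from assms have "1 + s / 2 \<in> \<int>\<^sub>\<le>\<^sub>0" by (simp add: rGamma_eq_zero_iff)
  then obtain n where "1 + s / 2 = - of_nat n" by (elim nonpos_Ints_cases')
  moreover have "s = 2 * (1 + s / 2) - 2" by simp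
  ultimately have "s = - of_nat (2 * (n + 1))" by (simp only:) simp
  then show ?thesis by (intro exI[of _ "n + 1"]) simp
qed

text \<open>A zero of zeta away from the trivial ones cannot come from \<open>rGamma\<close>.
  Conversely, \<open>xi\<close> does not vanish at -2k, since its value there is that at 1 + 2k,
  where zeta and Gamma are nonzero.\<close>

lemma nontrivial_zeros_eq: "nontrivial_zeros = {s. xi s = 0}"
proof (intro equalityI subsetI)
  fix s assume "s \<in> nontrivial_zeros"
  then have s: "s \<noteq> 1" "zeta s = 0" "\<nexists>k::nat. k \<ge> 1 \<and> s = - of_nat (2 * k)"
    by (auto simp: nontrivial_zeros_def)
  have "rGamma (1 + s / 2) \<noteq> 0" using s(3) rGamma_half_eq_0D by blast
  then show "s \<in> {s. xi s = 0}" using s zeta_eq_zeta_ext[of s] by (simp add: zeta_ext_def)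
next
  fix s assume s: "s \<in> {s. xi s = 0}"
  then have s1: "s \<noteq> 1" using xi_1_nonzero by auto
  have "s \<noteq> - of_nat (2 * k)" if "k \<ge> 1" for k :: nat
  proof
    assume "s = - of_nat (2 * k)"
    then have "Re (1 - s) \<ge> 2" using that by simp
    then show False using xi_nonzero[of "1 - s"] s by (simp add: xi_reflect)
  qed
  then show "s \<in> nontrivial_zeros"
    using s s1 zeta_eq_zeta_ext[of s] by (auto simp: nontrivial_zeros_def zeta_ext_def)
qed

lemma eventually_xi_nonzero: "eventually (\<lambda>w. xi w \<noteq> 0) (at z)"
  using non_zero_neighbour_alt[of xi UNIV z 2] holomorphic_xi[of UNIV] xi_nonzero[of 2] connected_UNIV
  by simp

text \<open>Near a nontrivial zero, zeta is \<open>xi\<close> times an analytic function that does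
  not vanish there.\<close>

lemma zorder_zeta_eq_zorder_xi:
  assumes "xi \<rho> = 0"
  shows "zorder zeta \<rho> = zorder xi \<rho>"
proof -
  define h :: "complex \<Rightarrow> complex" where "h = (\<lambda>s. of_real pi powr (s / 2) * rGamma (1 + s / 2) / (s - 1))"
  have "\<rho> \<in> nontrivial_zeros" using assms by (simp add: nontrivial_zeros_eq)
  then have \<rho>: "\<rho> \<noteq> 1" "\<nexists>k::nat. k \<ge> 1 \<and> \<rho> = - of_nat (2 * k)" by (auto simp: nontrivial_zeros_def)
  have "h holomorphic_on - {1}" unfolding h_def by (intro holomorphic_intros) auto
  then have h: "h analytic_on {\<rho>}" using \<rho> by (intro analytic_at[THEN iffD2] exI[of _ "- {1}"]) auto
  have "rGamma (1 + \<rho> / 2) \<noteq> 0" using \<rho>(2) rGamma_half_eq_0D by blast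
  then have h0: "h \<rho> \<noteq> 0" using \<rho> by (simp add: h_def)
  have "eventually (\<lambda>s. s \<noteq> 1) (nhds \<rho>)" using \<rho> by (intro t1_space_nhds) auto
  then have "eventually (\<lambda>s. zeta s = xi s * h s) (nhds \<rho>)"
    by eventually_elim (simp add: zeta_eq_zeta_ext zeta_ext_def h_def)
  then have "eventually (\<lambda>s. zeta s = xi s * h s) (at \<rho>)" by (auto simp: eventually_at_filter elim: eventually_mono)
  then have "zorder zeta \<rho> = zorder (\<lambda>s. xi s * h s) \<rho>"
    by (rule zorder_cong) simp
  also have "\<dots> = zorder xi \<rho> + zorder h \<rho>"
  proof (rule zorder_times_analytic)
    show "xi analytic_on {\<rho>}" using holomorphic_xi[of UNIV] by (intro analytic_at[THEN iffD2] exI[of _ UNIV]) auto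
    have "eventually (\<lambda>s. h s \<noteq> 0) (at \<rho>)"
      using h h0 by (metis analytic_at_imp_isCont eventually_at_filter isContD tendsto_imp_eventually_ne)
    with eventually_xi_nonzero[of \<rho>] show "eventually (\<lambda>z. xi z * h z \<noteq> 0) (at \<rho>)"
      by eventually_elim simp
  qed (rule h)
  also have "zorder h \<rho> = 0" using h h0 by (rule zorder_eq_0I)
  finally show ?thesis by simp
qed

lemma three_powr_le: "(3::real) powr (3/2) \<le> 6"
proof -
  have "(3::real) powr (3/2) = 3 * sqrt 3"
    using powr_add[of "3::real" 1 "1/2"] by (simp add: powr_half_sqrt)
  moreover have "sqrt 3 \<le> 2" by (rule real_le_lsqrt) auto
  ultimately show ?thesis by simp
qed

lemma norm_Gamma_le:
  assumes z: "Re z > 0"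
  shows "norm (Gamma z :: complex) \<le> Gamma (Re z)"
proof -
  have 1: "((\<lambda>t. complex_of_real t powr (z - 1) / of_real (exp t)) has_integral Gamma z) {0..}"
    by (rule Gamma_integral_complex[OF z])
  have 2: "((\<lambda>t. t powr (Re z - 1) / exp t) has_integral Gamma (Re z)) {0..}"
    by (rule Gamma_integral_real[OF z])
  have "norm (integral {0..} (\<lambda>t. complex_of_real t powr (z - 1) / of_real (exp t))) \<le> integral {0..} (\<lambda>t. t powr (Re z - 1) / exp t)"
  proof (rule integral_norm_bound_integral)
    fix t :: real assume "t \<in> {0..}"
    then consider "t = 0" | "t > 0" by force
    then show "norm (complex_of_real t powr (z - 1) / of_real (exp t)) \<le> t powr (Re z - 1) / exp t"
      by cases (simp_all add: norm_divide norm_of_real_powr)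
  qed (use 1 2 in auto)
  then show ?thesis using 1 2 by (simp add: integral_unique)
qed

text \<open>From x! <= x^x, with ln (x + 1) <= 2 sqrt (x + 1) turning x log x into the power 3/2.
  This crude step is the source of the exponent 3/2 in the growth bound.\<close>

lemma Gamma_le_exp:
  assumes x: "x \<ge> (1::real)"
  shows "Gamma x \<le> exp (2 * (x + 1) powr (3/2))"
proof -
  define n where "n = nat \<lceil>x\<rceil>"
  have n: "real n \<ge> x" "real n \<le> x + 1" using x by (auto simp: n_def)
  have "Gamma x \<le> x * Gamma x" using x by simp
  also have "\<dots> = Gamma (x + 1)" using x by (intro Gamma_plus1[symmetric]) (auto elim!: nonpos_Ints_cases)
  also have "\<dots> \<le> Gamma (1 + real n)"
    using Gamma_real_strict_mono[of "x + 1" "1 + real n"] x n by (cases "x = real n") (auto simp: add.commute)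
  also have "\<dots> = fact n" by (rule Gamma_fact)
  also have "fact n \<le> real n ^ n" by (metis fact_le_power le_refl of_nat_fact of_nat_le_iff of_nat_power)
  also have "\<dots> = real n powr real n" using n x by (simp add: powr_realpow)
  also have "\<dots> \<le> (x + 1) powr real n" using n x by (intro powr_mono2) auto
  also have "\<dots> \<le> (x + 1) powr (x + 1)" using n x by (intro powr_mono) auto
  also have "\<dots> = exp ((x + 1) * ln (x + 1))" using x by (simp add: powr_def mult.commute)
  also have "\<dots> \<le> exp ((x + 1) * (2 * sqrt (x + 1)))"
  proof -
    have "ln (x + 1) = 2 * ln (sqrt (x + 1))" using x by (simp add: ln_sqrt)
    also have "\<dots> \<le> 2 * sqrt (x + 1)" using x ln_le_minus_one[of "sqrt (x + 1)"] by simp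
    finally show ?thesis using x by simp
  qed
  also have "(x + 1) * (2 * sqrt (x + 1)) = 2 * (x + 1) powr (3/2)"
    using x powr_add[of "x + 1" 1 "1/2"] by (simp add: powr_half_sqrt)
  finally show ?thesis .
qed

text \<open>To the right of the critical line the trapezoidal series grows like a cubic polynomial,
  the power of pi is bounded and Gamma dominates; the left side follows by reflection.\<close>

lemma xi_growth:
  obtains C where "C > 0" "\<And>z. norm (xi (1/2 + z)) \<le> exp (C * (1 + norm z) powr (3/2))"
proof -
  define S0 where "S0 = (\<Sum>n. (real n + 1) powr (- 5/2))"
  have S0s: "summable (\<lambda>n. (real n + 1) powr (- 5/2))" by (rule summable_shifted_powr) simp
  have S0: "S0 \<ge> 0" unfolding S0_def by (intro suminf_nonneg S0s) simp
  define K where "K = 1 + S0"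
  \<comment> \<open>The summands pay for the constant \<open>K\<close>, for the factor R^3 and for
    Gamma; 12 is 2 * 6, the 6 coming from \<open>three_powr_le\<close>.\<close>
  define C where "C = 8 * K + 3 + 12"
  have C: "C > 0" using S0 by (simp add: C_def K_def)
  have main: "norm (xi (1/2 + z)) \<le> exp (C * (1 + norm z) powr (3/2))" if z: "Re z \<ge> 0" for z
  proof -
    define s where "s = 1/2 + z"
    define R where "R = 1 + norm z"
    have s: "Re s \<ge> 1/2" using z by (simp add: s_def)
    have R: "R \<ge> 1" by (simp add: R_def)
    have ns: "norm s \<le> R" using norm_triangle_ineq[of "1/2" z] by (simp add: s_def R_def norm_divide)
    have n1: "norm (s - 1) \<le> 2 * R" "norm (s + 1) \<le> 2 * R"
      using norm_triangle_ineq4[of s 1] norm_triangle_ineq[of s 1] ns R by auto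
    have RR: "R \<le> R powr (3/2)" using R powr_mono[of 1 "3/2" R] by simp
    have R1: "1 \<le> R powr (3/2)" using R RR by simp
    have "norm (\<Sum>n. zeta_trapezoid n s) \<le> (\<Sum>n. norm ((s - 1) * s * (s + 1)) / 8 * (real n + 1) powr (- 5/2))"
    proof (rule norm_suminf_le)
      show "norm (zeta_trapezoid n s) \<le> norm ((s - 1) * s * (s + 1)) / 8 * (real n + 1) powr (- 5/2)" for n
      proof -
        have "norm (zeta_trapezoid n s) \<le> norm ((s - 1) * s * (s + 1)) / 8 * (real n + 1) powr (- Re s - 2)"
          using s by (intro norm_zeta_trapezoid_le) simp
        also have "\<dots> \<le> norm ((s - 1) * s * (s + 1)) / 8 * (real n + 1) powr (- 5/2)"
          using s by (intro mult_left_mono powr_mono) auto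
        finally show ?thesis .
      qed
    qed (intro summable_mult S0s)
    also have "\<dots> = norm ((s - 1) * s * (s + 1)) / 8 * S0"
      unfolding S0_def by (intro suminf_mult S0s)
    also have "\<dots> \<le> (2 * R * R * (2 * R)) / 8 * S0"
      unfolding norm_mult using ns n1 S0 R by (intro mult_right_mono divide_right_mono mult_mono) auto
    also have "\<dots> \<le> R ^ 3 * S0" using S0 R by (intro mult_right_mono) (auto simp: power3_eq_cube)
    finally have t: "norm (\<Sum>n. zeta_trapezoid n s) \<le> R ^ 3 * S0" .
    have "norm (zeta_aux s) \<le> norm ((s + 1) / 2) + R ^ 3 * S0"
      unfolding zeta_aux_def using t norm_triangle_ineq[of "(s + 1) / 2" "\<Sum>n. zeta_trapezoid n s"] by simp
    also have "\<dots> \<le> K * R ^ 3"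
    proof -
      have "norm ((s + 1) / 2) \<le> R" using n1 by (simp add: norm_divide)
      moreover have "R \<le> R ^ 3" using R power_increasing[of 1 3 R] by simp
      ultimately show ?thesis by (simp add: K_def algebra_simps)
    qed
    finally have za: "norm (zeta_aux s) \<le> K * R ^ 3" .
    note za
    also have "\<dots> \<le> exp (8 * K * R powr (3/2)) * exp (3 * R powr (3/2))"
    proof (rule mult_mono)
      have k: "0 \<le> 8 * K" using S0 by (simp add: K_def)
      have "8 * K * 1 \<le> 8 * K * R powr (3/2)" by (rule mult_left_mono[OF R1 k])
      then have "K \<le> 8 * K * R powr (3/2)" using k by linarith
      also have "\<dots> \<le> exp (8 * K * R powr (3/2))" using exp_ge_add_one_self[of "8 * K * R powr (3/2)"] by linarith
      finally show "K \<le> exp (8 * K * R powr (3/2))" .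
      have "R \<le> exp R" using exp_ge_add_one_self[of R] by linarith
      then have "R ^ 3 \<le> exp R ^ 3" using R by (intro power_mono) auto
      also have "\<dots> = exp (3 * R)" by (simp add: exp_of_nat_mult[symmetric])
      also have "\<dots> \<le> exp (3 * R powr (3/2))" using RR by simp
      finally show "R ^ 3 \<le> exp (3 * R powr (3/2))" .
    qed (use R in auto)
    finally have za: "norm (zeta_aux s) \<le> exp (8 * K * R powr (3/2) + 3 * R powr (3/2))" by (simp add: exp_add)
    have pp: "norm (of_real pi powr (- s / 2)) \<le> 1"
    proof -
      have "norm (of_real pi powr (- s / 2)) = pi powr (- Re s / 2)" by (simp add: norm_of_real_powr)
      also have "\<dots> \<le> pi powr 0" using s pi_ge_two by (intro powr_mono) auto
      finally show ?thesis by simp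
    qed
    have G: "norm (Gamma (1 + s / 2)) \<le> exp (12 * R powr (3/2))"
    proof -
      have "norm (Gamma (1 + s / 2)) \<le> Gamma (1 + Re s / 2)" using norm_Gamma_le[of "1 + s / 2"] s by simp
      also have "\<dots> \<le> exp (2 * (1 + Re s / 2 + 1) powr (3/2))" using s by (intro Gamma_le_exp) simp
      also have "\<dots> \<le> exp (2 * (6 * R powr (3/2)))"
      proof -
        have "1 + Re s / 2 + 1 \<le> 3 * R" using ns complex_Re_le_cmod[of s] R by simp
        then have "(1 + Re s / 2 + 1) powr (3/2) \<le> (3 * R) powr (3/2)" using s by (intro powr_mono2) auto
        also have "\<dots> = 3 powr (3/2) * R powr (3/2)" by (rule powr_mult)
        also have "\<dots> \<le> 6 * R powr (3/2)"
        using three_powr_le by (intro mult_right_mono) auto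
        finally show ?thesis by simp
      qed
      finally show ?thesis by simp
    qed
    have "xi s = zeta_aux s * of_real pi powr (- s / 2) * Gamma (1 + s / 2)"
      using s by (simp add: xi_def xi_half_def)
    then have "norm (xi s) = norm (zeta_aux s) * norm (of_real pi powr (- s / 2)) * norm (Gamma (1 + s / 2))"
      by (simp add: norm_mult)
    also have "\<dots> \<le> exp (8 * K * R powr (3/2) + 3 * R powr (3/2)) * 1 * exp (12 * R powr (3/2))"
      by (intro mult_mono za pp G) auto
    also have "\<dots> = exp (C * R powr (3/2))"
      unfolding mult_1_right exp_add[symmetric] C_def
      by (rule arg_cong[where f = exp]) (simp add: algebra_simps)
    finally show ?thesis by (simp add: s_def R_def)
  qed
  have "norm (xi (1/2 + z)) \<le> exp (C * (1 + norm z) powr (3/2))" for z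
  proof (cases "Re z \<ge> 0")
    case False
    have "xi (1/2 + z) = xi (1/2 + (- z))" using xi_reflect[of "1/2 + z"] by simp
    then show ?thesis using main[of "- z"] False by simp
  qed (rule main)
  then show ?thesis using C that by blast
qed

section \<open>Partial fractions of the logarithmic derivative of an even entire function\<close>

text \<open>The Moebius map u -> u / (2 M - u) sends the half plane Re u < M into the unit disc and
  fixes 0. Schwarz's lemma bounds the composite \<open>\<phi>\<close> by 1/2 on the half radius, and
  l = 2 M \<phi> / (1 + \<phi>).\<close>

lemma Borel_Caratheodory_half:
  fixes l :: "complex \<Rightarrow> complex"
  assumes hol: "l holomorphic_on ball 0 R" and R: "R > 0" and l0: "l 0 = 0"
    and M: "\<And>z. norm z < R \<Longrightarrow> Re (l z) < M" and z: "norm z \<le> R / 2"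
  shows "norm (l z) \<le> 2 * M"
proof -
  have M0: "M > 0" using M[of 0] l0 R by simp
  define \<phi> where "\<phi> = (\<lambda>w. l (of_real R * w) / (2 * of_real M - l (of_real R * w)))"
  have in_ball: "norm (of_real R * w) < R" if "norm w < 1" for w :: complex
    using that R by (simp add: norm_mult)
  have nz: "2 * of_real M - l (of_real R * w) \<noteq> 0" if "norm w < 1" for w
  proof
    assume "2 * of_real M - l (of_real R * w) = 0"
    then have "Re (l (of_real R * w)) = 2 * M" by (simp add: complex_eq_iff)
    then show False using M[OF in_ball[OF that]] M0 by simp
  qed
  have "(l \<circ> (\<lambda>w. of_real R * w)) holomorphic_on ball 0 1"
    using in_ball by (intro holomorphic_on_compose_gen[OF _ hol]) (auto intro!: holomorphic_intros)
  then have hl: "(\<lambda>w. l (of_real R * w)) holomorphic_on ball 0 1" by (simp add: o_def)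
  have h\<phi>: "\<phi> holomorphic_on ball 0 1"
    unfolding \<phi>_def using nz by (intro holomorphic_intros hl) auto
  have lt: "norm (\<phi> w) < 1" if "norm w < 1" for w
  proof -
    define u where "u = l (of_real R * w)"
    have "Re u < M" using M[OF in_ball[OF that]] by (simp add: u_def)
    have "(norm u)\<^sup>2 < (norm (2 * of_real M - u))\<^sup>2"
    proof -
      have "(norm (2 * of_real M - u))\<^sup>2 = (norm u)\<^sup>2 + 4 * M * (M - Re u)"
        unfolding cmod_power2 by (simp add: power2_eq_square algebra_simps)
      then show ?thesis using \<open>Re u < M\<close> M0 by simp
    qed
    then have "norm u < norm (2 * of_real M - u)" by (rule power2_less_imp_less) simp
    then show ?thesis by (simp add: \<phi>_def norm_divide u_def[symmetric]) (metis norm_ge_zero divide_less_eq_1_pos le_less_trans)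
  qed
  have \<phi>0: "\<phi> 0 = 0" by (simp add: \<phi>_def l0)
  define w where "w = z / of_real R"
  have w: "norm w \<le> 1/2" using z R by (simp add: w_def norm_divide divide_simps)
  have zw: "z = of_real R * w" using R by (simp add: w_def)
  have n: "norm (\<phi> w) \<le> 1/2"
    using Schwarz_Lemma(1)[OF h\<phi> \<phi>0 lt, of w] w by simp
  have "\<phi> w * (2 * of_real M - l z) = l z"
    using nz[of w] w by (simp add: \<phi>_def zw)
  then have "l z * (1 + \<phi> w) = 2 * of_real M * \<phi> w" by (simp add: algebra_simps)
  then have "norm (l z) * norm (1 + \<phi> w) = 2 * M * norm (\<phi> w)"
    using M0 by (metis abs_of_pos norm_mult norm_numeral norm_of_real)
  moreover have "norm (1 + \<phi> w) \<ge> 1/2" using norm_diff_ineq[of 1 "\<phi> w"] n by simp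
  then have "norm (l z) * (1/2) \<le> norm (l z) * norm (1 + \<phi> w)" by (intro mult_left_mono) auto
  moreover have "2 * M * norm (\<phi> w) \<le> 2 * M * (1/2)" using n M0 by (intro mult_left_mono) auto
  ultimately show ?thesis by linarith
qed

text \<open>Normalised to 1 at the origin, so that dividing by it preserves
  \<open>G 0\<close>.\<close>

definition zero_prod :: "(complex \<Rightarrow> complex) \<Rightarrow> complex set \<Rightarrow> complex \<Rightarrow> complex" where
  "zero_prod G S z = (\<Prod>a\<in>S. (1 - z / a) ^ nat (zorder G a))"

lemma holomorphic_zero_prod: "zero_prod G S holomorphic_on A"
  unfolding zero_prod_def [abs_def] divide_inverse by (intro holomorphic_intros)

lemma zero_prod_eq_0_iff:
  assumes "finite S" "0 \<notin> S" "\<And>a. a \<in> S \<Longrightarrow> zorder G a > 0"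
  shows "zero_prod G S z = 0 \<longleftrightarrow> z \<in> S"
  using assms by (auto simp: zero_prod_def)

lemma has_field_derivative_zero_prod:
  assumes "finite S" "0 \<notin> S" "z \<notin> S"
  shows "(zero_prod G S has_field_derivative
           (zero_prod G S z * (\<Sum>a\<in>S. of_nat (nat (zorder G a)) / (z - a)))) (at z)"
  using assms
proof (induction S rule: finite_induct)
  case empty
  then show ?case by (simp add: zero_prod_def)
next
  case (insert b S)
  then have b: "b \<noteq> 0" "z \<noteq> b" by auto
  define n where "n = nat (zorder G b)"
  have D: "((\<lambda>z. (1 - z / b) ^ n) has_field_derivative ((1 - z / b) ^ n * (of_nat n / (z - b)))) (at z)"
  proof (cases n)
    case (Suc k)
    have "((\<lambda>z. (1 - z / b) ^ n) has_field_derivative (of_nat n * (1 - z / b) ^ (n - 1) * (- 1 / b))) (at z)"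
      by (auto intro!: derivative_eq_intros simp: b)
    also have "of_nat n * (1 - z / b) ^ (n - 1) * (- 1 / b) = (1 - z / b) ^ n * (of_nat n / (z - b))"
    proof -
      have "1 - z / b = (z - b) * (- 1 / b)" using b by (simp add: field_simps)
      then have e: "(1 - z / b) / (z - b) = - 1 / b" using b by simp
      have "(1 - z / b) ^ n * (of_nat n / (z - b)) = of_nat n * (1 - z / b) ^ (n - 1) * ((1 - z / b) / (z - b))"
        using Suc by simp
      then show ?thesis unfolding e ..
    qed
    finally show ?thesis .
  qed auto
  have "((\<lambda>z. (1 - z / b) ^ n * zero_prod G S z) has_field_derivative
      ((1 - z / b) ^ n * (of_nat n / (z - b)) * zero_prod G S z +
       (zero_prod G S z * (\<Sum>a\<in>S. of_nat (nat (zorder G a)) / (z - a))) * (1 - z / b) ^ n)) (at z)"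
    using insert by (intro DERIV_mult D insert.IH) auto
  moreover have "zero_prod G (insert b S) = (\<lambda>z. (1 - z / b) ^ n * zero_prod G S z)"
    using insert by (simp add: zero_prod_def fun_eq_iff n_def)
  ultimately show ?case using insert by (simp add: n_def algebra_simps)
qed

text \<open>Matching orders at every point are what the factorization of \<open>G\<close> by this
  product requires.\<close>

lemma zorder_zero_prod:
  assumes S: "finite S" "0 \<notin> S" "\<And>a. a \<in> S \<Longrightarrow> zorder G a > 0"
  shows "zorder (zero_prod G S) z = (if z \<in> S then zorder G z else 0)"
proof -
  have ana: "(\<lambda>z. (1 - z / a) ^ nat (zorder G a)) analytic_on {z}" for a
    unfolding divide_inverse by (intro analytic_intros)
  have nz: "eventually (\<lambda>w. w \<notin> S) (at z)"
  proof -
    have "eventually (\<lambda>w. w \<in> - (S - {z})) (nhds z)"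
      using S by (intro eventually_nhds_in_open open_Compl finite_imp_closed) auto
    then show ?thesis by (auto simp: eventually_at_filter elim!: eventually_mono)
  qed
  have "zorder (\<lambda>z. \<Prod>a\<in>S. (1 - z / a) ^ nat (zorder G a)) z = (\<Sum>a\<in>S. zorder (\<lambda>z. (1 - z / a) ^ nat (zorder G a)) z)"
  proof (rule zorder_prod_analytic[OF ana])
    show "\<forall>\<^sub>F z in at z. (\<Prod>a\<in>S. (1 - z / a) ^ nat (zorder G a)) \<noteq> 0"
      using nz by eventually_elim (use S zero_prod_eq_0_iff[OF S] in \<open>simp add: zero_prod_def\<close>)
  qed
  also have "\<dots> = (\<Sum>a\<in>S. if a = z then zorder G z else 0)"
  proof (rule sum.cong[OF refl])
    fix a assume a: "a \<in> S"
    then have a0: "a \<noteq> 0" using S by auto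
    show "zorder (\<lambda>z. (1 - z / a) ^ nat (zorder G a)) z = (if a = z then zorder G z else 0)"
    proof (cases "a = z")
      case True
      have "zorder (\<lambda>w. (1 - w / a) ^ nat (zorder G a)) z = zorder G a"
      proof (rule zorder_eqI[of UNIV z "\<lambda>_. (- 1 / a) ^ nat (zorder G a)"])
        fix w assume "w \<noteq> z"
        have "1 - w / a = (- 1 / a) * (w - a)" using a0 by (simp add: field_simps)
        then show "(1 - w / a) ^ nat (zorder G a) = (- 1 / a) ^ nat (zorder G a) * (w - z) powi zorder G a"
          using True S(3)[OF a] by (simp only: power_mult_distrib power_int_def) simp
      qed (use a0 in \<open>auto\<close>)
      then show ?thesis using True by simp
    next
      case False
      then show ?thesis using a0 ana by (auto intro!: zorder_eq_0I)
    qed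
  qed
  also have "\<dots> = (if z \<in> S then zorder G z else 0)" using S by simp
  finally show ?thesis by (simp add: zero_prod_def [abs_def])
qed

text \<open>After division by the zeros in the disc of radius R, the logarithm \<open>l\<close> of
  the zero-free quotient is O(R^(3/2)) on a smaller disc, so l'' is O(R^(-1/2)). Since l' vanishes
  at 0 by evenness, l' is O(|z| R^(-1/2)), and l' is exactly the error of the partial
  fraction.\<close>

theorem even_entire_log_deriv:
  fixes G :: "complex \<Rightarrow> complex"
  assumes hol: "G holomorphic_on UNIV" and even: "\<And>z. G (- z) = G z" and G0: "G 0 \<noteq> 0"
    and C: "C > 0" and growth: "\<And>z. norm (G z) \<le> exp (C * (1 + norm z) powr (3/2))"
  defines "S \<equiv> \<lambda>R. {a. G a = 0 \<and> norm a < R}"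
  obtains K where "K > 0"
    "\<And>R. finite (S R)"
    "\<And>R z. R \<ge> 1 \<Longrightarrow> norm z \<le> R / 4 \<Longrightarrow> G z \<noteq> 0 \<Longrightarrow>
       norm (deriv G z / G z - (\<Sum>a\<in>S R. of_int (zorder G a) / (z - a))) \<le> K * norm z * R powr (- 1/2)"
proof -
  define C1 where "C1 = 6 * C + \<bar>ln (norm (G 0))\<bar> + 1"
  have C1: "C1 > 0" using C by (simp add: C1_def)
  let ?s = "\<lambda>w R. \<Sum>a\<in>S R. complex_of_int (zorder G a) / (w - a)"
  have ev: "eventually (\<lambda>w. G w \<noteq> 0) (at z)" for z
    using non_zero_neighbour_alt[of G UNIV z 0] hol G0 connected_UNIV by simp
  have ana: "G analytic_on A" for A
    using hol by (meson analytic_on_holomorphic open_UNIV subset_UNIV)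
  have zpos: "zorder G a > 0" if "G a = 0" for a
    using zorder_pos_iff'[of G a] ana ev[of a] that by (simp add: eventually_frequently)
  have fin: "finite (S R)" for R
  proof (cases "G constant_on UNIV")
    case True
    then have "S R = {}" using G0 unfolding S_def constant_on_def by auto
    then show ?thesis by simp
  next
    case False
    then have "finite {z \<in> cball 0 R. G z = 0}"
      by (intro holomorphic_compact_finite_zeros[OF hol]) auto
    then show ?thesis by (rule rev_finite_subset) (auto simp: S_def)
  qed
  have zsym: "zorder G (- a) = zorder G a" for a
    using zorder_scale[of G "-1" a] analytic_on_imp_meromorphic_on[OF ana] even by simp
  have Ssym: "uminus ` S R = S R" for R
  proof -
    have "x \<in> uminus ` S R" if "x \<in> S R" for x
      using that even by (intro image_eqI[of _ _ "- x"]) (auto simp: S_def)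
    then show ?thesis using even by (auto simp: S_def)
  qed
  have dG: "(G has_field_derivative deriv G z) (at z)" for z
    by (rule holomorphic_derivI[OF hol]) auto
  have dG0: "deriv G 0 = 0"
  proof -
    have "((\<lambda>z. G (- z)) has_field_derivative (deriv G 0 * (- 1))) (at 0)"
      by (rule DERIV_chain2[of G]) (use dG[of 0] in \<open>auto intro!: derivative_eq_intros\<close>)
    then have "(G has_field_derivative (- deriv G 0)) (at 0)" by (simp add: even)
    then have "- deriv G 0 = deriv G 0" using dG by (rule DERIV_unique)
    then show ?thesis by simp
  qed
  have main: "norm (deriv G z / G z - ?s z R) \<le> (64 * C1) * norm z * R powr (- 1/2)"
    if R: "R \<ge> 1" and z: "norm z \<le> R / 4" and Gz: "G z \<noteq> 0" for R z
  proof -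
    define P where "P = zero_prod G (S R)"
    have SR: "finite (S R)" "0 \<notin> S R" "\<And>a. a \<in> S R \<Longrightarrow> zorder G a > 0"
      using fin G0 zpos by (auto simp: S_def)
    have P0: "P w = 0 \<longleftrightarrow> w \<in> S R" for w unfolding P_def by (rule zero_prod_eq_0_iff[OF SR])
    have holP: "P holomorphic_on A" for A unfolding P_def by (rule holomorphic_zero_prod)
    obtain h where h: "h holomorphic_on ball 0 R" "\<And>z. z \<in> ball 0 R \<Longrightarrow> h z \<noteq> 0"
      "\<And>z. z \<in> ball 0 R \<Longrightarrow> G z = h z * P z"
    proof (rule holomorphic_zorder_factorization[of G "ball 0 R" P])
      show "P w = 0 \<longleftrightarrow> G w = 0" if "w \<in> ball 0 R" for w using that by (auto simp: P0 S_def)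
      show "zorder P w = zorder G w" if "w \<in> ball 0 R" for w
        using that zorder_zero_prod[OF SR, of w] zorder_eq_0I[of G w] ana by (auto simp: P_def S_def)
    qed (use holP in \<open>auto intro: holomorphic_on_subset[OF hol]\<close>)
    \<comment> \<open>The quotient G / P with its removable singularities filled in by
      \<open>h\<close>, hence entire; this allows the maximum principle on a disc larger than that
      containing the zeros.\<close>
    define H where "H = (\<lambda>w. if norm w < R then h w else G w / P w)"
    have "H holomorphic_on ball 0 R \<union> - S R"
    proof (rule holomorphic_on_Un)
      show "H holomorphic_on ball 0 R" using h(1) by (rule holomorphic_transform) (simp add: H_def)
      have "(\<lambda>w. G w / P w) holomorphic_on - S R"
        using P0 by (intro holomorphic_on_divide holP holomorphic_on_subset[OF hol]) auto
      then show "H holomorphic_on - S R"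
      proof (rule holomorphic_transform)
        fix w assume "w \<in> - S R"
        then show "G w / P w = H w" using h(3)[of w] P0[of w] by (auto simp: H_def)
      qed
    qed (use SR(1) in \<open>auto intro: finite_imp_closed\<close>)
    moreover have "ball 0 R \<union> - S R = UNIV" by (auto simp: S_def)
    ultimately have holH: "H holomorphic_on A" for A using holomorphic_on_subset by auto
    define B where "B = exp (6 * C * R powr (3/2))"
    have Hbd: "norm (H w) \<le> B" if "norm w < R" for w
    proof (rule maximum_modulus_frontier[of H "ball 0 (2 * R)"])
      show "continuous_on (closure (ball 0 (2 * R))) H"
        using holH by (rule holomorphic_on_imp_continuous_on)
      fix u assume "u \<in> frontier (ball (0::complex) (2 * R))"
      then have u: "norm u = 2 * R" using R by (simp add: frontier_ball)
      \<comment> \<open>On the circle of radius 2 R, twice as far out as any zero in use, each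
        factor of the product has modulus at least 1, so dividing by it does not enlarge
        \<open>G\<close>.\<close>
      have "norm (1 - u / a) \<ge> 1" if "a \<in> S R" for a
      proof -
        have a: "0 < norm a" "norm a < R" using that SR by (auto simp: S_def)
        then have "norm (u / a) \<ge> 2" using u by (simp add: norm_divide field_simps)
        then show ?thesis using norm_triangle_ineq2[of "u / a" 1] by (simp add: norm_minus_commute)
      qed
      then have "1 \<le> norm (P u)"
        unfolding P_def zero_prod_def prod_norm[symmetric] norm_power
        by (intro prod_ge_1 one_le_power) auto
      then have "norm (G u) / norm (P u) \<le> norm (G u) / 1" by (intro divide_left_mono) auto
      then have "norm (H u) \<le> norm (G u)" using u R by (simp add: H_def norm_divide)
      also have "\<dots> \<le> exp (C * (1 + norm u) powr (3/2))" by (rule growth)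
      also have "\<dots> \<le> B"
      proof -
        have "(1 + norm u) powr (3/2) \<le> (3 * R) powr (3/2)" using u R by (intro powr_mono2) auto
        also have "\<dots> = 3 powr (3/2) * R powr (3/2)" by (rule powr_mult)
        also have "\<dots> \<le> 6 * R powr (3/2)"
        using three_powr_le by (intro mult_right_mono) auto
        finally show ?thesis using C by (simp add: B_def mult.assoc mult.left_commute[of 6])
      qed
      finally show "norm (H u) \<le> B" .
    qed (use that R in \<open>auto intro: holH\<close>)
    have h0: "h 0 = G 0" using h(3)[of 0] R by (simp add: P_def zero_prod_def)
    obtain g where g: "g holomorphic_on ball 0 R" "\<And>x. x \<in> ball 0 R \<Longrightarrow> exp (g x) = h x"
      using holomorphic_logarithm_exists[of "ball 0 R" h 0] h R by (auto simp: convex_ball)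
    define l where "l = (\<lambda>w. g w - g 0)"
    \<comment> \<open>The term |ln |G 0|| in \<open>C1\<close> absorbs the subtraction of
      \<open>g 0\<close>, and its 1 makes the bound strict; both use R^(3/2) >= 1.\<close>
    define M where "M = C1 * R powr (3/2)"
    have M: "M > 0" using C1 R by (simp add: M_def)
    have holl: "l holomorphic_on ball 0 R" unfolding l_def by (intro holomorphic_intros g)
    have "Re (l w) < M" if "norm w < R" for w
    proof -
      have "norm (h w) \<le> B" using Hbd[OF that] that by (simp add: H_def)
      then have "exp (Re (g w)) \<le> exp (6 * C * R powr (3/2))"
        using g(2)[of w] that by (simp add: B_def flip: norm_exp_eq_Re)
      then have 1: "Re (g w) \<le> 6 * C * R powr (3/2)" by simp
      have "norm (G 0) = exp (Re (g 0))" using g(2)[of 0] R h0 by (simp flip: norm_exp_eq_Re)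
      then have 2: "Re (g 0) = ln (norm (G 0))" by simp
      have "1 \<le> R powr (3/2)" using R powr_mono[of 0 "3/2" R] by simp
      then have "(\<bar>ln (norm (G 0))\<bar> + 1) * 1 \<le> (\<bar>ln (norm (G 0))\<bar> + 1) * R powr (3/2)"
        by (intro mult_left_mono) auto
      then show ?thesis using 1 2 by (simp add: l_def M_def C1_def algebra_simps)
    qed
    then have lbd: "norm (l w) \<le> 2 * M" if "norm w \<le> R / 2" for w
      using Borel_Caratheodory_half[OF holl, of M w] R that by (simp add: l_def)
    have dl: "(l has_field_derivative deriv l w) (at w)" if "norm w < R" for w
      using that by (intro holomorphic_derivI[OF holl]) auto
    \<comment> \<open>Discs of radius R / 4 about points of norm at most R / 4 stay inside the half
      radius, where Borel-Caratheodory applies.\<close>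
    have dl2: "norm ((deriv ^^ 2) l w) \<le> fact 2 * (2 * M) / (R / 4) ^ 2" if w: "norm w \<le> R / 4" for w
    proof (rule Cauchy_inequality)
      have sub: "cball w (R / 4) \<subseteq> ball 0 R"
      proof
        fix x assume "x \<in> cball w (R / 4)"
        then show "x \<in> ball 0 R" using w R norm_triangle_ineq2[of x w] by (simp add: dist_norm norm_minus_commute)
      qed
      then show "l holomorphic_on ball w (R / 4)"
        by (intro holomorphic_on_subset[OF holl]) (use ball_subset_cball in blast)
      show "continuous_on (cball w (R / 4)) l"
        using sub by (intro holomorphic_on_imp_continuous_on holomorphic_on_subset[OF holl])
      show "norm (l x) \<le> 2 * M" if "norm (w - x) = R / 4" for x
        using that w norm_triangle_ineq2[of x w] by (intro lbd) (simp add: norm_minus_commute)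
    qed (use R in simp)
    have l_eq: "deriv l w = deriv G w / G w - ?s w R"
      if w: "norm w < R" "G w \<noteq> 0" for w
    proof -
      have wS: "w \<notin> S R" using w by (simp add: S_def)
      have "((\<lambda>w. exp (g 0) * (exp (l w) * P w)) has_field_derivative
          exp (g 0) * (exp (l w) * deriv l w * P w + P w * (\<Sum>a\<in>S R. of_nat (nat (zorder G a)) / (w - a)) * exp (l w))) (at w)"
        unfolding P_def
        by (intro DERIV_cmult DERIV_mult has_field_derivative_zero_prod SR wS DERIV_chain2[of exp] DERIV_exp dl w)
      moreover have "eventually (\<lambda>w. exp (g 0) * (exp (l w) * P w) = G w) (nhds w)"
      proof -
        have "eventually (\<lambda>w. w \<in> ball 0 R) (nhds w)" using w by (intro eventually_nhds_in_open) auto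
        then show ?thesis
          by eventually_elim (use g(2) h(3) in \<open>simp add: l_def exp_diff\<close>)
      qed
      ultimately have "(G has_field_derivative
          exp (g 0) * (exp (l w) * deriv l w * P w + P w * (\<Sum>a\<in>S R. of_nat (nat (zorder G a)) / (w - a)) * exp (l w))) (at w)"
        by (subst (asm) DERIV_cong_ev[OF refl _ refl]) auto
      then have "deriv G w = exp (g 0) * (exp (l w) * deriv l w * P w + P w * (\<Sum>a\<in>S R. of_nat (nat (zorder G a)) / (w - a)) * exp (l w))"
        by (rule DERIV_imp_deriv)
      also have "\<dots> = (exp (g 0) * exp (l w) * P w) * (deriv l w + (\<Sum>a\<in>S R. of_nat (nat (zorder G a)) / (w - a)))"
        by (simp add: algebra_simps)
      also have "exp (g 0) * exp (l w) * P w = G w"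
        using g(2)[of w] h(3)[of w] w by (simp add: l_def exp_diff)
      also have "(\<Sum>a\<in>S R. of_nat (nat (zorder G a)) / (w - a)) = ?s w R"
        using SR(3) by (intro sum.cong refl) (metis less_imp_le of_int_of_nat_eq nat_0_le)
      finally show ?thesis using w by simp
    qed
    \<comment> \<open>The zeros come in pairs a, -a of equal order, so their reciprocals cancel, and
      G'(0) = 0 as well.\<close>
    have "deriv l 0 = 0"
    proof -
      have "?s 0 R = (\<Sum>a\<in>uminus ` S R. of_int (zorder G a) / (0 - a))"
        by (simp add: Ssym)
      also have "\<dots> = (\<Sum>a\<in>S R. of_int (zorder G (- a)) / (0 - (- a)))"
        by (subst sum.reindex) (auto simp: inj_on_def)
      also have "\<dots> = - ?s 0 R"
        by (simp add: zsym sum_negf)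
      finally have "?s 0 R = (0::complex)" by (simp add: eq_neg_iff_add_eq_0)
      then show ?thesis using l_eq[of 0] G0 R dG0 by simp
    qed
    moreover have "norm (deriv l z - deriv l 0) \<le> fact 2 * (2 * M) / (R / 4) ^ 2 * norm (z - 0)"
    proof (rule field_differentiable_bound[of "cball 0 (R / 4)"])
      fix w :: complex assume "w \<in> cball 0 (R / 4)"
      then have w: "norm w \<le> R / 4" by simp
      have "(deriv l has_field_derivative deriv (deriv l) w) (at w)"
        using w R by (intro holomorphic_derivI[OF holomorphic_deriv[OF holl]]) auto
      then show "(deriv l has_field_derivative (deriv ^^ 2) l w) (at w within cball 0 (R / 4))"
        by (simp add: numeral_2_eq_2 has_field_derivative_at_within)
      show "norm ((deriv ^^ 2) l w) \<le> fact 2 * (2 * M) / (R / 4) ^ 2" using dl2[OF w] .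
    qed (use z R in auto)
    ultimately have "norm (deriv l z) \<le> fact 2 * (2 * M) / (R / 4) ^ 2 * norm z" by simp
    also have "fact 2 * (2 * M) / (R / 4) ^ 2 = 64 * C1 * (R powr (3/2) * R powr (-2))"
      using R by (simp add: M_def powr_minus powr_numeral field_simps power2_eq_square)
    also have "R powr (3/2) * R powr (-2) = R powr (- 1/2)" unfolding powr_add[symmetric] by simp
    finally show ?thesis using l_eq[of z] z R Gz by (simp add: mult_ac)
  qed
  show ?thesis
    by (rule that[of "64 * C1"]) (use C1 fin main in auto)
qed

section \<open>The argument of the completed zeta function\<close>

lemma Im_Ln_eq_arctan:
  assumes "Re z > 0"
  shows "Im (Ln z) = arctan (Im z / Re z)"
  using assms by (metis Arg_eq_Im_Ln arg_conv_arctan order_less_irrefl zero_complex.simps(1))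

text \<open>Stirling's formula for the argument on Re = 2 only. The limit formula for Gamma gives
  the argument as y ln n minus a sum of arctangents, which is monotone in the summation index and
  can be compared with an integral.\<close>

lemma Im_ln_Gamma_bound:
  fixes y :: real
  assumes y: "y \<ge> 1/2"
  shows "\<bar>Im (ln_Gamma (Complex 2 y)) - (y * ln y - y)\<bar> \<le> 8"
proof -
  define z where "z = Complex 2 y"
  \<comment> \<open>An antiderivative of u -> arctan (y / u); for large u it behaves like y ln u +
    y, which yields the term - y of the result.\<close>
  define F where "F = (\<lambda>u::real. u * arctan (y / u) + y / 2 * ln (u\<^sup>2 + y\<^sup>2))"
  have y0: "y > 0" using y by simp
  have pos: "u\<^sup>2 + y\<^sup>2 > 0" for u using y0 by (simp add: add_nonneg_pos)
  have dF: "(F has_real_derivative arctan (y / u)) (at u)" if u: "u > 0" for u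
  proof -
    have "(F has_real_derivative (1 * arctan (y / u) + (inverse (1 + (y / u)\<^sup>2) * (- y / u\<^sup>2)) * u + y / 2 * ((2 * u) / (u\<^sup>2 + y\<^sup>2)))) (at u)"
    proof -
      have d1: "((\<lambda>u. arctan (y / u)) has_real_derivative (inverse (1 + (y / u)\<^sup>2) * (- y / u\<^sup>2))) (at u)"
      proof (rule DERIV_chain2[OF DERIV_arctan])
        show "((\<lambda>u. y / u) has_real_derivative - y / u\<^sup>2) (at u)"
          using u by (auto intro!: derivative_eq_intros simp: power2_eq_square)
      qed
      have d2: "((\<lambda>u. ln (u\<^sup>2 + y\<^sup>2)) has_real_derivative ((2 * u) / (u\<^sup>2 + y\<^sup>2))) (at u)"
        using pos[of u] by (auto intro!: derivative_eq_intros simp: divide_inverse)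
      show ?thesis unfolding F_def by (intro DERIV_add DERIV_mult DERIV_ident d1 DERIV_cmult d2)
    qed
    also have "1 * arctan (y / u) + (inverse (1 + (y / u)\<^sup>2) * (- y / u\<^sup>2)) * u + y / 2 * ((2 * u) / (u\<^sup>2 + y\<^sup>2)) = arctan (y / u)"
    proof -
      have "inverse (1 + (y / u)\<^sup>2) = u\<^sup>2 / (u\<^sup>2 + y\<^sup>2)" using u pos[of u] by (simp add: power_divide field_simps)
      then show ?thesis using u by (simp add: power2_eq_square)
    qed
    finally show ?thesis .
  qed
  have step: "arctan (y / (u + 1)) \<le> F (u + 1) - F u \<and> F (u + 1) - F u \<le> arctan (y / u)" if u: "u > 0" for u
  proof -
    obtain v where v: "u < v" "v < u + 1" "F (u + 1) - F u = (u + 1 - u) * arctan (y / v)"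
      using MVT2[of u "u + 1" F "\<lambda>v. arctan (y / v)"] dF u by auto
    have "y / (u + 1) \<le> y / v" "y / v \<le> y / u" using v u y0 by (auto intro!: divide_left_mono)
    then show ?thesis using v by (simp add: arctan_monotone')
  qed
  define A where "A = (\<lambda>n. arctan (y / 2) + (\<Sum>k=1..n. arctan (y / (real k + 2))))"
  have A1: "A n \<le> F (real n + 2) - F 1" for n
  proof (induction n)
    case 0
    show ?case using step[of 1] by (simp add: A_def)
  next
    case (Suc n)
    then show ?case using step[of "real n + 2"] by (simp add: A_def add_ac)
  qed
  have A2: "A n \<ge> F (real n + 3) - F 2" for n
  proof (induction n)
    case 0
    show ?case using step[of 2] by (simp add: A_def)
  next
    case (Suc n)
    then show ?case using step[of "real n + 3"] by (simp add: A_def add_ac)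
  qed
  have ser: "Im (ln_Gamma_series z n) = y * ln (real n) - A n" if n: "n > 0" for n
  proof -
    have "Im (Ln z) = arctan (y / 2)" by (subst Im_Ln_eq_arctan) (auto simp: z_def)
    moreover have "Im (ln (z / of_nat k + 1)) = arctan (y / (real k + 2))" if k: "k \<in> {1..n}" for k
    proof -
      have "z / of_nat k = Complex (2 / real k) (y / real k)" by (simp add: z_def complex_eq_iff Re_divide_of_nat Im_divide_of_nat)
      then have "Re (z / of_nat k + 1) = (2 + real k) / real k" "Im (z / of_nat k + 1) = y / real k" using k by (auto simp: field_simps)
      moreover have "Re (z / of_nat k + 1) > 0" using calculation k by auto
      ultimately show ?thesis using k by (subst Im_Ln_eq_arctan) (auto simp: add_ac)
    qed
    ultimately show ?thesis
      using n by (simp add: ln_Gamma_series_def A_def Im_sum Ln_of_nat) (simp add: z_def)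
  qed
  have lim: "(\<lambda>n. Im (ln_Gamma_series z n)) \<longlonglongrightarrow> Im (ln_Gamma z)"
    by (intro tendsto_Im ln_Gamma_complex_LIMSEQ) (auto simp: z_def elim!: nonpos_Ints_cases simp: complex_eq_iff)
  have l1: "(\<lambda>n. y * ln (real n) - F (real n + 2)) \<longlonglongrightarrow> - y"
    unfolding F_def using y0 by real_asymp
  have l2: "(\<lambda>n. y * ln (real n) - F (real n + 3)) \<longlonglongrightarrow> - y"
    unfolding F_def using y0 by real_asymp
  have lo: "Im (ln_Gamma z) \<ge> - y + F 1"
  proof (rule tendsto_le[OF _ lim tendsto_add[OF l1 tendsto_const]])
    show "\<forall>\<^sub>F n in sequentially. y * ln (real n) - F (real n + 2) + F 1 \<le> Im (ln_Gamma_series z n)"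
      using eventually_gt_at_top[of 0]
    proof eventually_elim
      case (elim n)
      then show ?case using A1[of n] ser[of n] by simp
    qed
  qed simp
  have hi: "Im (ln_Gamma z) \<le> - y + F 2"
  proof (rule tendsto_le[OF _ tendsto_add[OF l2 tendsto_const] lim])
    show "\<forall>\<^sub>F n in sequentially. Im (ln_Gamma_series z n) \<le> y * ln (real n) - F (real n + 3) + F 2"
      using eventually_gt_at_top[of 0]
    proof eventually_elim
      case (elim n)
      then show ?case using A2[of n] ser[of n] by simp
    qed
  qed simp
  \<comment> \<open>At the lower limits u = 1 and u = 2, \<open>F\<close> differs from y ln y by a
    bounded amount; the worst case is pi + 4 < 8.\<close>
  have Fb: "0 \<le> F u - y * ln y \<and> F u - y * ln y \<le> u * (pi / 2) + u\<^sup>2" if u: "u > 0" for u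
  proof -
    have "u\<^sup>2 + y\<^sup>2 = y\<^sup>2 * (1 + (u / y)\<^sup>2)" using y0 by (simp add: field_simps)
    moreover have "1 + (u / y)\<^sup>2 > 0" by (simp add: add_pos_nonneg)
    ultimately have "ln (u\<^sup>2 + y\<^sup>2) = 2 * ln y + ln (1 + (u / y)\<^sup>2)"
      using y0 by (simp add: ln_mult ln_realpow)
    then have e: "F u - y * ln y = u * arctan (y / u) + y / 2 * ln (1 + (u / y)\<^sup>2)"
      by (simp add: F_def algebra_simps)
    have 1: "0 \<le> arctan (y / u)" "arctan (y / u) \<le> pi / 2" using y0 u arctan_ubound[of "y / u"] by auto
    have 2: "0 \<le> ln (1 + (u / y)\<^sup>2)" "ln (1 + (u / y)\<^sup>2) \<le> (u / y)\<^sup>2"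
      by (auto intro: ln_add_one_self_le_self)
    have "y / 2 * ln (1 + (u / y)\<^sup>2) \<le> y / 2 * (u / y)\<^sup>2" using 2 y0 by (intro mult_left_mono) auto
    also have "\<dots> = u\<^sup>2 / (2 * y)" using y0 by (simp add: power2_eq_square field_simps)
    also have "\<dots> \<le> u\<^sup>2 / 1" using y by (intro divide_left_mono) auto
    finally have "y / 2 * ln (1 + (u / y)\<^sup>2) \<le> u\<^sup>2" by simp
    moreover have "u * arctan (y / u) \<le> u * (pi / 2)" using 1 u by (intro mult_left_mono) auto
    moreover have "0 \<le> u * arctan (y / u)" "0 \<le> y / 2 * ln (1 + (u / y)\<^sup>2)" using 1 2 u y0 by simp_all
    ultimately show ?thesis unfolding e by (intro conjI; linarith)
  qed
  show ?thesis
    using lo hi Fb[of 1] Fb[of 2] pi_less_4 unfolding z_def abs_le_iff by simp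
qed

section \<open>The argument of xi along the line Re s = 2\<close>

text \<open>The change of argument of (s - \<rho>) (s - conjugate of \<rho>) as s moves from 2 to 2
  + i t, for a zero on the critical line at height g; 3/2 is the distance from Re s = 2 to that
  line.\<close>

definition poisson_arg :: "real \<Rightarrow> real \<Rightarrow> real" where
  "poisson_arg g t = arctan ((t - g) / (3/2)) + arctan ((t + g) / (3/2))"

lemma poisson_arg_0 [simp]: "poisson_arg g 0 = 0"
proof -
  have "(0 - g) / (3/2) = - ((0 + g) / (3/2))" by simp
  then show ?thesis unfolding poisson_arg_def by (simp only: arctan_minus)
qed

text \<open>A logarithm of \<open>xi\<close> assembled from principal branches, all of them
  holomorphic for Re s >= 2 because zeta has positive real part there.\<close>

definition xi_log :: "complex \<Rightarrow> complex" where
  "xi_log s = Ln (s - 1) - s / 2 * of_real (ln pi) + ln_Gamma (1 + s / 2) + Ln (zeta s)"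

lemma exp_xi_log:
  assumes "Re s > 1" "zeta s \<noteq> 0"
  shows "exp (xi_log s) = xi s"
proof -
  have s: "s \<noteq> 1" "1 + s / 2 \<notin> \<int>\<^sub>\<le>\<^sub>0" using assms by (auto intro!: not_nonpos_Ints_if_Re_pos)
  have "exp (xi_log s) = (s - 1) * exp (- (s / 2 * of_real (ln pi))) * Gamma (1 + s / 2) * zeta s"
  proof -
    have "exp (xi_log s) = exp (Ln (s - 1)) * exp (- (s / 2 * of_real (ln pi))) * exp (ln_Gamma (1 + s / 2)) * exp (Ln (zeta s))"
      unfolding xi_log_def exp_add[symmetric] by simp
    then show ?thesis using s assms by (simp add: Gamma_complex_altdef)
  qed
  also have "exp (- (s / 2 * of_real (ln pi))) = of_real pi powr (- s / 2)"
    by (simp add: powr_def Ln_of_real)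
  finally show ?thesis using assms s xi_eq[of s] by (simp add: mult_ac)
qed

lemma not_nonpos_Reals_if_Re_pos: "Re z > 0 \<Longrightarrow> z \<notin> \<real>\<^sub>\<le>\<^sub>0"
  by (auto simp: complex_nonpos_Reals_iff)

lemma holomorphic_zeta: "zeta holomorphic_on - {1}"
  using is_zeta_zeta_ext holomorphic_transform[of zeta_ext "- {1}" zeta] zeta_eq_zeta_ext
  by (auto simp: is_zeta_def)

text \<open>The derivative found from the summands need not be simplified: differentiating exp
  (\<open>xi_log\<close>) = \<open>xi\<close> identifies it as the logarithmic derivative.\<close>

lemma has_field_derivative_xi_log:
  assumes s: "Re s \<ge> 2"
  shows "(xi_log has_field_derivative deriv xi s / xi s) (at s)"
proof -
  have s1: "s \<noteq> 1" using s by auto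
  have dz: "(zeta has_field_derivative deriv zeta s) (at s)"
    by (rule holomorphic_derivI[OF holomorphic_zeta]) (use s1 in auto)
  define L' where "L' = inverse (s - 1) * 1 - of_real (ln pi) / 2 + Digamma (1 + s / 2) * (1/2) + inverse (zeta s) * deriv zeta s"
  have "s - 1 \<notin> \<real>\<^sub>\<le>\<^sub>0" "1 + s / 2 \<notin> \<real>\<^sub>\<le>\<^sub>0" "zeta s \<notin> \<real>\<^sub>\<le>\<^sub>0"
    using s Re_zeta_pos[OF s] by (auto intro!: not_nonpos_Reals_if_Re_pos)
  then have L': "(xi_log has_field_derivative L') (at s)"
    unfolding xi_log_def [abs_def] L'_def
    by (intro DERIV_add DERIV_diff DERIV_chain2[of ln_Gamma] DERIV_chain2[of Ln] has_field_derivative_Ln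
        has_field_derivative_ln_Gamma_complex dz) (auto intro!: derivative_eq_intros)
  have "((\<lambda>w. exp (xi_log w)) has_field_derivative exp (xi_log s) * L') (at s)"
    by (rule DERIV_chain2[OF DERIV_exp L'])
  moreover have "eventually (\<lambda>w. exp (xi_log w) = xi w) (nhds s)"
  proof -
    have "eventually (\<lambda>w. w \<in> {w. Re w > 1}) (nhds s)"
      using s by (intro eventually_nhds_in_open) (auto intro: open_halfspace_Re_gt)
    moreover have "eventually (\<lambda>w. zeta w \<noteq> 0) (nhds s)"
    proof -
      have z: "zeta s \<noteq> 0" using Re_zeta_pos[OF s] by auto
      have "(zeta \<longlongrightarrow> zeta s) (at s)" using DERIV_isCont[OF dz] by (simp add: isCont_def)
      from tendsto_imp_eventually_ne[OF this z] show ?thesis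
        using z by (auto simp: eventually_at_filter elim!: eventually_mono)
    qed
    ultimately show ?thesis by eventually_elim (simp add: exp_xi_log)
  qed
  ultimately have "(xi has_field_derivative exp (xi_log s) * L') (at s)"
    by (subst (asm) DERIV_cong_ev[OF refl _ refl]) auto
  then have "deriv xi s = exp (xi_log s) * L'" by (rule DERIV_imp_deriv)
  moreover have "exp (xi_log s) = xi s" using s Re_zeta_pos[OF s] by (intro exp_xi_log) auto
  ultimately show ?thesis using L' xi_nonzero[OF s] by simp
qed

lemma Im_i_times: "Im (\<i> * w) = Re w"
  by simp

lemma has_real_derivative_Im_xi_log:
  "((\<lambda>t. Im (xi_log (Complex 2 t))) has_real_derivative Re (deriv xi (Complex 2 t) / xi (Complex 2 t))) (at t)"
proof -
  have C: "Complex 2 = (\<lambda>t. 2 + \<i> * of_real t)" by (auto simp: complex_eq_iff)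
  have "(Complex 2 has_vector_derivative \<i>) (at t)"
    unfolding C by (auto intro!: derivative_eq_intros)
  then have "((xi_log \<circ> Complex 2) has_vector_derivative \<i> * (deriv xi (Complex 2 t) / xi (Complex 2 t))) (at t)"
    by (rule field_vector_diff_chain_at) (rule has_field_derivative_xi_log, simp)
  from bounded_linear.has_vector_derivative[OF bounded_linear_Im this]
  show ?thesis
    unfolding has_real_derivative_iff_has_vector_derivative o_def
    by (rule has_vector_derivative_eq_rhs) (simp only: Im_i_times)
qed

text \<open>The logarithms of s - 1 and of zeta contribute at most pi each, and Stirling's error is
  8; the power of pi turns ln (T / 2) into ln (T / (2 pi)).\<close>

lemma Im_xi_log_bound:
  assumes T: "T \<ge> 1"
  shows "\<bar>Im (xi_log (Complex 2 T)) - (T / 2 * ln (T / (2 * pi)) - T / 2)\<bar> \<le> 16"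
proof -
  have "Complex 2 T - 1 \<noteq> 0" "zeta (Complex 2 T) \<noteq> 0"
    using Re_zeta_pos[of "Complex 2 T"] by (auto simp: complex_eq_iff)
  then have "\<bar>Im (Ln (Complex 2 T - 1))\<bar> \<le> pi" "\<bar>Im (Ln (zeta (Complex 2 T)))\<bar> \<le> pi"
    using Im_Ln_le_pi[of "Complex 2 T - 1"] mpi_less_Im_Ln[of "Complex 2 T - 1"]
      Im_Ln_le_pi[of "zeta (Complex 2 T)"] mpi_less_Im_Ln[of "zeta (Complex 2 T)"] by (simp_all add: abs_le_iff)
  moreover have "1 + Complex 2 T / 2 = Complex 2 (T / 2)" by (simp add: complex_eq_iff)
  moreover have "\<bar>Im (ln_Gamma (Complex 2 (T / 2))) - (T / 2 * ln (T / 2) - T / 2)\<bar> \<le> 8"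
    using T by (intro Im_ln_Gamma_bound) simp
  moreover have "T / 2 * ln (T / (2 * pi)) = T / 2 * ln (T / 2) - T / 2 * ln pi"
    using T ln_div[of "T / 2" pi] by (simp add: right_diff_distrib)
  moreover have "Im (Complex 2 T / 2 * of_real (ln pi)) = T / 2 * ln pi" by simp
  moreover have "Im (xi_log (Complex 2 T)) = Im (Ln (Complex 2 T - 1)) - Im (Complex 2 T / 2 * of_real (ln pi))
      + Im (ln_Gamma (1 + Complex 2 T / 2)) + Im (Ln (zeta (Complex 2 T)))"
    by (simp only: xi_log_def plus_complex.sel minus_complex.sel)
  ultimately show ?thesis using pi_less_4 by (simp only:)
qed

text \<open>
  Integrating the partial fraction of \<open>\<xi>'/\<xi>\<close> along \<open>Re s = 2\<close> expresses the argument of \<open>\<xi>\<close>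
  as a sum over the zeros, and Stirling's formula evaluates it.
\<close>

lemma xi_zero_arg_sum:
  assumes RH: "riemann_hypothesis"
  obtains C where "C > 0"
    "\<And>R. finite {\<rho> \<in> upper_zeros. Im \<rho> < R}"
    "\<And>\<rho>. \<rho> \<in> upper_zeros \<Longrightarrow> zorder zeta \<rho> > 0"
    "\<And>T. T \<ge> 1 \<Longrightarrow> \<exists>L. ((\<lambda>R. \<Sum>\<rho> | \<rho> \<in> upper_zeros \<and> Im \<rho> < R. of_int (zorder zeta \<rho>) * poisson_arg (Im \<rho>) T) \<longlongrightarrow> L) at_top
        \<and> \<bar>L - (T / 2 * ln (T / (2 * pi)) - T / 2)\<bar> \<le> C"
proof -
  \<comment> \<open>Centring at 1/2 turns the functional equation into evenness, and RH puts the
    zeros at +- i \<gamma>.\<close>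
  define G where "G = (\<lambda>z. xi (1/2 + z))"
  let ?i = "\<lambda>\<rho>. \<i> * complex_of_real (Im \<rho>)"
  let ?pf = "\<lambda>z \<rho>. 1 / (z - \<i> * complex_of_real (Im \<rho>)) + 1 / (z + \<i> * complex_of_real (Im \<rho>))"
  define U where "U = (\<lambda>R. {\<rho>. \<rho> \<in> upper_zeros \<and> Im \<rho> < R})"
  define S where "S = (\<lambda>R. {a. G a = 0 \<and> norm a < R})"
  have Re: "Re \<rho> = 1/2" if "xi \<rho> = 0" for \<rho>
    using RH that by (simp add: riemann_hypothesis_def nontrivial_zeros_eq)
  have holG: "G holomorphic_on UNIV"
  proof -
    have "(xi \<circ> (\<lambda>z. 1/2 + z)) holomorphic_on UNIV"
      by (rule holomorphic_on_compose_gen[OF _ holomorphic_xi[of UNIV]]) (auto intro!: holomorphic_intros)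
    then show ?thesis by (simp add: G_def o_def)
  qed
  have anaG: "G analytic_on A" for A
    using holG by (meson analytic_on_holomorphic open_UNIV subset_UNIV)
  have even: "G (- z) = G z" for z using xi_reflect[of "1/2 + z"] by (simp add: G_def)
  have G0: "G 0 \<noteq> 0" using xi_one_half_nonzero by (simp add: G_def)
  obtain C0 where C0: "C0 > 0" "\<And>z. norm (G z) \<le> exp (C0 * (1 + norm z) powr (3/2))"
    using xi_growth unfolding G_def by metis
  obtain K where K0: "K > 0" "\<And>R. finite {a. G a = 0 \<and> norm a < R}"
    "\<And>R z. R \<ge> 1 \<Longrightarrow> norm z \<le> R / 4 \<Longrightarrow> G z \<noteq> 0 \<Longrightarrow>
       norm (deriv G z / G z - (\<Sum>a | G a = 0 \<and> norm a < R. of_int (zorder G a) / (z - a))) \<le> K * norm z * R powr (- 1/2)"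
    by (rule even_entire_log_deriv[OF holG even G0 C0], rule that) auto
  have K: "K > 0" "finite (S R)"
    "R \<ge> 1 \<Longrightarrow> norm z \<le> R / 4 \<Longrightarrow> G z \<noteq> 0 \<Longrightarrow>
       norm (deriv G z / G z - (\<Sum>a\<in>S R. of_int (zorder G a) / (z - a))) \<le> K * norm z * R powr (- 1/2)" for R z
    unfolding S_def by (fact K0)+
  have U_xi: "\<rho> \<in> upper_zeros \<longleftrightarrow> xi \<rho> = 0 \<and> Im \<rho> > 0" for \<rho>
    by (auto simp: upper_zeros_def nontrivial_zeros_eq)
  have ord: "zorder G (?i \<rho>) = zorder zeta \<rho>" "zorder G (- (?i \<rho>)) = zorder zeta \<rho>"
    if "\<rho> \<in> upper_zeros" for \<rho>
  proof -
    have \<rho>: "xi \<rho> = 0" "1/2 + ?i \<rho> = \<rho>"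
      using that U_xi Re[of \<rho>] by (auto simp: complex_eq_iff)
    have "zorder G (?i \<rho>) = zorder (\<lambda>u. G (u + ?i \<rho>)) 0" by (rule zorder_shift)
    also have "(\<lambda>u. G (u + ?i \<rho>)) = (\<lambda>u. xi (u + \<rho>))"
      unfolding G_def by (subst \<rho>(2)[symmetric]) (simp add: add_ac)
    also have "zorder (\<lambda>u. xi (u + \<rho>)) 0 = zorder xi \<rho>" by (rule zorder_shift[symmetric])
    also have "\<dots> = zorder zeta \<rho>" using zorder_zeta_eq_zorder_xi[OF \<rho>(1)] by simp
    finally show 1: "zorder G (?i \<rho>) = zorder zeta \<rho>" .
    have "zorder (\<lambda>w. G (-1 * w)) (?i \<rho>) = zorder G (-1 * (?i \<rho>))"
      by (rule zorder_scale[OF analytic_on_imp_meromorphic_on[OF anaG]]) simp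
    then show "zorder G (- (?i \<rho>)) = zorder zeta \<rho>" using 1 even by simp
  qed
  have SU: "S R = ?i ` U R \<union> (\<lambda>\<rho>. - ?i \<rho>) ` U R" for R
  proof (intro equalityI subsetI)
    fix a assume "a \<in> S R"
    then have a: "xi (1/2 + a) = 0" "norm a < R" "a \<noteq> 0" using G0 by (auto simp: S_def G_def)
    have Rea: "Re a = 0" using Re[OF a(1)] by simp
    then have na: "norm a = \<bar>Im a\<bar>" by (simp add: cmod_def)
    have ia: "Im a \<noteq> 0" using Rea a(3) by (auto simp: complex_eq_iff)
    have "xi (1/2 - a) = 0" using a(1) even[of a] by (simp add: G_def)
    show "a \<in> ?i ` U R \<union> (\<lambda>\<rho>. - ?i \<rho>) ` U R"
    proof (cases "Im a > 0")
      case True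
      then have "1/2 + a \<in> U R" using a na by (auto simp: U_def U_xi)
      moreover have "a = \<i> * of_real (Im (1/2 + a))" using Rea by (auto simp: complex_eq_iff)
      ultimately show ?thesis by blast
    next
      case False
      then have "1/2 - a \<in> U R" using a na ia \<open>xi (1/2 - a) = 0\<close> by (auto simp: U_def U_xi)
      moreover have "a = - (\<i> * of_real (Im (1/2 - a)))" using Rea by (auto simp: complex_eq_iff)
      ultimately show ?thesis by blast
    qed
  next
    fix a assume "a \<in> ?i ` U R \<union> (\<lambda>\<rho>. - ?i \<rho>) ` U R"
    then obtain \<rho> where \<rho>: "\<rho> \<in> U R" "a = ?i \<rho> \<or> a = - (?i \<rho>)" by auto
    have "xi \<rho> = 0" "Im \<rho> > 0" "Im \<rho> < R" using \<rho>(1) by (auto simp: U_def U_xi)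
    moreover have "\<rho> = 1/2 + ?i \<rho>" using Re[OF \<open>xi \<rho> = 0\<close>] by (auto simp: complex_eq_iff)
    ultimately have "G (?i \<rho>) = 0" by (simp add: G_def)
    then show "a \<in> S R" using \<rho>(2) \<open>Im \<rho> > 0\<close> \<open>Im \<rho> < R\<close> even by (auto simp: S_def norm_mult)
  qed
  have inj: "inj_on ?i (U R)" "inj_on (\<lambda>\<rho>. - ?i \<rho>) (U R)" for R
  proof -
    have "\<rho> = \<rho>'" if "xi \<rho> = 0" "xi \<rho>' = 0" "Im \<rho> = Im \<rho>'" for \<rho> \<rho>'
      using Re[OF that(1)] Re[OF that(2)] that(3) by (intro complex_eqI) simp_all
    then show "inj_on ?i (U R)" "inj_on (\<lambda>\<rho>. - ?i \<rho>) (U R)"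
      by (auto simp: inj_on_def U_def U_xi)
  qed
  have finU: "finite (U R)" for R
  proof -
    have "finite (?i ` U R)" using K(2)[of R] unfolding SU by simp
    then show ?thesis using inj(1) finite_imageD by blast
  qed
  have mpos: "zorder zeta \<rho> > 0" if "\<rho> \<in> upper_zeros" for \<rho>
  proof -
    have "xi analytic_on {\<rho>}" using holomorphic_xi[of UNIV] by (intro analytic_at[THEN iffD2] exI[of _ UNIV]) auto
    then show ?thesis
      using that U_xi zorder_zeta_eq_zorder_xi[of \<rho>] zorder_pos_iff'[of xi \<rho>] eventually_xi_nonzero[of \<rho>]
      by (simp add: eventually_frequently)
  qed
  have sumS: "(\<Sum>a\<in>S R. of_int (zorder G a) / (z - a)) =
     (\<Sum>\<rho>\<in>U R. of_int (zorder zeta \<rho>) * ?pf z \<rho>)" for R z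
  proof -
    have disj: "?i ` U R \<inter> (\<lambda>\<rho>. - ?i \<rho>) ` U R = {}"
      by (auto simp: U_def U_xi complex_eq_iff)
    have "(\<Sum>a\<in>S R. of_int (zorder G a) / (z - a)) =
       (\<Sum>\<rho>\<in>U R. of_int (zorder G (?i \<rho>)) / (z - ?i \<rho>)) +
       (\<Sum>\<rho>\<in>U R. of_int (zorder G (- (?i \<rho>))) / (z - - (?i \<rho>)))"
      unfolding SU using finU disj
      by (subst sum.union_disjoint) (simp_all add: sum.reindex[OF inj(1)] sum.reindex[OF inj(2)] o_def)
    also have "\<dots> = (\<Sum>\<rho>\<in>U R. of_int (zorder zeta \<rho>) * ?pf z \<rho>)"
      unfolding sum.distrib[symmetric]
      by (intro sum.cong refl) (simp add: ord U_def distrib_left)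
    finally show ?thesis .
  qed
  define \<phi> where "\<phi> = (\<lambda>t. Im (xi_log (Complex 2 t)))"
  define \<psi> where "\<psi> = (\<lambda>R t. \<Sum>\<rho>\<in>U R. of_int (zorder zeta \<rho>) * poisson_arg (Im \<rho>) t)"
  \<comment> \<open>The pair of poles +- i \<gamma> has, on Re z = 3/2, a real part that is the
    derivative of the two arctangents.\<close>
  have d\<psi>: "(\<psi> R has_real_derivative Re (\<Sum>a\<in>S R. of_int (zorder G a) / (Complex (3/2) t - a))) (at t)" for R t
  proof -
    have d: "((\<lambda>t. arctan ((t + c) / (3/2))) has_real_derivative Re (1 / Complex (3/2) (t + c))) (at t)" for c
    proof -
      have "(((\<lambda>t. arctan ((t + c) / (3/2)))) has_real_derivative (inverse (1 + ((t + c) / (3/2))\<^sup>2) * (1 / (3/2)))) (at t)"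
        by (rule DERIV_chain2[OF DERIV_arctan]) (auto intro!: derivative_eq_intros)
      moreover have "inverse (1 + ((t + c) / (3/2))\<^sup>2) * (1 / (3/2)) = Re (1 / Complex (3/2) (t + c))"
      proof -
        have "(3/2)\<^sup>2 + (t + c)\<^sup>2 > 0" by (simp add: add_pos_nonneg)
        then show ?thesis by (simp add: Re_divide field_simps power2_eq_square add_eq_0_iff)
      qed
      ultimately show ?thesis by simp
    qed
    have pa: "(poisson_arg g has_real_derivative Re (1 / (Complex (3/2) t - \<i> * of_real g) + 1 / (Complex (3/2) t + \<i> * of_real g))) (at t)" for g
    proof -
      have "Complex (3/2) t - \<i> * of_real g = Complex (3/2) (t + - g)" "Complex (3/2) t + \<i> * of_real g = Complex (3/2) (t + g)"
        by (auto simp: complex_eq_iff)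
      moreover have "poisson_arg g = (\<lambda>t. arctan ((t + - g) / (3/2)) + arctan ((t + g) / (3/2)))"
        by (auto simp: poisson_arg_def)
      ultimately show ?thesis using DERIV_add[OF d[of "- g"] d[of g]] by simp
    qed
    have "(\<psi> R has_real_derivative (\<Sum>\<rho>\<in>U R. of_int (zorder zeta \<rho>) * Re (?pf (Complex (3/2) t) \<rho>))) (at t)"
      unfolding \<psi>_def by (intro DERIV_sum DERIV_cmult pa)
    also have "(\<Sum>\<rho>\<in>U R. of_int (zorder zeta \<rho>) * Re (?pf (Complex (3/2) t) \<rho>))
      = Re (\<Sum>\<rho>\<in>U R. of_int (zorder zeta \<rho>) * (?pf (Complex (3/2) t) \<rho>))"
      unfolding Re_sum
    proof (intro sum.cong refl)
      fix \<rho>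
      have "Re (of_int m * w) = of_int m * Re w" for m and w :: complex by simp
      then show "of_int (zorder zeta \<rho>) * Re (?pf (Complex (3/2) t) \<rho>)
        = Re (of_int (zorder zeta \<rho>) * (?pf (Complex (3/2) t) \<rho>))"
        by simp
    qed
    finally show ?thesis unfolding sumS .
  qed
  have dG: "deriv G (Complex (3/2) t) = deriv xi (Complex 2 t)" "G (Complex (3/2) t) = xi (Complex 2 t)" for t
  proof -
    have e: "1/2 + Complex (3/2) t = Complex 2 t" by (simp add: complex_eq_iff)
    have "(xi has_field_derivative deriv xi (Complex 2 t)) (at (1/2 + Complex (3/2) t))"
      unfolding e by (rule holomorphic_derivI[OF holomorphic_xi[of UNIV]]) auto
    then have "(G has_field_derivative deriv xi (Complex 2 t) * 1) (at (Complex (3/2) t))"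
      unfolding G_def by (rule DERIV_chain2) (auto intro!: derivative_eq_intros)
    then show "deriv G (Complex (3/2) t) = deriv xi (Complex 2 t)" by (auto intro: DERIV_imp_deriv)
    show "G (Complex (3/2) t) = xi (Complex 2 t)" by (simp add: G_def e)
  qed
  define C where "C = 16 + \<bar>\<phi> 0\<bar>"
  have lim: "((\<lambda>R. \<psi> R T) \<longlongrightarrow> \<phi> T - \<phi> 0) at_top" if T: "T \<ge> 1" for T
  proof -
    \<comment> \<open>The segment from 3/2 to 3/2 + i T lies in |z| <= 2 + T, so R >= 4 (2 + T)
      makes the partial fraction estimate valid along it; the mean value bound then controls the
      arguments.\<close>
    have bd: "\<bar>\<psi> R T - (\<phi> T - \<phi> 0)\<bar> \<le> (K * (2 + T) * T) * R powr (- 1/2)" if R: "R \<ge> 4 * (2 + T)" for R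
    proof -
      have "norm ((\<phi> T - \<psi> R T) - (\<phi> 0 - \<psi> R 0)) \<le> (K * (2 + T) * R powr (- 1/2)) * norm (T - 0)"
      proof (rule field_differentiable_bound[of "{0..T}"])
        fix t assume t: "t \<in> {0..T}"
        show "((\<lambda>t. \<phi> t - \<psi> R t) has_field_derivative
           (Re (deriv xi (Complex 2 t) / xi (Complex 2 t)) - Re (\<Sum>a\<in>S R. of_int (zorder G a) / (Complex (3/2) t - a)))) (at t within {0..T})"
          unfolding \<phi>_def by (rule has_field_derivative_at_within[OF DERIV_diff[OF has_real_derivative_Im_xi_log d\<psi>]])
        have nz: "norm (Complex (3/2) t) \<le> 2 + T" using cmod_le[of "Complex (3/2) t"] t by simp
        have "norm (deriv G (Complex (3/2) t) / G (Complex (3/2) t) - (\<Sum>a\<in>S R. of_int (zorder G a) / (Complex (3/2) t - a)))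
           \<le> K * norm (Complex (3/2) t) * R powr (- 1/2)"
          using R T nz xi_nonzero[of "Complex 2 t"] by (intro K(3)) (auto simp: dG)
        also have "\<dots> \<le> K * (2 + T) * R powr (- 1/2)"
          using nz K(1) by (intro mult_right_mono mult_left_mono) auto
        finally have "norm (deriv xi (Complex 2 t) / xi (Complex 2 t) - (\<Sum>a\<in>S R. of_int (zorder G a) / (Complex (3/2) t - a)))
           \<le> K * (2 + T) * R powr (- 1/2)" unfolding dG .
        then show "norm (Re (deriv xi (Complex 2 t) / xi (Complex 2 t)) - Re (\<Sum>a\<in>S R. of_int (zorder G a) / (Complex (3/2) t - a)))
           \<le> K * (2 + T) * R powr (- 1/2)"
          using abs_Re_le_cmod order_trans unfolding minus_complex.sel(1)[symmetric] real_norm_def by blast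
      qed (use T in auto)
      moreover have "\<psi> R 0 = 0" by (simp add: \<psi>_def)
      ultimately show ?thesis using T by (simp add: abs_minus_commute mult_ac algebra_simps)
    qed
    have "((\<lambda>R. (K * (2 + T) * T) * R powr (- 1/2)) \<longlongrightarrow> 0) at_top" by real_asymp
    then have "((\<lambda>R. \<psi> R T - (\<phi> T - \<phi> 0)) \<longlongrightarrow> 0) at_top"
      by (rule Lim_null_comparison[rotated]) (use eventually_ge_at_top[of "4 * (2 + T)"] in eventually_elim, use bd in auto)
    then show ?thesis by (simp add: LIM_zero_iff)
  qed
  show ?thesis
  proof (rule that[of C])
    show "C > 0" by (simp add: C_def add_pos_nonneg)
    show "finite {\<rho> \<in> upper_zeros. Im \<rho> < R}" for R using finU[of R] by (simp add: U_def)
    show "\<exists>L. ((\<lambda>R. \<Sum>\<rho> | \<rho> \<in> upper_zeros \<and> Im \<rho> < R. of_int (zorder zeta \<rho>) * poisson_arg (Im \<rho>) T) \<longlongrightarrow> L) at_top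
        \<and> \<bar>L - (T / 2 * ln (T / (2 * pi)) - T / 2)\<bar> \<le> C" if T: "T \<ge> 1" for T
    proof (intro exI[of _ "\<phi> T - \<phi> 0"] conjI)
      show "((\<lambda>R. \<Sum>\<rho> | \<rho> \<in> upper_zeros \<and> Im \<rho> < R. of_int (zorder zeta \<rho>) * poisson_arg (Im \<rho>) T) \<longlongrightarrow> \<phi> T - \<phi> 0) at_top"
        using lim[OF T] by (simp add: \<psi>_def U_def)
      show "\<bar>\<phi> T - \<phi> 0 - (T / 2 * ln (T / (2 * pi)) - T / 2)\<bar> \<le> C"
        using Im_xi_log_bound[OF T] by (simp add: \<phi>_def C_def)
    qed
  qed (rule mpos)
qed

section \<open>Counting the zeros\<close>

lemma arctan_diff_le:
  fixes a b :: real assumes "a \<le> b"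
  shows "arctan b - arctan a \<le> b - a"
proof (cases "a = b")
  case False
  then have "a < b" using assms by simp
  then obtain v where "arctan b - arctan a = (b - a) * inverse (1 + v\<^sup>2)"
    using MVT2[of a b arctan "\<lambda>v. inverse (1 + v\<^sup>2)"] DERIV_arctan by blast
  also have "\<dots> \<le> (b - a) * 1"
    using \<open>a < b\<close> by (intro mult_left_mono) (auto simp: inverse_le_1_iff)
  finally show ?thesis by simp
qed simp

lemma arctan_eq_inverse:
  assumes "x > 0" shows "arctan x = pi / 2 - arctan (1 / x)"
proof -
  have "arctan (inverse x) = pi / 2 - arctan x" using assms by (rule arctan_inverse)
  then show ?thesis by (simp add: inverse_eq_divide)
qed

lemma arctan_lower:
  assumes "x > 0" shows "arctan x \<ge> pi / 2 - 1 / x"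
proof -
  have "arctan (1 / x) - arctan 0 \<le> 1 / x - 0" using assms by (intro arctan_diff_le) auto
  then show ?thesis using arctan_eq_inverse[OF assms] by simp
qed

lemma poisson_arg_nonneg: "g > 0 \<Longrightarrow> t > 0 \<Longrightarrow> poisson_arg g t \<ge> 0"
proof -
  assume "g > 0" "t > 0"
  then have "arctan (- ((t - g) / (3/2))) \<le> arctan ((t + g) / (3/2))"
    by (intro arctan_monotone') (simp add: field_simps)
  then show ?thesis unfolding poisson_arg_def arctan_minus by linarith
qed

lemma poisson_arg_le_pi: "poisson_arg g t \<le> pi"
  using arctan_ubound[of "(t - g) / (3/2)"] arctan_ubound[of "(t + g) / (3/2)"]
  unfolding poisson_arg_def by linarith

text \<open>Once t exceeds g by h, both arctangents are within (3/2) / h of pi / 2.\<close>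

lemma poisson_arg_ge:
  assumes "g > 0" "h > 0" "t \<ge> g + h"
  shows "poisson_arg g t \<ge> pi - 3 / h"
proof -
  have *: "arctan (x / (3/2)) \<ge> pi / 2 - (3/2) / h" if "x \<ge> h" for x
  proof -
    have "arctan (x / (3/2)) \<ge> arctan (h / (3/2))" using that by (intro arctan_monotone') (simp add: field_simps)
    moreover have "arctan (h / (3/2)) \<ge> pi / 2 - 1 / (h / (3/2))" using assms by (intro arctan_lower) simp
    ultimately show ?thesis by simp
  qed
  have "poisson_arg g t \<ge> (pi / 2 - (3/2) / h) + (pi / 2 - (3/2) / h)"
    unfolding poisson_arg_def by (intro add_mono *) (use assms in auto)
  then show ?thesis by simp
qed

text \<open>For zeros above t the two arctangents nearly cancel. Passing to reciprocals retains the
  cancellation and gives decay like 1 / g^2 for fixed t, where separate bounds would give only 1 /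
  g.\<close>

lemma poisson_arg_le_far:
  assumes t: "0 \<le> t" "t < g"
  shows "poisson_arg g t \<le> 3 * t / ((g - t) * g)"
proof -
  have e: "(t - g) / (3/2) = - ((g - t) / (3/2))" by (simp add: field_simps)
  have "poisson_arg g t = arctan ((t + g) / (3/2)) - arctan ((g - t) / (3/2))"
    unfolding poisson_arg_def e arctan_minus by simp
  also have "\<dots> = arctan ((3/2) / (g - t)) - arctan ((3/2) / (t + g))"
  proof -
    have i: "1 / (y / (3/2)) = (3/2) / y" for y :: real by simp
    have "arctan ((t + g) / (3/2)) = pi / 2 - arctan (1 / ((t + g) / (3/2)))"
      "arctan ((g - t) / (3/2)) = pi / 2 - arctan (1 / ((g - t) / (3/2)))"
      using t by (intro arctan_eq_inverse; simp)+
    then show ?thesis unfolding i by linarith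
  qed
  also have "\<dots> \<le> (3/2) / (g - t) - (3/2) / (t + g)"
    using t by (intro arctan_diff_le divide_left_mono) auto
  also have "\<dots> = 3 * t / ((g - t) * (t + g))"
  proof -
    have "(3/2) / a - (3/2) / b = (3/2) * (b - a) / (a * b)" if "a \<noteq> 0" "b \<noteq> 0" for a b :: real
      using that by (simp add: diff_divide_distrib right_diff_distrib)
    from this[of "g - t" "t + g"] show ?thesis using t by simp
  qed
  also have "\<dots> \<le> 3 * t / ((g - t) * g)"
    using t by (intro divide_left_mono mult_left_mono) auto
  finally show ?thesis .
qed

text \<open>Pi times the smooth main term of the zero count.\<close>

definition main_arg :: "real \<Rightarrow> real" where
  "main_arg T = T / 2 * ln (T / (2 * pi)) - T / 2"

lemma has_real_derivative_main_arg:
  assumes "t > 0"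
  shows "(main_arg has_real_derivative ln (t / (2 * pi)) / 2) (at t)"
proof -
  have "((\<lambda>T. T / 2 * ln (T / (2 * pi)) - T / 2) has_real_derivative
      (1 / 2 * ln (t / (2 * pi)) + (1 / t) * (t / 2) - 1 / 2)) (at t)"
  proof (intro DERIV_diff DERIV_mult)
    show "((\<lambda>T. ln (T / (2 * pi))) has_real_derivative 1 / t) (at t)"
      using assms by (auto intro!: derivative_eq_intros)
  qed (auto intro!: derivative_eq_intros)
  then show ?thesis using assms by (simp add: main_arg_def [abs_def])
qed

text \<open>The derivative is logarithmic and hence O(T^(1/4)); over a distance sqrt T this costs
  T^(1/4 + 1/2).\<close>

lemma main_arg_increment:
  assumes T: "T \<ge> 4" and t: "t \<ge> 1" "\<bar>t - T\<bar> \<le> sqrt T"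
  shows "\<bar>main_arg t - main_arg T\<bar> \<le> 5 * T powr (3/4)"
proof -
  have sq: "sqrt T \<le> T" using T by (simp add: real_le_lsqrt power2_eq_square)
  have "norm (main_arg t - main_arg T) \<le> (5 * T powr (1/4)) * norm (t - T)"
  proof (rule field_differentiable_bound[of "{1..2*T}"])
    fix x assume x: "x \<in> {1..2*T}"
    show "(main_arg has_field_derivative ln (x / (2 * pi)) / 2) (at x within {1..2*T})"
      using x by (intro has_field_derivative_at_within[OF has_real_derivative_main_arg]) auto
    have T1: "T powr (1/4) \<ge> 1" using T powr_mono2[of "1/4" 1 T] by simp
    have lnle: "ln x \<le> 8 * T powr (1/4)"
    proof -
      have "ln x \<le> ln (2 * T)" using x by simp
      \<comment> \<open>Passing to the fourth root before using ln x <= x - 1 replaces the logarithm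
        by T^(1/4).\<close>
      also have "\<dots> = 4 * ln ((2 * T) powr (1/4))" using T by (simp add: ln_powr)
      also have "\<dots> \<le> 4 * (2 * T) powr (1/4)"
        using ln_le_minus_one[of "(2 * T) powr (1/4)"] T by simp
      also have "\<dots> \<le> 4 * (2 * T powr (1/4))"
      proof -
        have "(2::real) powr (1/4) \<le> 2 powr 1" by (intro powr_mono) auto
        then show ?thesis unfolding powr_mult by (intro mult_left_mono mult_right_mono) auto
      qed
      finally show ?thesis by simp
    qed
    have l2: "ln (2 * pi) \<le> 2" "ln (2 * pi) \<ge> 0"
    proof -
      have e_ge: "(2.7::real) \<le> exp 1" using e_approx_32 unfolding abs_le_iff by simp
      have "2 * pi \<le> 2.7 * 2.7" using pi_approx by simp
      also have "\<dots> \<le> exp 1 * exp (1::real)" using e_ge by (intro mult_mono) auto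
      also have "\<dots> = exp 2" by (simp flip: exp_add)
      finally have "ln (2 * pi) \<le> ln (exp 2)" by (intro ln_mono) auto
      then show "ln (2 * pi) \<le> 2" by simp
      show "ln (2 * pi) \<ge> 0" using pi_ge_two by simp
    qed
    have "ln (x / (2 * pi)) = ln x - ln (2 * pi)" using x ln_div[of x "2 * pi"] by auto
    moreover have "ln x \<ge> 0" using x by simp
    ultimately have "\<bar>ln (x / (2 * pi))\<bar> \<le> 10 * T powr (1/4)" using lnle l2 T1 by linarith
    then show "norm (ln (x / (2 * pi)) / 2) \<le> 5 * T powr (1/4)" by simp
  qed (use T t sq in auto)
  also have "\<dots> \<le> (5 * T powr (1/4)) * T powr (1/2)"
    using t T by (intro mult_left_mono) (auto simp: powr_half_sqrt)
  also have "\<dots> = 5 * T powr (3/4)" by (simp flip: powr_add)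
  finally show ?thesis by simp
qed

text \<open>A zero well below T contributes nearly pi to the smoothed count and one well above it
  contributes little. Evaluating at T + sqrt T and T - sqrt T therefore bounds pi N(T) from both
  sides.\<close>

lemma weighted_count_asymp:
  fixes \<gamma> m :: "'a \<Rightarrow> real"
  assumes pos: "\<And>\<rho>. \<rho> \<in> U \<Longrightarrow> \<gamma> \<rho> > 0" "\<And>\<rho>. \<rho> \<in> U \<Longrightarrow> m \<rho> \<ge> 0"
    and fin: "\<And>R. finite {\<rho> \<in> U. \<gamma> \<rho> < R}"
    and sm: "(\<lambda>\<rho>. m \<rho> * \<gamma> \<rho> powr (- 5/4)) summable_on U"
    and arg: "\<And>T. T \<ge> 1 \<Longrightarrow> \<exists>L. ((\<lambda>R. \<Sum>\<rho> | \<rho> \<in> U \<and> \<gamma> \<rho> < R. m \<rho> * poisson_arg (\<gamma> \<rho>) T) \<longlongrightarrow> L) at_top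
        \<and> \<bar>L - main_arg T\<bar> \<le> C"
  obtains C' where "\<And>T. T \<ge> 4 \<Longrightarrow> \<bar>(\<Sum>\<rho> | \<rho> \<in> U \<and> \<gamma> \<rho> < T. m \<rho>) - main_arg T / pi\<bar> \<le> C' * T powr (3/4)"
proof -
  define A where "A = (\<lambda>T. {\<rho>. \<rho> \<in> U \<and> \<gamma> \<rho> < T})"
  define N where "N = (\<lambda>T. \<Sum>\<rho>\<in>A T. m \<rho>)"
  \<comment> \<open>The only a priori information on the density of zeros; it gives N(T) <= B
    T^(5/4).\<close>
  define B where "B = (\<Sum>\<^sub>\<infinity>\<rho>\<in>U. m \<rho> * \<gamma> \<rho> powr (- 5/4))"
  have finA: "finite (A T)" for T using fin by (simp add: A_def)
  have sumB: "(\<Sum>\<rho>\<in>F. m \<rho> * \<gamma> \<rho> powr (- 5/4)) \<le> B" if "finite F" "F \<subseteq> U" for F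
    unfolding B_def using that pos by (intro finite_sum_le_infsum sm) auto
  have B0: "B \<ge> 0" using sumB[of "{}"] by simp
  define P where "P = (\<lambda>T L. ((\<lambda>R. \<Sum>\<rho>\<in>A R. m \<rho> * poisson_arg (\<gamma> \<rho>) T) \<longlongrightarrow> L) at_top \<and> \<bar>L - main_arg T\<bar> \<le> C)"
  define L where "L = (\<lambda>T. SOME l. P T l)"
  have "P T (L T)" if "T \<ge> 1" for T
    unfolding L_def by (rule someI_ex) (use arg[OF that] in \<open>simp add: P_def A_def\<close>)
  then have L: "T \<ge> 1 \<Longrightarrow> ((\<lambda>R. \<Sum>\<rho>\<in>A R. m \<rho> * poisson_arg (\<gamma> \<rho>) T) \<longlongrightarrow> L T) at_top"
    "T \<ge> 1 \<Longrightarrow> \<bar>L T - main_arg T\<bar> \<le> C" for T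
    by (auto simp: P_def)
  have C0: "C \<ge> 0" using L(2)[of 1] by simp
  have Nle: "N T \<le> B * T powr (5/4)" if T: "T > 0" for T
  proof -
    have "N T \<le> (\<Sum>\<rho>\<in>A T. (m \<rho> * \<gamma> \<rho> powr (- 5/4)) * T powr (5/4))"
      unfolding N_def
    proof (rule sum_mono)
      fix \<rho> assume "\<rho> \<in> A T"
      then have \<rho>: "\<rho> \<in> U" "\<gamma> \<rho> < T" "\<gamma> \<rho> > 0" "m \<rho> \<ge> 0" using pos by (auto simp: A_def)
      have "1 = \<gamma> \<rho> powr (- 5/4) * \<gamma> \<rho> powr (5/4)" using \<rho> by (simp flip: powr_add)
      also have "\<dots> \<le> \<gamma> \<rho> powr (- 5/4) * T powr (5/4)" using \<rho> by (intro mult_left_mono powr_mono2) auto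
      finally show "m \<rho> \<le> (m \<rho> * \<gamma> \<rho> powr (- 5/4)) * T powr (5/4)"
        unfolding mult.assoc using \<rho>(4) by (metis mult.right_neutral mult_left_mono)
    qed
    also have "\<dots> = (\<Sum>\<rho>\<in>A T. m \<rho> * \<gamma> \<rho> powr (- 5/4)) * T powr (5/4)" by (simp add: sum_distrib_right)
    also have "\<dots> \<le> B * T powr (5/4)" by (intro mult_right_mono sumB finA) (auto simp: A_def)
    finally show ?thesis .
  qed
  have main: "\<bar>N T - main_arg T / pi\<bar> \<le> (C + 3 * B + 5) * T powr (3/4)" if T: "T \<ge> 4" for T
  proof -
    \<comment> \<open>The window balances the losses: T^(5/4) / H from imperfect arctangents and H
      T^(1/4) from moving the main term are both T^(3/4).\<close>
    define H where "H = sqrt T"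
    have H: "H \<ge> 2" "H * H = T" using T by (auto simp: H_def real_le_rsqrt)
    have HT: "2 * H \<le> T" using H mult_right_mono[of 2 H H] by simp
    have Hp: "H = T powr (1/2)" using T by (simp add: H_def powr_half_sqrt)
    have T1: "T powr (3/4) \<ge> 1" using T powr_mono2[of "3/4" 1 T] by simp
    have up: "N T * (pi - 3 / H) \<le> L (T + H)"
    proof (rule tendsto_lowerbound[OF L(1)])
      show "\<forall>\<^sub>F R in at_top. N T * (pi - 3 / H) \<le> (\<Sum>\<rho>\<in>A R. m \<rho> * poisson_arg (\<gamma> \<rho>) (T + H))"
        using eventually_ge_at_top[of T]
      proof eventually_elim
        case (elim R)
        have "N T * (pi - 3 / H) = (\<Sum>\<rho>\<in>A T. m \<rho> * (pi - 3 / H))" by (simp add: N_def sum_distrib_right)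
        also have "\<dots> \<le> (\<Sum>\<rho>\<in>A T. m \<rho> * poisson_arg (\<gamma> \<rho>) (T + H))"
          using pos H by (intro sum_mono mult_left_mono poisson_arg_ge) (auto simp: A_def)
        also have "\<dots> \<le> (\<Sum>\<rho>\<in>A R. m \<rho> * poisson_arg (\<gamma> \<rho>) (T + H))"
          using pos H T elim by (intro sum_mono2 finA mult_nonneg_nonneg poisson_arg_nonneg) (auto simp: A_def)
        finally show ?case .
      qed
    qed (use T H in auto)
    have NH: "N T * (3 / H) \<le> 3 * B * T powr (3/4)"
    proof -
      have "N T * (3 / H) \<le> (B * T powr (5/4)) * (3 / H)" using Nle[of T] T H by (intro mult_right_mono) auto
      also have "\<dots> = 3 * B * (T powr (5/4) / T powr (1/2))" by (simp add: Hp)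
      also have "T powr (5/4) / T powr (1/2) = T powr (3/4)" by (simp flip: powr_diff)
      finally show ?thesis .
    qed
    have "pi * N T \<le> L (T + H) + 3 * B * T powr (3/4)" using up NH by (simp add: algebra_simps)
    also have "L (T + H) \<le> main_arg (T + H) + C" using L(2)[of "T + H"] T H by (simp add: abs_le_iff)
    also have "main_arg (T + H) \<le> main_arg T + 5 * T powr (3/4)"
      using main_arg_increment[of T "T + H"] T H by (simp add: H_def abs_le_iff)
    also have "main_arg T + 5 * T powr (3/4) + C + 3 * B * T powr (3/4) \<le> main_arg T + (C + 3 * B + 5) * T powr (3/4)"
      using mult_left_mono[OF T1 C0] by (simp add: algebra_simps)
    finally have 1: "pi * N T \<le> main_arg T + (C + 3 * B + 5) * T powr (3/4)" by simp
    \<comment> \<open>At T - H each zero below T counts for at most pi, so only the tail of zeros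
      above T has to be estimated.\<close>
    have dn: "L (T - H) \<le> pi * N T + 3 * B * T powr (3/4)"
    proof (rule tendsto_upperbound[OF L(1)])
      show "\<forall>\<^sub>F R in at_top. (\<Sum>\<rho>\<in>A R. m \<rho> * poisson_arg (\<gamma> \<rho>) (T - H)) \<le> pi * N T + 3 * B * T powr (3/4)"
        using eventually_ge_at_top[of T]
      proof eventually_elim
        case (elim R)
        have sub: "A T \<subseteq> A R" using elim by (auto simp: A_def)
        have "(\<Sum>\<rho>\<in>A R. m \<rho> * poisson_arg (\<gamma> \<rho>) (T - H)) =
          (\<Sum>\<rho>\<in>A R - A T. m \<rho> * poisson_arg (\<gamma> \<rho>) (T - H)) + (\<Sum>\<rho>\<in>A T. m \<rho> * poisson_arg (\<gamma> \<rho>) (T - H))"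
          by (rule sum.subset_diff[OF sub finA])
        also have "(\<Sum>\<rho>\<in>A T. m \<rho> * poisson_arg (\<gamma> \<rho>) (T - H)) \<le> (\<Sum>\<rho>\<in>A T. m \<rho> * pi)"
          using pos by (intro sum_mono mult_left_mono poisson_arg_le_pi) (auto simp: A_def)
        also have "\<dots> = pi * N T" by (simp add: N_def sum_distrib_left mult.commute)
        also have "(\<Sum>\<rho>\<in>A R - A T. m \<rho> * poisson_arg (\<gamma> \<rho>) (T - H)) \<le>
          (\<Sum>\<rho>\<in>A R - A T. (m \<rho> * \<gamma> \<rho> powr (- 5/4)) * (3 * T powr (3/4)))"
        proof (rule sum_mono)
          fix \<rho> assume "\<rho> \<in> A R - A T"
          then have \<rho>: "\<rho> \<in> U" "\<gamma> \<rho> \<ge> T" "m \<rho> \<ge> 0" using pos by (auto simp: A_def)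
          define g where "g = \<gamma> \<rho>"
          have g: "g \<ge> T" "g > 0" using \<rho> T by (auto simp: g_def)
          have "poisson_arg g (T - H) \<le> 3 * (T - H) / ((g - (T - H)) * g)"
            using g HT H by (intro poisson_arg_le_far) auto
          also have "\<dots> \<le> 3 * T / ((g * H / T) * g)"
          proof (rule frac_le)
            \<comment> \<open>Equality holds at g = T, and the difference grows with g; this makes
              the denominator a pure power of g.\<close>
            have "g * H / T \<le> g - (T - H)"
            proof -
              have "(g - T) * (T - H) \<ge> 0" using g HT H by (intro mult_nonneg_nonneg) auto
              then have "g * H \<le> (g - (T - H)) * T" by (simp add: algebra_simps)
              then show ?thesis using T by (simp add: divide_le_eq)
            qed
            then show "g * H / T * g \<le> (g - (T - H)) * g" using g by (intro mult_right_mono) auto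
          qed (use g T H HT in auto)
          also have "\<dots> = 3 * T powr 2 / T powr (1/2) * g powr (- 2)"
            using g T unfolding Hp by (simp add: powr_numeral powr_minus field_simps power2_eq_square)
          also have "T powr 2 = T powr (3/2) * T powr (1/2)" by (simp flip: powr_add)
          also have "3 * (T powr (3/2) * T powr (1/2)) / T powr (1/2) = 3 * T powr (3/2)" using T by simp
          \<comment> \<open>The summable power -5/4 is split off; the rest is bounded by its value
            at T and reduces T^(3/2) to T^(3/4).\<close>
          also have "g powr (- 2) = g powr (- 5/4) * g powr (- 3/4)" by (simp flip: powr_add)
          also have "3 * T powr (3/2) * (g powr (- 5/4) * g powr (- 3/4)) \<le> 3 * T powr (3/2) * (g powr (- 5/4) * T powr (- 3/4))"
            using g T by (intro mult_left_mono powr_mono2') auto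
          also have "\<dots> = g powr (- 5/4) * (3 * (T powr (3/2) * T powr (- 3/4)))" by simp
          also have "T powr (3/2) * T powr (- 3/4) = T powr (3/4)" by (simp flip: powr_add)
          finally show "m \<rho> * poisson_arg (\<gamma> \<rho>) (T - H) \<le> (m \<rho> * \<gamma> \<rho> powr (- 5/4)) * (3 * T powr (3/4))"
            unfolding g_def mult.assoc using \<rho> by (intro mult_left_mono) auto
        qed
        also have "\<dots> = (\<Sum>\<rho>\<in>A R - A T. m \<rho> * \<gamma> \<rho> powr (- 5/4)) * (3 * T powr (3/4))" by (simp add: sum_distrib_right)
        also have "\<dots> \<le> B * (3 * T powr (3/4))"
          using finA by (intro mult_right_mono sumB) (auto simp: A_def)
        finally show ?case by simp
      qed
    qed (use HT H in auto)
    have "main_arg T \<le> main_arg (T - H) + 5 * T powr (3/4)"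
      using main_arg_increment[of T "T - H"] T H HT by (simp add: H_def abs_le_iff)
    also have "main_arg (T - H) \<le> L (T - H) + C" using L(2)[of "T - H"] HT H by (simp add: abs_le_iff)
    also note dn
    finally have 2: "main_arg T \<le> pi * N T + (C + 3 * B + 5) * T powr (3/4)"
      using mult_left_mono[OF T1 C0] by (simp add: algebra_simps)
    have "\<bar>pi * N T - main_arg T\<bar> \<le> (C + 3 * B + 5) * T powr (3/4)" using 1 2 by (simp add: abs_le_iff)
    moreover have "\<bar>N T - main_arg T / pi\<bar> = \<bar>pi * N T - main_arg T\<bar> / pi"
    proof -
      have "N T - main_arg T / pi = (pi * N T - main_arg T) / pi" by (simp add: diff_divide_distrib)
      then show ?thesis by (simp add: abs_divide)
    qed
    moreover have "\<dots> \<le> \<bar>pi * N T - main_arg T\<bar> / 1"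
      using pi_ge_two by (intro divide_left_mono) auto
    ultimately show ?thesis by simp
  qed
  show ?thesis by (rule that[of "C + 3 * B + 5"]) (use main in \<open>simp add: N_def A_def\<close>)
qed

section \<open>Abel summation\<close>

lemma funpow_deriv_eq:
  fixes A :: "nat \<Rightarrow> complex \<Rightarrow> complex"
  assumes "\<And>n w. (A n has_field_derivative A (Suc n) w) (at w)"
  shows "(deriv ^^ n) (A 0) = A n"
proof (induction n)
  case (Suc n)
  have "deriv (A n) = A (Suc n)" using assms by (intro ext DERIV_imp_deriv)
  then show ?case by (simp add: Suc)
qed simp

section \<open>The transform of the main term\<close>

text \<open>With x = ln t and \<open>X = ln T\<close>, the n-th derivative in w of the integral of
  log (t / 2 pi) t^(-1-w) over [1, T]. It is entire in w, so w = 0 is no exception.\<close>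

definition main_transform :: "nat \<Rightarrow> real \<Rightarrow> complex \<Rightarrow> complex" where
  "main_transform n X w =
     integral {0..X} (\<lambda>x. of_real ((x - ln (2 * pi)) * (- x) ^ n) * exp (- (w * of_real x)))"

lemma has_field_derivative_main_transform:
  "(main_transform n X has_field_derivative main_transform (Suc n) X w) (at w)"
proof -
  have "((\<lambda>w. integral (cbox 0 X) (\<lambda>x. of_real ((x - ln (2 * pi)) * (- x) ^ n) * exp (- (w * of_real x)))) has_field_derivative
      integral (cbox 0 X) (\<lambda>x. of_real ((x - ln (2 * pi)) * (- x) ^ Suc n) * exp (- (w * of_real x)))) (at w within UNIV)"
  proof (rule leibniz_rule_field_derivative)
    show "((\<lambda>w. of_real ((x - ln (2 * pi)) * (- x) ^ n) * exp (- (w * of_real x))) has_field_derivative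
       of_real ((x - ln (2 * pi)) * (- x) ^ Suc n) * exp (- (w * of_real x))) (at w within UNIV)" for w x
      by (auto intro!: derivative_eq_intros)
    show "(\<lambda>x. of_real ((x - ln (2 * pi)) * (- x) ^ n) * exp (- (w * of_real x))) integrable_on cbox 0 X" for w :: complex
      by (intro integrable_continuous continuous_intros)
    show "continuous_on (UNIV \<times> cbox 0 X) (\<lambda>(w, x). of_real ((x - ln (2 * pi)) * (- x) ^ Suc n) * exp (- (w * of_real x)) :: complex)"
      by (auto simp: case_prod_unfold intro!: continuous_intros)
  qed auto
  then show ?thesis by (simp add: main_transform_def [abs_def])
qed

lemma has_vector_derivative_main_transform:
  assumes "0 < X"
  shows "((\<lambda>X. main_transform 0 X w) has_vector_derivative of_real (X - ln (2 * pi)) * exp (- (w * of_real X))) (at X)"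
proof -
  have "((\<lambda>X. main_transform 0 X w) has_vector_derivative of_real (X - ln (2 * pi)) * exp (- (w * of_real X))) (at X within {0..X+1})"
  proof -
    have "continuous_on {0..X+1} (\<lambda>x. of_real ((x - ln (2 * pi)) * (- x) ^ 0) * exp (- (w * of_real x)) :: complex)"
      by (intro continuous_intros)
    from integral_has_vector_derivative[OF this, of X] show ?thesis
      using assms by (simp add: main_transform_def)
  qed
  moreover have "at X within {0..X+1} = at X" using assms by (intro at_within_interior) auto
  ultimately show ?thesis by simp
qed

lemma main_transform_closed:
  assumes w: "w \<noteq> 0" and X: "X \<ge> 0"
  shows "main_transform 0 X w = (1 / w\<^sup>2 - of_real (ln (2 * pi)) / w)
    - exp (- (w * of_real X)) * ((of_real X - of_real (ln (2 * pi))) / w + 1 / w\<^sup>2)"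
proof -
  define P where "P = (\<lambda>x::real. - (exp (- (w * of_real x)) * ((of_real x - of_real (ln (2 * pi))) / w + 1 / w\<^sup>2)))"
  have "((\<lambda>x. of_real ((x - ln (2 * pi)) * (- x) ^ 0) * exp (- (w * of_real x))) has_integral (P X - P 0)) {0..X}"
  proof (rule fundamental_theorem_of_calculus[OF X])
    fix x :: real
    have "((\<lambda>z. - (exp (- (w * z)) * ((z - of_real (ln (2 * pi))) / w + 1 / w\<^sup>2))) has_field_derivative
       (of_real x - of_real (ln (2 * pi))) * exp (- (w * of_real x))) (at (of_real x))"
      using w by (auto intro!: derivative_eq_intros simp: field_simps power2_eq_square)
    then show "(P has_vector_derivative of_real ((x - ln (2 * pi)) * (- x) ^ 0) * exp (- (w * of_real x))) (at x within {0..X})"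
      unfolding P_def using has_vector_derivative_real_field by fastforce
  qed
  then have "main_transform 0 X w = P X - P 0" unfolding main_transform_def by (rule integral_unique)
  then show ?thesis by (simp add: P_def)
qed

text \<open>The limit is 2 pi times the principal part of Z at s = 1 + w; the lower limit 0 of the
  integral leaves no further constant.\<close>

lemma tendsto_main_transform:
  assumes w: "Re w > 0"
  shows "((\<lambda>X. main_transform 0 X w) \<longlongrightarrow> 1 / w\<^sup>2 - of_real (ln (2 * pi)) / w) at_top"
proof -
  have w0: "w \<noteq> 0" using w by auto
  let ?r = "\<lambda>X::real. (complex_of_real X - complex_of_real (ln (2 * pi))) / w + 1 / w\<^sup>2"
  have "((\<lambda>X. exp (- (w * of_real X)) * (?r X)) \<longlongrightarrow> 0) at_top"
  proof (rule Lim_null_comparison)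
    show "\<forall>\<^sub>F X in at_top. norm (exp (- (w * of_real X)) * (?r X))
       \<le> exp (- (Re w * X)) * ((X + ln (2 * pi)) / norm w + 1 / (norm w)\<^sup>2)"
      using eventually_ge_at_top[of 0]
    proof eventually_elim
      case (elim X)
      have l: "ln (2 * pi) \<ge> 0" using pi_ge_two by simp
      have "norm (?r X) \<le> norm ((of_real X - of_real (ln (2 * pi))) / w) + norm (1 / w\<^sup>2)"
        by (rule norm_triangle_ineq)
      also have "norm ((of_real X - of_real (ln (2 * pi))) / w) = \<bar>X - ln (2 * pi)\<bar> / norm w"
        unfolding norm_divide by (simp flip: of_real_diff)
      also have "\<dots> \<le> (X + ln (2 * pi)) / norm w"
      proof (rule divide_right_mono)
        show "\<bar>X - ln (2 * pi)\<bar> \<le> X + ln (2 * pi)" using elim l by linarith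
      qed simp
      finally have "norm (?r X) \<le> (X + ln (2 * pi)) / norm w + 1 / (norm w)\<^sup>2"
        by (simp add: norm_divide norm_power)
      then show ?case unfolding norm_mult by (intro mult_mono) (auto simp: norm_exp_eq_Re)
    qed
    show "((\<lambda>X. exp (- (Re w * X)) * ((X + ln (2 * pi)) / norm w + 1 / (norm w)\<^sup>2)) \<longlongrightarrow> 0) at_top"
      using w w0 by real_asymp
  qed
  then have "((\<lambda>X. (1 / w\<^sup>2 - of_real (ln (2 * pi)) / w) - exp (- (w * of_real X)) * (?r X))
     \<longlongrightarrow> (1 / w\<^sup>2 - of_real (ln (2 * pi)) / w) - 0) at_top"
    by (intro tendsto_diff tendsto_const)
  moreover have "\<forall>\<^sub>F X in at_top. (1 / w\<^sup>2 - of_real (ln (2 * pi)) / w) - exp (- (w * of_real X)) * (?r X) = main_transform 0 X w"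
    using eventually_ge_at_top[of 0] by eventually_elim (use main_transform_closed[OF w0] in simp)
  ultimately show ?thesis using tendsto_cong by force
qed

text \<open>At w = 0 the integrand is a polynomial, and the result divided by 2 pi is the subtracted
  term of the theorem up to the sign (-1)^n.\<close>

lemma main_transform_0:
  assumes "X \<ge> 0"
  shows "main_transform n X 0 = of_real ((-1) ^ n * (X ^ (n + 2) / (real n + 2) - ln (2 * pi) * X ^ (n + 1) / (real n + 1)))"
proof -
  define P where "P = (\<lambda>x::real. (-1) ^ n * (x ^ (n + 2) / (real n + 2) - ln (2 * pi) * x ^ (n + 1) / (real n + 1)))"
  have "((\<lambda>x. (x - ln (2 * pi)) * (- x) ^ n) has_integral (P X - P 0)) {0..X}"
  proof (rule fundamental_theorem_of_calculus[OF assms])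
    fix x :: real
    have pow: "((\<lambda>x. x ^ Suc k / (real k + 1)) has_real_derivative x ^ k) (at x within {0..X})" for k
    proof -
      have "((\<lambda>x. x ^ Suc k / (real k + 1)) has_real_derivative real (Suc k) * x ^ (Suc k - Suc 0) / (real k + 1)) (at x within {0..X})"
        by (intro DERIV_cdivide DERIV_pow)
      then show ?thesis by (simp add: add.commute)
    qed
    have 1: "((\<lambda>x. x ^ (n + 2) / (real n + 2)) has_real_derivative x ^ (n + 1)) (at x within {0..X})"
      using pow[of "n + 1"] by (simp add: add_ac)
    have 2: "((\<lambda>x. ln (2 * pi) * x ^ (n + 1) / (real n + 1)) has_real_derivative ln (2 * pi) * x ^ n) (at x within {0..X})"
      using DERIV_cmult[OF pow[of n], of "ln (2 * pi)"] by simp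
    have "(P has_real_derivative (-1) ^ n * (x ^ (n + 1) - ln (2 * pi) * x ^ n)) (at x within {0..X})"
      unfolding P_def by (intro DERIV_cmult DERIV_diff 1 2)
    also have "(-1) ^ n * (x ^ (n + 1) - ln (2 * pi) * x ^ n) = (x - ln (2 * pi)) * (- x) ^ n"
      by (subst power_minus) (simp add: algebra_simps)
    finally show "(P has_vector_derivative (x - ln (2 * pi)) * (- x) ^ n) (at x within {0..X})"
      by (simp add: has_real_derivative_iff_has_vector_derivative)
  qed
  then have "((\<lambda>x. complex_of_real ((x - ln (2 * pi)) * (- x) ^ n)) has_integral of_real (P X - P 0)) {0..X}"
    by (rule has_integral_of_real)
  then show ?thesis by (simp add: main_transform_def integral_unique P_def)
qed

section \<open>Truncated sums and their limit\<close>

text \<open>From here to the limit only weights on a locally finite set of ordinates and their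
  counting estimate matter; zeta returns when the locale is interpreted.\<close>

locale weighted_density =
  fixes U :: "'a set" and \<gamma> m :: "'a \<Rightarrow> real" and C :: real
  assumes gamma_pos: "\<And>\<rho>. \<rho> \<in> U \<Longrightarrow> \<gamma> \<rho> > 0"
    and m_nonneg: "\<And>\<rho>. \<rho> \<in> U \<Longrightarrow> m \<rho> \<ge> 0"
    and fin: "\<And>T. finite {\<rho> \<in> U. \<gamma> \<rho> < T}"
    and count: "\<And>T. T \<ge> 4 \<Longrightarrow> \<bar>(\<Sum>\<rho> | \<rho> \<in> U \<and> \<gamma> \<rho> < T. m \<rho>) - main_arg T / pi\<bar> \<le> C * T powr (3/4)"
begin

definition below :: "real \<Rightarrow> 'a set" where "below T = {\<rho>. \<rho> \<in> U \<and> \<gamma> \<rho> < T}"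

lemma finite_below [simp]: "finite (below T)"
  using fin by (simp add: below_def)

definition err :: "real \<Rightarrow> real" where "err T = (\<Sum>\<rho>\<in>below T. m \<rho>) - main_arg T / pi"

lemma err_le: "T \<ge> 4 \<Longrightarrow> \<bar>err T\<bar> \<le> C * T powr (3/4)"
  using count by (simp add: err_def below_def)

lemma C_nonneg: "C \<ge> 0"
proof -
  have "0 \<le> C * 4 powr (3/4)" using err_le[of 4] by linarith
  then show ?thesis by (simp add: zero_le_mult_iff)
qed

text \<open>Truncated sum at s = 1 + w minus its main term, entire in w. The factor (- ln
  \<gamma>)^n makes \<open>trunc n\<close> the n-th derivative of \<open>trunc 0\<close>.\<close>

definition trunc :: "nat \<Rightarrow> real \<Rightarrow> complex \<Rightarrow> complex" where
  "trunc n T w = (\<Sum>\<rho>\<in>below T. of_real (m \<rho> * (- ln (\<gamma> \<rho>)) ^ n) * exp (- ((1 + w) * of_real (ln (\<gamma> \<rho>)))))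
      - of_real (1 / (2 * pi)) * main_transform n (ln T) w"

lemma has_field_derivative_trunc: "(trunc n T has_field_derivative trunc (Suc n) T w) (at w)"
proof -
  have "((\<lambda>w. of_real (m \<rho> * (- ln (\<gamma> \<rho>)) ^ n) * exp (- ((1 + w) * of_real (ln (\<gamma> \<rho>))))) has_field_derivative
     of_real (m \<rho> * (- ln (\<gamma> \<rho>)) ^ Suc n) * exp (- ((1 + w) * of_real (ln (\<gamma> \<rho>))))) (at w)" for \<rho>
    by (auto intro!: derivative_eq_intros)
  then show ?thesis unfolding trunc_def [abs_def]
    by (intro DERIV_diff DERIV_sum DERIV_cmult has_field_derivative_main_transform)
qed

lemma higher_deriv_trunc: "(deriv ^^ n) (trunc 0 T) = trunc n T"
  by (rule funpow_deriv_eq) (rule has_field_derivative_trunc)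

lemma holomorphic_trunc: "trunc n T holomorphic_on S"
  unfolding holomorphic_on_def field_differentiable_def
  using has_field_derivative_at_within[OF has_field_derivative_trunc] by blast

text \<open>Abel summation: only the error term of the counting function survives in the increment.\<close>

lemma trunc_increment:
  fixes T V :: real and w :: complex
  assumes T: "4 \<le> T" "T \<le> V"
  defines "s \<equiv> 1 + w"
  shows "((\<lambda>t. of_real (err t - err T) * (s * exp (- ((s + 1) * of_real (ln t))))) has_integral
    (trunc 0 V w - trunc 0 T w - of_real (err V - err T) * exp (- (s * of_real (ln V))))) {T..V}"
proof -
  define e where "e = (\<lambda>t::real. exp (- (s * of_real (ln t))))"
  define k where "k = (\<lambda>t::real. s * exp (- ((s + 1) * of_real (ln t))))"
  define N where "N = (\<lambda>T. \<Sum>\<rho>\<in>below T. m \<rho>)"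
  let ?S = "\<lambda>T. \<Sum>\<rho>\<in>below T. of_real (m \<rho>) * e (\<gamma> \<rho>)"
  have k_eq: "k t = s * e t / of_real t" if "t > 0" for t
  proof -
    have "exp (- ((s + 1) * of_real (ln t))) = e t * exp (- of_real (ln t))"
      unfolding e_def exp_add[symmetric] by (simp add: algebra_simps)
    also have "exp (- complex_of_real (ln t)) = 1 / of_real t"
      using that by (simp add: exp_minus exp_of_real inverse_eq_divide flip: of_real_minus)
    finally show ?thesis by (simp add: k_def)
  qed
  have de: "(e has_vector_derivative - k t) (at t within A)" if t: "t > 0" for t A
  proof -
    have "((\<lambda>t. exp (- (s * of_real (ln t)))) has_vector_derivative (- (s * of_real (1 / t))) * exp (- (s * of_real (ln t)))) (at t within A)"
    proof (rule has_vector_derivative_at_within)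
      have "((\<lambda>t. - (s * of_real (ln t))) has_vector_derivative - (s * of_real (1 / t))) (at t)"
        using t by (auto intro!: has_vector_derivative_minus has_vector_derivative_mult_right has_vector_derivative_of_real
            simp: has_real_derivative_iff_has_vector_derivative[symmetric] intro!: derivative_eq_intros)
      from field_vector_diff_chain_at[OF this DERIV_exp]
      show "((\<lambda>t. exp (- (s * of_real (ln t)))) has_vector_derivative (- (s * of_real (1 / t))) * exp (- (s * of_real (ln t)))) (at t)"
        by (simp add: o_def)
    qed
    then show ?thesis using k_eq[OF t] by (simp add: e_def)
  qed
  \<comment> \<open>A zero at height g is counted only for t > g, \<open>below\<close> being strict;
    the point t = g is removed as a null set.\<close>
  have single: "((\<lambda>t. if g < t then k t else 0) has_integral (e g - e V)) {T..V}" if g: "T \<le> g" "g < V" for g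
  proof -
    have "((\<lambda>t. - (- k t)) has_integral - (e V - e g)) {g..V}"
      using g T by (intro has_integral_neg fundamental_theorem_of_calculus de) auto
    then have "(k has_integral (e g - e V)) {g..V}" by simp
    then have "((\<lambda>t. if t \<in> {g..V} then k t else 0) has_integral (e g - e V)) {T..V}"
      using g has_integral_restrict_closed_subinterval[of k "e g - e V" g V T V] by simp
    then show ?thesis by (rule has_integral_spike_finite[of "{g}", rotated 2]) auto
  qed
  have S: "((\<lambda>t. \<Sum>\<rho>\<in>below V - below T. of_real (m \<rho>) * (if \<gamma> \<rho> < t then k t else 0)) has_integral
      (\<Sum>\<rho>\<in>below V - below T. of_real (m \<rho>) * (e (\<gamma> \<rho>) - e V))) {T..V}"
    by (intro has_integral_sum has_integral_mult_right single finite_Diff finite_below) (auto simp: below_def)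
  have sub: "below T \<subseteq> below t" if "T \<le> t" for t using that by (auto simp: below_def)
  have S1: "(\<Sum>\<rho>\<in>below V - below T. of_real (m \<rho>) * (if \<gamma> \<rho> < t then k t else 0)) = of_real (N t - N T) * k t"
    if t: "t \<in> {T..V}" for t
  proof -
    have "(\<Sum>\<rho>\<in>below V - below T. of_real (m \<rho>) * (if \<gamma> \<rho> < t then k t else 0)) =
      (\<Sum>\<rho>\<in>below t - below T. of_real (m \<rho>) * k t)"
      using t by (intro sum.mono_neutral_cong_right finite_Diff finite_below) (auto simp: below_def)
    also have "\<dots> = of_real (\<Sum>\<rho>\<in>below t - below T. m \<rho>) * k t" by (simp add: sum_distrib_right)
    also have "(\<Sum>\<rho>\<in>below t - below T. m \<rho>) = N t - N T"
      unfolding N_def using t sub by (intro sum_diff) auto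
    finally show ?thesis .
  qed
  have S2: "(\<Sum>\<rho>\<in>below V - below T. of_real (m \<rho>) * (e (\<gamma> \<rho>) - e V)) =
     ?S V - ?S T - of_real (N V - N T) * e V"
    unfolding N_def right_diff_distrib sum_subtractf
    using sub[OF T(2)] by (simp add: sum_diff flip: sum_distrib_right)
  have I1: "((\<lambda>t. of_real (N t - N T) * k t) has_integral
     (?S V - ?S T - of_real (N V - N T) * e V)) {T..V}"
    using has_integral_eq[OF S1 S] unfolding S2 .
  define M where "M = (\<lambda>t. main_arg t / pi)"
  define F where "F = (\<lambda>t. of_real (1 / (2 * pi)) * main_transform 0 (ln t) w)"
  \<comment> \<open>The density of the main term times \<open>e\<close> is the derivative of
    \<open>F\<close>, so the product rule leaves only the term with \<open>k\<close>.\<close>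
  have I2: "((\<lambda>t. of_real (M t - M T) * k t) has_integral (F V - of_real (M V - M T) * e V) - (F T - of_real (M T - M T) * e T)) {T..V}"
  proof (rule fundamental_theorem_of_calculus[OF T(2)])
    fix t assume "t \<in> {T..V}"
    then have t: "t > 0" "t > 1" using T by auto
    have lnt: "(ln has_vector_derivative (1 / t)) (at t)"
      using t by (auto simp: has_real_derivative_iff_has_vector_derivative[symmetric] intro!: derivative_eq_intros)
    have "((\<lambda>t. main_transform 0 (ln t) w) has_vector_derivative
        (1 / t) *\<^sub>R (of_real (ln t - ln (2 * pi)) * exp (- (w * of_real (ln t))))) (at t)"
      using vector_diff_chain_at[OF lnt has_vector_derivative_main_transform[of "ln t" w]] t by (simp add: o_def)
    then have dF: "(F has_vector_derivative of_real (1 / (2 * pi)) * ((1 / t) *\<^sub>R (of_real (ln t - ln (2 * pi)) * exp (- (w * of_real (ln t)))))) (at t within {T..V})"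
      unfolding F_def by (rule has_vector_derivative_mult_right[OF has_vector_derivative_at_within])
    have dM: "((\<lambda>t. of_real (M t - M T) :: complex) has_vector_derivative of_real (ln (t / (2 * pi)) / 2 / pi - 0)) (at t within {T..V})"
      unfolding M_def
      by (intro has_vector_derivative_of_real)
         (intro DERIV_diff DERIV_cdivide DERIV_const has_field_derivative_at_within[OF has_real_derivative_main_arg[OF t(1)]])
    have "((\<lambda>t. F t - of_real (M t - M T) * e t) has_vector_derivative
       of_real (1 / (2 * pi)) * ((1 / t) *\<^sub>R (of_real (ln t - ln (2 * pi)) * exp (- (w * of_real (ln t)))))
       - (of_real (M t - M T) * (- k t) + of_real (ln (t / (2 * pi)) / 2 / pi - 0) * e t)) (at t within {T..V})"
      by (intro has_vector_derivative_diff has_vector_derivative_mult dF dM de t)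
    also have "of_real (1 / (2 * pi)) * ((1 / t) *\<^sub>R (of_real (ln t - ln (2 * pi)) * exp (- (w * of_real (ln t)))))
      = of_real (ln (t / (2 * pi)) / 2 / pi - 0) * e t"
    proof -
      have "e t = exp (- (w * of_real (ln t))) * exp (- of_real (ln t))"
        unfolding e_def s_def exp_add[symmetric] by (simp add: algebra_simps)
      also have "exp (- complex_of_real (ln t)) = of_real (1 / t)"
        using t by (simp add: exp_minus exp_of_real inverse_eq_divide flip: of_real_minus)
      finally have "e t = exp (- (w * of_real (ln t))) * of_real (1 / t)" .
      moreover have "ln (t / (2 * pi)) = ln t - ln (2 * pi)" using t ln_div[of t "2 * pi"] by auto
      ultimately show ?thesis by (simp add: scaleR_conv_of_real)
    qed
    finally show "((\<lambda>t. F t - of_real (M t - M T) * e t) has_vector_derivative of_real (M t - M T) * k t) (at t within {T..V})"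
      by simp
  qed
  have "((\<lambda>t. of_real (N t - N T) * k t - of_real (M t - M T) * k t) has_integral
     (?S V - ?S T - of_real (N V - N T) * e V
      - ((F V - of_real (M V - M T) * e V) - (F T - of_real (M T - M T) * e T)))) {T..V}"
    by (rule has_integral_diff[OF I1 I2])
  moreover have "of_real (N t - N T) * k t - of_real (M t - M T) * k t = of_real (err t - err T) * k t" for t
    by (simp add: err_def N_def M_def algebra_simps)
  moreover have "?S V - ?S T - of_real (N V - N T) * e V
      - ((F V - of_real (M V - M T) * e V) - (F T - of_real (M T - M T) * e T))
      = trunc 0 V w - trunc 0 T w - of_real (err V - err T) * e V"
    by (simp add: trunc_def err_def N_def M_def F_def e_def s_def algebra_simps)
  ultimately show ?thesis by (simp add: e_def k_def)
qed

text \<open>With Re (1 + w) >= 9/10 the error T^(3/4) wins over the kernel, whose size is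
  t^(-19/10): the integrand is O(t^(-23/20)), so the increment is O(T^(-3/20)), with a factor
  growing only linearly in w.\<close>

lemma norm_trunc_increment_le:
  assumes T: "4 \<le> T" "T \<le> V" and w: "Re w \<ge> - 1/10"
  shows "norm (trunc 0 V w - trunc 0 T w) \<le> 14 * C * (1 + norm (1 + w)) * T powr (- 3/20)"
proof -
  define s where "s = 1 + w"
  have s: "Re s \<ge> 9/10" using w by (simp add: s_def)
  define k where "k = (\<lambda>t::real. s * exp (- ((s + 1) * of_real (ln t))))"
  have nexp: "norm (exp (- (z * of_real (ln t)))) = t powr (- Re z)" if "t > 0" for t z
    using that by (simp add: norm_exp_eq_Re powr_def)
  have E: "\<bar>err t - err T\<bar> \<le> 2 * C * t powr (3/4)" if t: "t \<ge> T" for t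
  proof -
    have "\<bar>err t\<bar> \<le> C * t powr (3/4)" "\<bar>err T\<bar> \<le> C * T powr (3/4)" using err_le t T by auto
    moreover have "C * T powr (3/4) \<le> C * t powr (3/4)" using t T C_nonneg by (intro mult_left_mono powr_mono2) auto
    ultimately show ?thesis by linarith
  qed
  define B where "B = 2 * C * norm s"
  have B0: "B \<ge> 0" using C_nonneg by (simp add: B_def)
  define P where "P = (\<lambda>t. - (B * (20/3)) * t powr (- 3/20))"
  have I: "((\<lambda>t. B * t powr (- 23/20)) has_integral (P V - P T)) {T..V}"
  proof (rule fundamental_theorem_of_calculus[OF T(2)])
    fix t assume "t \<in> {T..V}"
    then have t: "t > 0" using T by auto
    have "(P has_real_derivative - (B * (20/3)) * ((- 3/20) * t powr (- 3/20 - 1))) (at t within {T..V})"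
      unfolding P_def by (intro DERIV_cmult has_field_derivative_at_within[OF has_real_derivative_powr[OF t]])
    moreover have "- (B * (20/3)) * ((- 3/20) * t powr (- 3/20 - 1)) = B * t powr (- 23/20)" by simp
    ultimately show "(P has_vector_derivative B * t powr (- 23/20)) (at t within {T..V})"
      by (simp add: has_real_derivative_iff_has_vector_derivative)
  qed
  define J where "J = trunc 0 V w - trunc 0 T w - of_real (err V - err T) * exp (- (s * of_real (ln V)))"
  have HJ: "((\<lambda>t. of_real (err t - err T) * k t) has_integral J) {T..V}"
    using trunc_increment[OF T, of w] by (simp add: k_def J_def s_def)
  have "norm (integral {T..V} (\<lambda>t. of_real (err t - err T) * k t)) \<le> integral {T..V} (\<lambda>t. B * t powr (- 23/20))"
  proof (rule integral_norm_bound_integral)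
    fix t assume "t \<in> {T..V}"
    then have t: "t \<ge> T" "t \<ge> 1" using T by auto
    have "norm (k t) = norm s * t powr (- Re s - 1)"
    proof -
      have "- Re (s + 1) = - Re s - 1" by simp
      then show ?thesis using t nexp[of t "s + 1"] unfolding k_def norm_mult by simp
    qed
    also have "\<dots> \<le> norm s * t powr (- 19/10)" using s t by (intro mult_left_mono powr_mono) auto
    finally have k: "norm (k t) \<le> norm s * t powr (- 19/10)" .
    have "norm (of_real (err t - err T) * k t) \<le> (2 * C * t powr (3/4)) * (norm s * t powr (- 19/10))"
      unfolding norm_mult norm_of_real using E[OF t(1)] k C_nonneg by (intro mult_mono) auto
    also have "\<dots> = B * (t powr (3/4) * t powr (- 19/10))" by (simp add: B_def)
    also have "t powr (3/4) * t powr (- 19/10) = t powr (- 23/20)" by (simp flip: powr_add)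
    finally show "norm (of_real (err t - err T) * k t) \<le> B * t powr (- 23/20)" .
  qed (use HJ I in auto)
  then have "norm J \<le> P V - P T" unfolding integral_unique[OF HJ] integral_unique[OF I] .
  also have "\<dots> \<le> B * (20/3) * T powr (- 3/20)" using B0 by (simp add: P_def)
  finally have 1: "norm J \<le> B * (20/3) * T powr (- 3/20)" .
  have 2: "norm (of_real (err V - err T) * exp (- (s * of_real (ln V)))) \<le> 2 * C * T powr (- 3/20)"
  proof -
    have V: "V \<ge> 1" using T by simp
    have "norm (of_real (err V - err T) * exp (- (s * of_real (ln V)))) = \<bar>err V - err T\<bar> * V powr (- Re s)"
      unfolding norm_mult norm_of_real using nexp[of V s] V by simp
    also have "\<dots> \<le> (2 * C * V powr (3/4)) * V powr (- 9/10)"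
      using E[OF T(2)] s V C_nonneg by (intro mult_mono powr_mono) auto
    also have "\<dots> = 2 * C * (V powr (3/4) * V powr (- 9/10))" by simp
    also have "V powr (3/4) * V powr (- 9/10) = V powr (- 3/20)" by (simp flip: powr_add)
    also have "2 * C * V powr (- 3/20) \<le> 2 * C * T powr (- 3/20)"
      using T C_nonneg by (intro mult_left_mono powr_mono2') auto
    finally show ?thesis .
  qed
  have "trunc 0 V w - trunc 0 T w = J + of_real (err V - err T) * exp (- (s * of_real (ln V)))" by (simp add: J_def)
  then have "norm (trunc 0 V w - trunc 0 T w) \<le> B * (20/3) * T powr (- 3/20) + 2 * C * T powr (- 3/20)"
    using norm_triangle_mono[OF 1 2] by simp
  also have "\<dots> = C * ((40/3) * norm s + 2) * T powr (- 3/20)" by (simp add: B_def algebra_simps)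
  \<comment> \<open>The integral contributes 40/3 and the boundary term 2; both are at most
    14.\<close>
  also have "\<dots> \<le> C * (14 * (1 + norm s)) * T powr (- 3/20)"
    using C_nonneg by (intro mult_right_mono mult_left_mono) auto
  finally show ?thesis by (simp add: s_def mult_ac)
qed


text \<open>The sets \<open>below T\<close> eventually contain every finite subset, so unordered
  summability gives convergence along heights.\<close>

lemma tendsto_trunc:
  assumes w: "Re w > 0"
    and sum: "((\<lambda>\<rho>. of_real (m \<rho>) * exp (- ((1 + w) * of_real (ln (\<gamma> \<rho>))))) has_sum S) U"
  shows "((\<lambda>T. trunc 0 T w) \<longlongrightarrow> S - of_real (1 / (2 * pi)) * (1 / w\<^sup>2 - of_real (ln (2 * pi)) / w)) at_top"
proof -
  have f: "filterlim below (finite_subsets_at_top U) at_top"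
    unfolding filterlim_finite_subsets_at_top
  proof (intro allI impI)
    fix X assume X: "finite X \<and> X \<subseteq> U"
    define b where "b = Max (insert 0 (\<gamma> ` X))"
    have b: "\<gamma> x \<le> b" if "x \<in> X" for x using X that by (auto simp: b_def)
    have "eventually (\<lambda>T. T > b) at_top" by (rule eventually_gt_at_top)
    then show "\<forall>\<^sub>F T in at_top. finite (below T) \<and> X \<subseteq> below T \<and> below T \<subseteq> U"
    proof eventually_elim
      case (elim T)
      then show ?case using X b finite_below[of T] by (force simp: below_def simp del: finite_below)
    qed
  qed
  have "((\<lambda>T. \<Sum>\<rho>\<in>below T. of_real (m \<rho>) * exp (- ((1 + w) * of_real (ln (\<gamma> \<rho>))))) \<longlongrightarrow> S) at_top"
    using filterlim_compose[OF sum[unfolded has_sum_def] f] .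
  moreover have "((\<lambda>T. main_transform 0 (ln T) w) \<longlongrightarrow> 1 / w\<^sup>2 - of_real (ln (2 * pi)) / w) at_top"
    by (rule filterlim_compose[OF tendsto_main_transform[OF w] ln_at_top])
  ultimately show ?thesis unfolding trunc_def by (auto intro!: tendsto_intros)
qed

text \<open>The limit \<open>l\<close> of the truncations is holomorphic across w = 0 and agrees
  with Z minus its principal part for Re w > 0, hence on the whole punctured half plane. Its
  derivatives at 0 are the coefficients, and the uniform rate passes to derivatives.\<close>

theorem trunc_tendsto_laurent_coeff:
  fixes Z :: "complex \<Rightarrow> complex" and c :: "nat \<Rightarrow> complex"
  assumes Z: "Z holomorphic_on {w. Re w > - 1/10} - {0}"
    and sum: "\<And>w. Re w > 0 \<Longrightarrow> ((\<lambda>\<rho>. of_real (m \<rho>) * exp (- ((1 + w) * of_real (ln (\<gamma> \<rho>))))) has_sum Z w) U"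
    and laurent: "\<forall>\<^sub>F w in at 0. (\<lambda>k. c k * (w ^ k / fact k)) sums
        (Z w - of_real (1 / (2 * pi)) * (1 / w\<^sup>2 - of_real (ln (2 * pi)) / w))"
  shows "((\<lambda>T. trunc n T 0) \<longlongrightarrow> c n) at_top"
proof -
  define V where "V = {w::complex. Re w > - 1/10}"
  have V: "open V" unfolding V_def by (rule open_halfspace_Re_gt)
  define R where "R = (\<lambda>w. Z w - of_real (1 / (2 * pi)) * (1 / w\<^sup>2 - of_real (ln (2 * pi)) / w))"
  \<comment> \<open>A sequence of heights suffices to define the limit; \<open>near\<close> recovers
    the rate for all real T. It starts at 4, where the counting estimate does.\<close>
  define l where "l = (\<lambda>w. lim (\<lambda>j. trunc 0 (4 + real j) w))"
  define b where "b = (\<lambda>w::complex. 14 * C * (1 + norm (1 + w)))"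
  have b0: "b w \<ge> 0" for w using C_nonneg by (simp add: b_def)
  have pw: "((\<lambda>T::real. T powr (- 3/20)) \<longlongrightarrow> 0) at_top" by real_asymp
  have seq: "(\<lambda>j. trunc 0 (4 + real j) w) \<longlonglongrightarrow> l w" if w: "w \<in> V" for w
  proof -
    have "Cauchy (\<lambda>j. trunc 0 (4 + real j) w)"
    proof (rule metric_CauchyI)
      fix \<epsilon> :: real assume \<epsilon>: "\<epsilon> > 0"
      have "(\<lambda>j. (b w + 1) * (4 + real j) powr (- 3/20)) \<longlonglongrightarrow> 0" by real_asymp
      then have "eventually (\<lambda>j. (b w + 1) * (4 + real j) powr (- 3/20) < \<epsilon>) sequentially"
        using \<epsilon> by (rule order_tendstoD)
      then obtain M where M: "\<And>j. j \<ge> M \<Longrightarrow> (b w + 1) * (4 + real j) powr (- 3/20) < \<epsilon>"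
        by (auto simp: eventually_sequentially)
      have *: "norm (trunc 0 (4 + real j) w - trunc 0 (4 + real i) w) < \<epsilon>" if "M \<le> i" "i \<le> j" for i j
      proof -
        have "norm (trunc 0 (4 + real j) w - trunc 0 (4 + real i) w) \<le> b w * (4 + real i) powr (- 3/20)"
          unfolding b_def using that w by (intro norm_trunc_increment_le) (auto simp: V_def)
        also have "\<dots> \<le> (b w + 1) * (4 + real i) powr (- 3/20)" by (intro mult_right_mono) auto
        also have "\<dots> < \<epsilon>" using M that by auto
        finally show ?thesis .
      qed
      have "dist (trunc 0 (4 + real i) w) (trunc 0 (4 + real j) w) < \<epsilon>" if "i \<ge> M" "j \<ge> M" for i j
        using *[of i j] *[of j i] that by (cases "i \<le> j") (auto simp: dist_norm norm_minus_commute)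
      then show "\<exists>M. \<forall>i\<ge>M. \<forall>j\<ge>M. dist (trunc 0 (4 + real i) w) (trunc 0 (4 + real j) w) < \<epsilon>" by blast
    qed
    then show ?thesis unfolding l_def by (simp add: Cauchy_convergent_iff convergent_LIMSEQ_iff)
  qed
  have near: "norm (trunc 0 T w - l w) \<le> b w * T powr (- 3/20)" if w: "w \<in> V" and T: "T \<ge> 4" for w T
  proof (rule tendsto_upperbound)
    show "(\<lambda>j. norm (trunc 0 T w - trunc 0 (4 + real j) w)) \<longlonglongrightarrow> norm (trunc 0 T w - l w)"
      by (intro tendsto_intros seq w)
    show "\<forall>\<^sub>F j in sequentially. norm (trunc 0 T w - trunc 0 (4 + real j) w) \<le> b w * T powr (- 3/20)"
      using eventually_ge_at_top[of "nat \<lceil>T\<rceil>"]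
    proof eventually_elim
      case (elim j)
      have "norm (trunc 0 (4 + real j) w - trunc 0 T w) \<le> b w * T powr (- 3/20)"
        unfolding b_def
      proof (rule norm_trunc_increment_le[OF T])
        show "T \<le> 4 + real j" using elim by linarith
      qed (use w in \<open>simp add: V_def\<close>)
      then show ?case by (simp add: norm_minus_commute)
    qed
  qed simp
  have holl: "l holomorphic_on V"
  proof (rule holomorphic_uniform_sequence[OF V])
    show "trunc 0 (4 + real j) holomorphic_on V" for j by (rule holomorphic_trunc)
    fix x assume x: "x \<in> V"
    then obtain d where d: "d > 0" "cball x d \<subseteq> V" using V open_contains_cball by blast
    define K where "K = 14 * C * (2 + norm x + d)"
    have "uniform_limit (cball x d) (\<lambda>j. trunc 0 (4 + real j)) l sequentially"
    proof (rule uniform_limitI)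
      fix \<epsilon> :: real assume \<epsilon>: "\<epsilon> > 0"
      have "(\<lambda>j. (K + 1) * (4 + real j) powr (- 3/20)) \<longlonglongrightarrow> 0" by real_asymp
      then have "eventually (\<lambda>j. (K + 1) * (4 + real j) powr (- 3/20) < \<epsilon>) sequentially"
        using \<epsilon> by (rule order_tendstoD)
      then show "\<forall>\<^sub>F j in sequentially. \<forall>w\<in>cball x d. dist (trunc 0 (4 + real j) w) (l w) < \<epsilon>"
      proof eventually_elim
        case (elim j)
        show ?case
        proof
          fix w assume w: "w \<in> cball x d"
          have "norm (1 + w) \<le> 1 + norm x + d"
            using w norm_triangle_ineq[of 1 w] norm_triangle_ineq2[of w x] by (simp add: dist_norm norm_minus_commute)
          then have "b w \<le> K" using C_nonneg by (simp add: b_def K_def mult_left_mono)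
          have "dist (trunc 0 (4 + real j) w) (l w) \<le> b w * (4 + real j) powr (- 3/20)"
            unfolding dist_norm using w d by (intro near) auto
          also have "\<dots> \<le> (K + 1) * (4 + real j) powr (- 3/20)" using \<open>b w \<le> K\<close> by (intro mult_right_mono) auto
          finally show "dist (trunc 0 (4 + real j) w) (l w) < \<epsilon>" using elim by simp
        qed
      qed
    qed
    then show "\<exists>d>0. cball x d \<subseteq> V \<and> uniform_limit (cball x d) (\<lambda>j. trunc 0 (4 + real j)) l sequentially"
      using d by blast
  qed
  have holR: "R holomorphic_on V - {0}"
    unfolding R_def using Z by (intro holomorphic_intros) (auto simp: V_def)
  have l_R: "l w = R w" if "w \<in> V - {0}" for w
  proof (rule analytic_continuation_open[where s = "{w. Re w > 0}" and s' = "V - {0}" and f = l and g = R])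
    show "open {w. Re w > 0}" by (rule open_halfspace_Re_gt)
    show "open (V - {0})" using V by auto
    have "1 \<in> {w. Re w > 0}" by simp
    then show "{w. Re w > 0} \<noteq> {}" by blast
    have "convex V" unfolding V_def by (rule convex_halfspace_Re_gt)
    then show "connected (V - {0})" using V by (intro connected_open_delete convex_connected) auto
    show "l holomorphic_on V - {0}" using holl by (rule holomorphic_on_subset) auto
    fix w assume "w \<in> {w. Re w > 0}"
    then have w: "Re w > 0" "w \<in> V" by (auto simp: V_def)
    have "((\<lambda>T. trunc 0 T w) \<longlongrightarrow> R w) at_top"
      unfolding R_def by (rule tendsto_trunc[OF w(1) sum[OF w(1)]])
    moreover have "filterlim (\<lambda>j. 4 + real j) at_top sequentially" by real_asymp
    ultimately have "(\<lambda>j. trunc 0 (4 + real j) w) \<longlonglongrightarrow> R w" by (rule filterlim_compose)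
    then show "l w = R w" using seq[OF w(2)] LIMSEQ_unique by blast
  qed (use that holR in \<open>auto simp: V_def\<close>)
  have zV: "0 \<in> V" by (simp add: V_def)
  have cV: "cball 0 (1/20) \<subseteq> V"
  proof
    fix w :: complex assume "w \<in> cball 0 (1/20)"
    then show "w \<in> V" using abs_Re_le_cmod[of w] by (simp add: V_def)
  qed
  have sums0: "(\<lambda>k. c k * (0 ^ k / fact k)) sums c 0"
    using sums_single[of 0 c] by (rule back_subst[where P = "\<lambda>f. f sums c 0"]) (auto simp: fun_eq_iff)
  have "l has_fps_expansion Abs_fps (\<lambda>k. c k / fact k)"
  proof (rule has_fps_expansionI)
    \<comment> \<open>The expansion is assumed only off 0. Giving \<open>l\<close> the value of the
      series there yields a continuous function, and continuity of \<open>l\<close> shows that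
      nothing was changed.\<close>
    define g where "g = (\<lambda>w. if w = 0 then c 0 else l w)"
    have "eventually (\<lambda>w. w \<in> V) (nhds 0)" using V zV by (rule eventually_nhds_in_open)
    with laurent have "\<forall>\<^sub>F w in at 0. (\<lambda>k. c k * (w ^ k / fact k)) sums l w"
      unfolding eventually_at_filter
      by eventually_elim (auto simp: l_R R_def)
    then have ev: "\<forall>\<^sub>F w in nhds 0. (\<lambda>k. c k * (w ^ k / fact k)) sums g w"
      unfolding eventually_at_filter by eventually_elim (use sums0 in \<open>auto simp: g_def\<close>)
    then have "g has_fps_expansion Abs_fps (\<lambda>k. c k / fact k)"
      by (intro has_fps_expansionI) simp
    then have "isCont g 0" by (rule has_fps_expansion_imp_continuous)
    then have "(g \<longlongrightarrow> c 0) (at 0)" by (simp add: isCont_def g_def)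
    then have "(l \<longlongrightarrow> c 0) (at 0)"
      by (rule Lim_transform_eventually) (auto simp: g_def eventually_at_filter)
    moreover have "(l \<longlongrightarrow> l 0) (at 0)"
      using holomorphic_on_imp_continuous_on[OF holl] V zV by (simp add: continuous_on_eq_continuous_at isCont_def)
    ultimately have "l 0 = c 0" using LIM_unique by blast
    then have "g = l" by (auto simp: g_def)
    then show "\<forall>\<^sub>F u in nhds 0. (\<lambda>k. fps_nth (Abs_fps (\<lambda>k. c k / fact k)) k * u ^ k) sums l u"
      using ev by simp
  qed
  then have "(deriv ^^ n) l 0 / fact n = c n / fact n"
    using fps_nth_fps_expansion[of l "Abs_fps (\<lambda>k. c k / fact k)" n] by simp
  then have dl: "(deriv ^^ n) l 0 = c n" by simp
  \<comment> \<open>On the circle of radius 1/20 one has norm (1 + x) <= 2, so \<open>b x\<close> is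
    at most 14 * C * 3.\<close>
  define K where "K = 14 * C * 3"
  have bound: "norm (trunc n T 0 - c n) \<le> fact n * (K * T powr (- 3/20)) / (1/20) ^ n" if T: "T \<ge> 4" for T
  proof -
    have "norm ((deriv ^^ n) (\<lambda>w. trunc 0 T w - l w) 0) \<le> fact n * (K * T powr (- 3/20)) / (1/20) ^ n"
    proof (rule Cauchy_inequality)
      have "(\<lambda>w. trunc 0 T w - l w) holomorphic_on V" by (intro holomorphic_intros holomorphic_trunc holl)
      then have h: "(\<lambda>w. trunc 0 T w - l w) holomorphic_on cball 0 (1/20)" using cV by (rule holomorphic_on_subset)
      then show "(\<lambda>w. trunc 0 T w - l w) holomorphic_on ball 0 (1/20)"
        by (rule holomorphic_on_subset) (rule ball_subset_cball)
      show "continuous_on (cball 0 (1/20)) (\<lambda>w. trunc 0 T w - l w)" using h by (rule holomorphic_on_imp_continuous_on)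
      fix x :: complex assume x: "norm (0 - x) = 1/20"
      then have xV: "x \<in> V" using cV by auto
      have "norm (1 + x) \<le> 2" using x norm_triangle_ineq[of 1 x] by simp
      then have "b x \<le> K" unfolding b_def K_def using C_nonneg by (intro mult_left_mono) auto
      then show "norm (trunc 0 T x - l x) \<le> K * T powr (- 3/20)"
        using near[OF xV T] mult_right_mono[of "b x" K "T powr (- 3/20)"] by simp
    qed simp
    moreover have "(deriv ^^ n) (\<lambda>w. trunc 0 T w - l w) 0 = (deriv ^^ n) (trunc 0 T) 0 - (deriv ^^ n) l 0"
      by (rule higher_deriv_diff[OF holomorphic_trunc holl V zV])
    ultimately show ?thesis by (simp add: higher_deriv_trunc dl)
  qed
  have "((\<lambda>T. fact n * (K * T powr (- 3/20)) / (1/20) ^ n) \<longlongrightarrow> fact n * (K * 0) / (1/20) ^ n) at_top"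
    by (intro tendsto_intros pw) simp
  then have "((\<lambda>T. fact n * (K * T powr (- 3/20)) / (1/20) ^ n) \<longlongrightarrow> 0) at_top" by simp
  then have "((\<lambda>T. trunc n T 0 - c n) \<longlongrightarrow> 0) at_top"
    by (rule Lim_null_comparison[rotated]) (use eventually_ge_at_top[of 4] in eventually_elim, use bound in auto)
  then show ?thesis by (simp add: LIM_zero_iff)
qed

end

lemma inverse_powr_eq_exp:
  assumes "x > 0"
  shows "1 / complex_of_real x powr s = exp (- (s * of_real (ln x)))"
  using assms by (simp add: powr_def Ln_of_real exp_minus inverse_eq_divide)

theorem theorem1:
  fixes Z :: "complex \<Rightarrow> complex" and C :: "nat \<Rightarrow> complex" and n :: nat
  assumes RH: "riemann_hypothesis"
    and Z: "is_secondary_zeta Z"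
    and laurent: "\<forall>\<^sub>F s in at 1.
      (\<lambda>k. C k * ((s - 1) ^ k / fact k)) sums
        (Z s - (1 / (2 * of_real pi * (s - 1)\<^sup>2)
                 - of_real (ln (2 * pi)) / (2 * of_real pi * (s - 1))))"
  shows "((\<lambda>T::real. complex_of_real ((-1) ^ n *
            (zero_sum (\<lambda>\<gamma>. ln \<gamma> ^ n / \<gamma>) T
             - 1 / (2 * pi * (real n + 1) * (real n + 2)) * ln T ^ (n + 1)
               * ln (T ^ (n + 1) / (2 * pi) ^ (n + 2))))) \<longlongrightarrow> C n) at_top"
proof -
  define m where "m = (\<lambda>\<rho>. real_of_int (zorder zeta \<rho>))"
  obtain C0 where C0: "C0 > 0"
    "\<And>R. finite {\<rho> \<in> upper_zeros. Im \<rho> < R}"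
    "\<And>\<rho>. \<rho> \<in> upper_zeros \<Longrightarrow> zorder zeta \<rho> > 0"
    "\<And>T. T \<ge> 1 \<Longrightarrow> \<exists>L. ((\<lambda>R. \<Sum>\<rho> | \<rho> \<in> upper_zeros \<and> Im \<rho> < R. of_int (zorder zeta \<rho>) * poisson_arg (Im \<rho>) T) \<longlongrightarrow> L) at_top
        \<and> \<bar>L - (T / 2 * ln (T / (2 * pi)) - T / 2)\<bar> \<le> C0"
    by (rule xi_zero_arg_sum[OF RH], rule that) auto
  have pos: "Im \<rho> > 0" "m \<rho> \<ge> 0" if "\<rho> \<in> upper_zeros" for \<rho>
    using that C0(3)[OF that] by (auto simp: upper_zeros_def m_def)
  have sum: "((\<lambda>\<rho>. of_real (m \<rho>) * exp (- (s * of_real (ln (Im \<rho>))))) has_sum Z s) upper_zeros" if "Re s > 1" for s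
  proof -
    have "((\<lambda>\<rho>. of_int (zorder zeta \<rho>) * (1 / of_real (Im \<rho>) powr s)) has_sum Z s) upper_zeros"
      using Z that by (simp add: is_secondary_zeta_def)
    then show ?thesis
      by (rule has_sum_cong[THEN iffD1, rotated]) (simp add: inverse_powr_eq_exp pos(1) m_def)
  qed
  \<comment> \<open>Absolute convergence at s = 5/4 supplies the a priori density bound for the
    count.\<close>
  have sm: "(\<lambda>\<rho>. m \<rho> * Im \<rho> powr (- 5/4)) summable_on upper_zeros"
  proof -
    have "(\<lambda>\<rho>. of_real (m \<rho>) * exp (- (of_real (5/4) * of_real (ln (Im \<rho>)))) :: complex) summable_on upper_zeros"
      using sum[of "of_real (5/4)"] by (intro has_sum_imp_summable) simp
    then have "(\<lambda>\<rho>. Re (of_real (m \<rho>) * exp (- (of_real (5/4) * of_real (ln (Im \<rho>)))))) summable_on upper_zeros"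
      by (rule summable_on_Re)
    then show ?thesis
    proof (rule summable_on_cong[THEN iffD1, rotated])
      fix \<rho> assume "\<rho> \<in> upper_zeros"
      then have "Im \<rho> > 0" by (rule pos)
      moreover have "exp (- (of_real (5/4) * of_real (ln (Im \<rho>)))) = complex_of_real (exp (- 5/4 * ln (Im \<rho>)))"
        by (simp flip: exp_of_real)
      ultimately show "Re (of_real (m \<rho>) * exp (- (of_real (5/4) * of_real (ln (Im \<rho>))))) = m \<rho> * Im \<rho> powr (- 5/4)"
        by (simp add: powr_def)
    qed
  qed
  obtain C' where C': "\<And>T. T \<ge> 4 \<Longrightarrow> \<bar>(\<Sum>\<rho> | \<rho> \<in> upper_zeros \<and> Im \<rho> < T. m \<rho>) - main_arg T / pi\<bar> \<le> C' * T powr (3/4)"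
  proof (rule weighted_count_asymp[of upper_zeros Im m C0])
    show "\<exists>L. ((\<lambda>R. \<Sum>\<rho> | \<rho> \<in> upper_zeros \<and> Im \<rho> < R. m \<rho> * poisson_arg (Im \<rho>) T) \<longlongrightarrow> L) at_top
        \<and> \<bar>L - main_arg T\<bar> \<le> C0" if "T \<ge> 1" for T
      using C0(4)[OF that] by (simp add: m_def main_arg_def)
  qed (use pos C0(2) sm in auto)
  interpret weighted_density upper_zeros Im m C'
    by unfold_locales (use pos C0(2) C' in auto)
  have "((\<lambda>T. trunc n T 0) \<longlongrightarrow> C n) at_top"
  proof (rule trunc_tendsto_laurent_coeff[where Z = "\<lambda>w. Z (1 + w)"])
    have "(Z \<circ> (\<lambda>w. 1 + w)) holomorphic_on {w. Re w > - 1/10} - {0}"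
    proof (rule holomorphic_on_compose_gen)
      show "Z holomorphic_on - insert 1 (range (\<lambda>k::nat. - of_nat (2 * k + 1)))"
        using Z by (simp add: is_secondary_zeta_def)
      show "(\<lambda>w. 1 + w) ` ({w. Re w > - 1/10} - {0}) \<subseteq> - insert 1 (range (\<lambda>k::nat. - of_nat (2 * k + 1)))"
      proof (rule image_subsetI)
        fix w :: complex assume w: "w \<in> {w. Re w > - 1/10} - {0}"
        have "1 + w \<noteq> - of_nat (2 * k + 1)" for k :: nat
        proof
          assume "1 + w = - of_nat (2 * k + 1)"
          then have "Re (1 + w) = - real (2 * k + 1)" by (metis Re_complex_of_real of_real_minus of_real_of_nat_eq)
          then show False using w by simp
        qed
        then show "1 + w \<in> - insert 1 (range (\<lambda>k::nat. - of_nat (2 * k + 1)))" using w by auto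
      qed
    qed (intro holomorphic_intros)
    then show "(\<lambda>w. Z (1 + w)) holomorphic_on {w. Re w > - 1/10} - {0}" by (simp add: o_def)
    show "((\<lambda>\<rho>. of_real (m \<rho>) * exp (- ((1 + w) * of_real (ln (Im \<rho>))))) has_sum Z (1 + w)) upper_zeros"
      if "Re w > 0" for w using that by (intro sum) simp
    have "\<forall>\<^sub>F w in at 0. (\<lambda>k. C k * (((w + 1) - 1) ^ k / fact k)) sums
        (Z (w + 1) - (1 / (2 * of_real pi * ((w + 1) - 1)\<^sup>2) - of_real (ln (2 * pi)) / (2 * of_real pi * ((w + 1) - 1))))"
      using laurent unfolding at_to_0[of "1::complex"] eventually_filtermap .
    then show "\<forall>\<^sub>F w in at 0. (\<lambda>k. C k * (w ^ k / fact k)) sums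
        (Z (1 + w) - of_real (1 / (2 * pi)) * (1 / w\<^sup>2 - of_real (ln (2 * pi)) / w))"
    proof eventually_elim
      case (elim w)
      have "1 / (2 * of_real pi * w\<^sup>2) - of_real (ln (2 * pi)) / (2 * of_real pi * w)
        = of_real (1 / (2 * pi)) * (1 / w\<^sup>2 - of_real (ln (2 * pi)) / w)"
        by (simp add: right_diff_distrib)
      then show ?case using elim by (simp add: add.commute)
    qed
  qed
  moreover have "\<forall>\<^sub>F T in at_top. trunc n T 0 = complex_of_real ((-1) ^ n *
            (zero_sum (\<lambda>\<gamma>. ln \<gamma> ^ n / \<gamma>) T
             - 1 / (2 * pi * (real n + 1) * (real n + 2)) * ln T ^ (n + 1)
               * ln (T ^ (n + 1) / (2 * pi) ^ (n + 2))))"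
    using eventually_ge_at_top[of 1]
  proof eventually_elim
    case (elim T)
    have "(\<Sum>\<rho>\<in>below T. of_real (m \<rho> * (- ln (Im \<rho>)) ^ n) * exp (- ((1 + 0) * of_real (ln (Im \<rho>)))))
      = (\<Sum>\<rho>\<in>below T. complex_of_real ((-1) ^ n * (m \<rho> * (ln (Im \<rho>) ^ n / Im \<rho>))))"
    proof (rule sum.cong[OF refl])
      fix \<rho> assume "\<rho> \<in> below T"
      then have g: "Im \<rho> > 0" using pos(1) by (auto simp: below_def)
      have "exp (- ((1 + 0) * of_real (ln (Im \<rho>)))) = complex_of_real (1 / Im \<rho>)"
        using inverse_powr_eq_exp[OF g, of 1] by simp
      moreover have "(- ln (Im \<rho>)) ^ n = (-1) ^ n * ln (Im \<rho>) ^ n" by (rule power_minus)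
      ultimately show "of_real (m \<rho> * (- ln (Im \<rho>)) ^ n) * exp (- ((1 + 0) * of_real (ln (Im \<rho>))))
        = complex_of_real ((-1) ^ n * (m \<rho> * (ln (Im \<rho>) ^ n / Im \<rho>)))" by simp
    qed
    also have "\<dots> = of_real ((-1) ^ n * zero_sum (\<lambda>\<gamma>. ln \<gamma> ^ n / \<gamma>) T)"
      unfolding zero_sum_def m_def below_def sum_distrib_left of_real_sum ..
    finally have 1: "(\<Sum>\<rho>\<in>below T. of_real (m \<rho> * (- ln (Im \<rho>)) ^ n) * exp (- ((1 + 0) * of_real (ln (Im \<rho>)))))
      = complex_of_real ((-1) ^ n * zero_sum (\<lambda>\<gamma>. ln \<gamma> ^ n / \<gamma>) T)" .
    have "T ^ (n + 1) > 0" "(2 * pi) ^ (n + 2) > 0" using elim by auto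
    then have "ln (T ^ (n + 1) / (2 * pi) ^ (n + 2)) = ln (T ^ (n + 1)) - ln ((2 * pi) ^ (n + 2))" using ln_div by auto
    also have "\<dots> = (real n + 1) * ln T - (real n + 2) * ln (2 * pi)"
      using elim by (simp only: ln_realpow) (simp add: algebra_simps)
    finally have l: "ln (T ^ (n + 1) / (2 * pi) ^ (n + 2)) = (real n + 1) * ln T - (real n + 2) * ln (2 * pi)" .
    \<comment> \<open>With p = n + 1 and q = n + 2 this merges the two monomials of the main term
      into the single product with the logarithm of a quotient.\<close>
    have a: "1 / (2 * pi * p * q) * Y * (p * X - q * L) = 1 / (2 * pi) * (X * Y / q - L * Y / p)"
      if "p > 0" "q > 0" for p q X Y L :: real using that by (simp add: field_simps)
    have 2: "1 / (2 * pi) * (ln T ^ (n + 2) / (real n + 2) - ln (2 * pi) * ln T ^ (n + 1) / (real n + 1))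
       = 1 / (2 * pi * (real n + 1) * (real n + 2)) * ln T ^ (n + 1) * ln (T ^ (n + 1) / (2 * pi) ^ (n + 2))"
      unfolding l by (subst a) auto
    show ?case
      unfolding trunc_def 1 main_transform_0[OF ln_ge_zero[OF elim]] of_real_mult[symmetric] of_real_diff[symmetric] 2[symmetric]
      by (rule arg_cong[where f = of_real]) (simp only: right_diff_distrib mult_ac)
  qed
  ultimately show ?thesis using tendsto_cong by fast
qed

end
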